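(* The colax morphism of 2-monads $(\mathrm{Dom},\kappa)$ from $\mathbb C$ to $\mathbb S$ and the comparison isomorphism $\Gamma\colon\mathbf{SCoFib}\to\mathbf{Alg}_{\mathrm s}(\mathbb C)$, $P\mapsto(P,L^P)$, determine a strict 2-functor $$\mathsf{Fact}:=\kappa^*\Gamma\colon\mathbf{SCoFib}\longrightarrow\mathbf{Alg}_{\mathrm s}(\mathbb S)$$ such that (besides $\mathsf{Fact}=\kappa^*\Gamma$) $U_{\mathbb S}\,\mathsf{Fact}=\mathrm{Dom}\,U$ strictly, where $U\colon\mathbf{SCoFib}\to\mathbf{CAT}^{\mathbf 2}$ and $U_{\mathbb S}\colon\mathbf{Alg}_{\mathrm s}(\mathbb S)\to\mathbf{CAT}$ are the forgetful 2-functors. More explicitly, if $P\colon E\to B$ is a split cofibration, then $\mathsf{Fact}(P)$ has action $F^P:=L^P\kappa_P\colon E^{\mathbf 2}\to E$. For $f\colon x\to y$ and a commutative square $(r,s)\colon f\to g$, where $g\colon x'\to y'$, one has $$F^P(f)=(Pf)_!x,\qquad PF^P(r,s)=Ps,\qquad F^P(r,s)\,\delta^x_{Pf}=\delta^{x'}_{Pg}\,r,$$ and moreover $\nu_g\,F^P(r,s)=s\,\nu_f$, so that $(r,F^P(r,s),s)$ is a morphism from the factorization $x\xrightarrow{\delta^x_{Pf}}(Pf)_!x\xrightarrow{\nu_f}y$ to the factorization $x'\xrightarrow{\delta^{x'}_{Pg}}(Pg)_!x'\xrightarrow{\nu_g}y'$. The factorization of $f$ selected by this algebra is $$f=\nu_f\,\delta^x_{Pf},\qquad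 P\nu_f=1_{Py}.$$ On a strictly cleavage-preserving square $(T,S)\colon P\to Q$, the 2-functor $\mathsf{Fact}$ acts by the total functor $T$, and $TF^P=F^QT^{\mathbf 2}$; in particular $$T\delta^x_{Pf}=\delta^{Tx}_{Q(Tf)},\qquad T\nu_f=\nu_{Tf}.$$ On a 2-cell $(\beta,\alpha)\colon(T,S)\Rightarrow(T',S')$ it acts by $\beta$, and $\beta F^P=F^Q\beta^{\mathbf 2}$.
   Context: $\mathbf{CAT}$ is the strict 2-category of locally small categories, functors and natural transformations. $\mathbf{CAT}^{\mathbf 2}$ is the strict arrow 2-category: objects are functors $P\colon E\to B$; a 1-cell (square) $(T,S)\colon P\to Q$, with $Q\colon F\to C$, is a pair of functors with $QT=SP$; a 2-cell $(\beta,\alpha)\colon(T,S)\Rightarrow(T',S')$ is a pair of natural transformations with $Q\beta=\alpha P$. $\mathrm{Dom}\colon\mathbf{CAT}^{\mathbf 2}\to\mathbf{CAT}$ sends $P\colon E\to B$ to $E$, $(T,S)$ to $T$, $(\beta,\alpha)$ to $\beta$. **Split cofibrations.** For $P\colon E\to B$, an arrow $e\colon x\to y$ of $E$ is $P$-cocartesian if for all $g\colon x\to z$ and $v\colon Py\to Pz$ with $Pg=v\,Pe$ there is a unique $h\colon y\to z$ with $he=g$, $Ph=v$. A cleavage chooses, for each $x\in E$ and $u\colon Px\to b$, a $P$-cocartesian arrow $\delta^x_u\colon x\to u_!x$ with $P\delta^x_u=u$. For $u\colon a\to b$ it induces a functor $u_!\colon E_a\to E_b$ between fibres by $(u_!f)\delta^x_u=\delta^y_uf$,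 $u_!f$ vertical (sent to an identity by $P$). It is split if $\delta^x_{1_{Px}}=1_x$ and $(vu)_!=v_!u_!$, $\delta^x_{vu}=\delta^{u_!x}_v\delta^x_u$ whenever defined. A split cofibration is a functor with a split cleavage. For $f\colon x\to y$ in $E$, $\nu_f\colon(Pf)_!x\to y$ is the unique arrow with $\nu_f\delta^x_{Pf}=f$ and $P\nu_f=1_{Py}$. $\mathbf{SCoFib}$ has split cofibrations as objects, squares $(T,S)\colon P\to Q$ with $T\delta^x_u=\delta^{Tx}_{Su}$ for all $x,u$ as 1-cells, and all 2-cells of $\mathbf{CAT}^{\mathbf 2}$ between them. **Comma 2-monad $\mathbb C$ on $\mathbf{CAT}^{\mathbf 2}$.** $P\downarrow B$ has objects $(x,u)$ with $x\in E$, $u\colon Px\to b$; an arrow $(f,v)\colon(x,u)\to(y,w)$ consists of $f\colon x\to y$, $v\colon b\to c$ with $vu=w\,Pf$. $\mathbb CP=\mathrm{Cod}_P\colon P\downarrow B\to B$, $(x,u)\mapsto b$, $(f,v)\mapsto v$; $\mathbb C(T,S)=(\overline T,S)$, $\overline T(x,u)=(Tx,Su)$, $\overline T(f,v)=(Tf,Sv)$; $\mathbb C(\beta,\alpha)=(\overline\beta,\alpha)$, $\overline\beta_{(x,u)}=(\beta_x,\alpha_b)$; unit $(H^P,1_B)$, $H^Px=(x,1_{Px})$, $H^Pf=(f,Pf)$; multiplication $(M^P,1_B)$, $M^P((x,u),v)=(x,vu)$, $M^P((f,r),s)=(f,s)$. For a cloven cofibration, $L^P\colon P\downarrow B\to E$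 is the unique functor with $L^P(x,u)=u_!x$, $PL^P=\mathrm{Cod}_P$, $L^P(f,v)\delta^x_u=\delta^y_wf$. $\Gamma$ sends $P$ to the strict $\mathbb C$-action $(L^P,1_B)$ and leaves underlying 1-cells and 2-cells unchanged. **Strict algebras.** For a strict 2-monad $\mathbb T$ on $\mathcal K$, $\mathbf{Alg}_{\mathrm s}(\mathbb T)$ has objects $a\colon\mathbb TX\to X$ with $a\eta_X=1_X$, $a\mu_X=a\,\mathbb Ta$; 1-cells $f$ with $fa=b\,\mathbb Tf$; 2-cells $\alpha\colon f\Rightarrow g$ with $\alpha a=b\,\mathbb T\alpha$. **Squaring 2-monad $\mathbb S$ on $\mathbf{CAT}$.** $\mathbb SE=E^{\mathbf 2}$ (arrows $(r,s)\colon f\to g$ are commutative squares $sf=gr$); unit $I_E$, $x\mapsto1_x$; multiplication $m_E$ sends a square $(r,s)\colon f\to g$ to its diagonal $sf=gr$ (and a morphism of squares to its components at the initial and terminal vertices). The factorization of $f\colon x\to y$ selected by a strict $\mathbb S$-algebra $F\colon E^{\mathbf 2}\to E$ is $f=m_fe_f$ with $e_f=F(1_x,f)$, $m_f=F(f,1_y)$. **$\kappa$ and $\kappa^*$.** $\kappa\colon\mathbb S\,\mathrm{Dom}\Rightarrow\mathrm{Dom}\,\mathbb C$ has components $\kappa_P\colon E^{\mathbf 2}\to P\downarrow B$, $\kappa_P(f\colon x\to y)=(x,Pf)$, $\kappa_P(r,s)=(r,Ps)$. That $(\mathrm{Dom},\kappa)$ is a colax morphism of 2-monads means $\kappa$ is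 2-natural, $\kappa_PI_E=H^P$ and $\kappa_Pm_E=M^P\kappa_{\mathbb CP}(\kappa_P)^{\mathbf 2}$. $\kappa^*\colon\mathbf{Alg}_{\mathrm s}(\mathbb C)\to\mathbf{Alg}_{\mathrm s}(\mathbb S)$ sends $(P,A)$ to $(E,A\kappa_P)$, $(T,S)$ to $T$, and $(\beta,\alpha)$ to $\beta$. *)

theory Defs
  imports Main "HOL-Library.FuncSet" "HOL-Library.Equipollence"
begin

section \<open>Categories and strict 2-categories\<close>

record ('o, 'a) cat =
  Obj :: "'o set"
  Arr :: "'a set"
  Src :: "'a \<Rightarrow> 'o"
  Tgt :: "'a \<Rightarrow> 'o"
  Idn :: "'o \<Rightarrow> 'a"
  Cmp :: "'a \<Rightarrow> 'a \<Rightarrow> 'a"  \<comment> \<open>\<open>Cmp C g f\<close> is \<open>g\<close> after \<open>f\<close>\<close>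

definition hom :: "('o, 'a) cat \<Rightarrow> 'o \<Rightarrow> 'o \<Rightarrow> 'a set" where
  "hom C x y = {f \<in> Arr C. Src C f = x \<and> Tgt C f = y}"

definition category :: "('o, 'a) cat \<Rightarrow> bool" where
  "category C \<longleftrightarrow>
     (\<forall>f \<in> Arr C. Src C f \<in> Obj C \<and> Tgt C f \<in> Obj C) \<and>
     (\<forall>x \<in> Obj C. Idn C x \<in> hom C x x) \<and>
     (\<forall>f \<in> Arr C. \<forall>g \<in> Arr C. Src C g = Tgt C f \<longrightarrow> Cmp C g f \<in> hom C (Src C f) (Tgt C g)) \<and>
     (\<forall>f \<in> Arr C. Cmp C f (Idn C (Src C f)) = f \<and> Cmp C (Idn C (Tgt C f)) f = f) \<and>
     (\<forall>f \<in> Arr C. \<forall>g \<in> Arr C. \<forall>h \<in> Arr C. Src C g = Tgt C f \<longrightarrow> Src C h = Tgt C g \<longrightarrow>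
        Cmp C h (Cmp C g f) = Cmp C (Cmp C h g) f)"

record ('o, 'm, 't) two_cat =
  Ob :: "'o set"
  Cell1 :: "'m set"
  Cell2 :: "'t set"
  src1 :: "'m \<Rightarrow> 'o"
  tgt1 :: "'m \<Rightarrow> 'o"
  src2 :: "'t \<Rightarrow> 'm"
  tgt2 :: "'t \<Rightarrow> 'm"
  id1 :: "'o \<Rightarrow> 'm"
  id2 :: "'m \<Rightarrow> 't"
  comp1 :: "'m \<Rightarrow> 'm \<Rightarrow> 'm"
  vcomp :: "'t \<Rightarrow> 't \<Rightarrow> 't"
  hcomp :: "'t \<Rightarrow> 't \<Rightarrow> 't"

definition two_category :: "('o, 'm, 't) two_cat \<Rightarrow> bool" where
  "two_category K \<longleftrightarrow>
     category \<lparr>Obj = Ob K, Arr = Cell1 K, Src = src1 K, Tgt = tgt1 K, Idn = id1 K, Cmp = comp1 K\<rparr> \<and>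
     category \<lparr>Obj = Cell1 K, Arr = Cell2 K, Src = src2 K, Tgt = tgt2 K, Idn = id2 K, Cmp = vcomp K\<rparr> \<and>
     category \<lparr>Obj = Ob K, Arr = Cell2 K, Src = (\<lambda>\<alpha>. src1 K (src2 K \<alpha>)),
       Tgt = (\<lambda>\<alpha>. tgt1 K (src2 K \<alpha>)), Idn = (\<lambda>x. id2 K (id1 K x)), Cmp = hcomp K\<rparr> \<and>
     (\<forall>\<alpha> \<in> Cell2 K. src1 K (src2 K \<alpha>) = src1 K (tgt2 K \<alpha>) \<and>
        tgt1 K (src2 K \<alpha>) = tgt1 K (tgt2 K \<alpha>)) \<and>
     (\<forall>\<alpha> \<in> Cell2 K. \<forall>\<beta> \<in> Cell2 K. src1 K (src2 K \<beta>) = tgt1 K (src2 K \<alpha>) \<longrightarrow>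
        src2 K (hcomp K \<beta> \<alpha>) = comp1 K (src2 K \<beta>) (src2 K \<alpha>) \<and>
        tgt2 K (hcomp K \<beta> \<alpha>) = comp1 K (tgt2 K \<beta>) (tgt2 K \<alpha>)) \<and>
     (\<forall>f \<in> Cell1 K. \<forall>g \<in> Cell1 K. src1 K g = tgt1 K f \<longrightarrow>
        hcomp K (id2 K g) (id2 K f) = id2 K (comp1 K g f)) \<and>
     (\<forall>\<alpha> \<in> Cell2 K. \<forall>\<alpha>' \<in> Cell2 K. \<forall>\<beta> \<in> Cell2 K. \<forall>\<beta>' \<in> Cell2 K.
        src2 K \<alpha>' = tgt2 K \<alpha> \<longrightarrow> src2 K \<beta>' = tgt2 K \<beta> \<longrightarrow>
        src1 K (src2 K \<beta>) = tgt1 K (src2 K \<alpha>) \<longrightarrow>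
        hcomp K (vcomp K \<beta>' \<beta>) (vcomp K \<alpha>' \<alpha>) = vcomp K (hcomp K \<beta>' \<alpha>') (hcomp K \<beta> \<alpha>))"

definition whisker_left :: "('o, 'm, 't) two_cat \<Rightarrow> 'm \<Rightarrow> 't \<Rightarrow> 't" where
  "whisker_left K g \<alpha> = hcomp K (id2 K g) \<alpha>"

definition whisker_right :: "('o, 'm, 't) two_cat \<Rightarrow> 't \<Rightarrow> 'm \<Rightarrow> 't" where
  "whisker_right K \<alpha> f = hcomp K \<alpha> (id2 K f)"

record ('o, 'm, 't, 'p, 'n, 's) two_map =
  on0 :: "'o \<Rightarrow> 'p"
  on1 :: "'m \<Rightarrow> 'n"
  on2 :: "'t \<Rightarrow> 's"

definition two_functor ::
  "('o, 'm, 't) two_cat \<Rightarrow> ('p, 'n, 's) two_cat \<Rightarrow> ('o, 'm, 't, 'p, 'n, 's) two_map \<Rightarrow> bool" where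
  "two_functor A B F \<longleftrightarrow> two_category A \<and> two_category B \<and>
     (\<forall>x \<in> Ob A. on0 F x \<in> Ob B \<and> on1 F (id1 A x) = id1 B (on0 F x)) \<and>
     (\<forall>f \<in> Cell1 A. on1 F f \<in> Cell1 B \<and> src1 B (on1 F f) = on0 F (src1 A f) \<and>
        tgt1 B (on1 F f) = on0 F (tgt1 A f) \<and> on2 F (id2 A f) = id2 B (on1 F f)) \<and>
     (\<forall>\<alpha> \<in> Cell2 A. on2 F \<alpha> \<in> Cell2 B \<and> src2 B (on2 F \<alpha>) = on1 F (src2 A \<alpha>) \<and>
        tgt2 B (on2 F \<alpha>) = on1 F (tgt2 A \<alpha>)) \<and>
     (\<forall>f \<in> Cell1 A. \<forall>g \<in> Cell1 A. src1 A g = tgt1 A f \<longrightarrow>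
        on1 F (comp1 A g f) = comp1 B (on1 F g) (on1 F f)) \<and>
     (\<forall>\<alpha> \<in> Cell2 A. \<forall>\<beta> \<in> Cell2 A. src2 A \<beta> = tgt2 A \<alpha> \<longrightarrow>
        on2 F (vcomp A \<beta> \<alpha>) = vcomp B (on2 F \<beta>) (on2 F \<alpha>)) \<and>
     (\<forall>\<alpha> \<in> Cell2 A. \<forall>\<beta> \<in> Cell2 A. src1 A (src2 A \<beta>) = tgt1 A (src2 A \<alpha>) \<longrightarrow>
        on2 F (hcomp A \<beta> \<alpha>) = hcomp B (on2 F \<beta>) (on2 F \<alpha>))"

text \<open>The maps of a 2-functor are not constrained outside the cells of its source, so equality of
  2-functors out of \<open>A\<close> is equality on all cells of \<open>A\<close>.\<close>

definition two_functor_eq ::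
  "('o, 'm, 't) two_cat \<Rightarrow> ('o, 'm, 't, 'p, 'n, 's) two_map \<Rightarrow> ('o, 'm, 't, 'p, 'n, 's) two_map \<Rightarrow> bool" where
  "two_functor_eq A F G \<longleftrightarrow> (\<forall>x \<in> Ob A. on0 F x = on0 G x) \<and>
     (\<forall>f \<in> Cell1 A. on1 F f = on1 G f) \<and> (\<forall>\<alpha> \<in> Cell2 A. on2 F \<alpha> = on2 G \<alpha>)"

definition two_id :: "('o, 'm, 't, 'o, 'm, 't) two_map" where
  "two_id = \<lparr>on0 = (\<lambda>x. x), on1 = (\<lambda>f. f), on2 = (\<lambda>\<alpha>. \<alpha>)\<rparr>"

definition two_comp ::
  "('p, 'n, 's, 'q, 'l, 'r) two_map \<Rightarrow> ('o, 'm, 't, 'p, 'n, 's) two_map \<Rightarrow> ('o, 'm, 't, 'q, 'l, 'r) two_map" where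
  "two_comp G F = \<lparr>on0 = on0 G \<circ> on0 F, on1 = on1 G \<circ> on1 F, on2 = on2 G \<circ> on2 F\<rparr>"

definition two_isomorphism ::
  "('o, 'm, 't) two_cat \<Rightarrow> ('p, 'n, 's) two_cat \<Rightarrow> ('o, 'm, 't, 'p, 'n, 's) two_map \<Rightarrow> bool" where
  "two_isomorphism A B F \<longleftrightarrow> two_functor A B F \<and>
     (\<exists>G. two_functor B A G \<and> two_functor_eq A (two_comp G F) two_id \<and>
          two_functor_eq B (two_comp F G) two_id)"

definition two_natural ::
  "('o, 'm, 't) two_cat \<Rightarrow> ('p, 'n, 's) two_cat \<Rightarrow> ('o, 'm, 't, 'p, 'n, 's) two_map \<Rightarrow>
   ('o, 'm, 't, 'p, 'n, 's) two_map \<Rightarrow> ('o \<Rightarrow> 'n) \<Rightarrow> bool" where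
  "two_natural A B F G \<theta> \<longleftrightarrow> two_functor A B F \<and> two_functor A B G \<and>
     (\<forall>x \<in> Ob A. \<theta> x \<in> Cell1 B \<and> src1 B (\<theta> x) = on0 F x \<and> tgt1 B (\<theta> x) = on0 G x) \<and>
     (\<forall>f \<in> Cell1 A. comp1 B (on1 G f) (\<theta> (src1 A f)) = comp1 B (\<theta> (tgt1 A f)) (on1 F f)) \<and>
     (\<forall>\<alpha> \<in> Cell2 A. whisker_right B (on2 G \<alpha>) (\<theta> (src1 A (src2 A \<alpha>))) =
                     whisker_left B (\<theta> (tgt1 A (src2 A \<alpha>))) (on2 F \<alpha>))"

section \<open>2-categories of structured objects, arrow 2-categories\<close>

text \<open>A 1-cell from \<open>X\<close> to \<open>Y\<close> in a 2-category of structured objects is a cell of the ambient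
  2-category together with \<open>X\<close> and \<open>Y\<close>; likewise for a 2-cell between 1-cells from \<open>X\<close> to \<open>Y\<close>, whose
  source and target 1-cells are determined by the ambient 2-cell.\<close>

record ('x, 'c) framed =
  fr_src :: 'x
  fr_cell :: 'c
  fr_tgt :: 'x

abbreviation frame :: "'x \<Rightarrow> 'c \<Rightarrow> 'x \<Rightarrow> ('x, 'c) framed" where
  "frame X c Y \<equiv> \<lparr>fr_src = X, fr_cell = c, fr_tgt = Y\<rparr>"

text \<open>Objects are the elements of \<open>A\<close>, with underlying object \<open>u\<close>; 1-cells and 2-cells are those of
  \<open>K\<close> between underlying objects which satisfy \<open>P1\<close> and \<open>P2\<close>.\<close>

definition structured ::
  "('o, 'm, 't) two_cat \<Rightarrow> 'x set \<Rightarrow> ('x \<Rightarrow> 'o) \<Rightarrow> ('x \<Rightarrow> 'm \<Rightarrow> 'x \<Rightarrow> bool) \<Rightarrow> ('x \<Rightarrow> 't \<Rightarrow> 'x \<Rightarrow> bool) \<Rightarrow>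
   ('x, ('x, 'm) framed, ('x, 't) framed) two_cat" where
  "structured K A u P1 P2 = \<lparr>
     Ob = A,
     Cell1 = {frame X f Y | X f Y. X \<in> A \<and> Y \<in> A \<and> f \<in> Cell1 K \<and>
                src1 K f = u X \<and> tgt1 K f = u Y \<and> P1 X f Y},
     Cell2 = {frame X \<alpha> Y | X \<alpha> Y. X \<in> A \<and> Y \<in> A \<and> \<alpha> \<in> Cell2 K \<and>
                src1 K (src2 K \<alpha>) = u X \<and> tgt1 K (src2 K \<alpha>) = u Y \<and>
                P1 X (src2 K \<alpha>) Y \<and> P1 X (tgt2 K \<alpha>) Y \<and> P2 X \<alpha> Y},
     src1 = fr_src,
     tgt1 = fr_tgt,
     src2 = (\<lambda>\<alpha>. frame (fr_src \<alpha>) (src2 K (fr_cell \<alpha>)) (fr_tgt \<alpha>)),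
     tgt2 = (\<lambda>\<alpha>. frame (fr_src \<alpha>) (tgt2 K (fr_cell \<alpha>)) (fr_tgt \<alpha>)),
     id1 = (\<lambda>X. frame X (id1 K (u X)) X),
     id2 = (\<lambda>f. frame (fr_src f) (id2 K (fr_cell f)) (fr_tgt f)),
     comp1 = (\<lambda>g f. frame (fr_src f) (comp1 K (fr_cell g) (fr_cell f)) (fr_tgt g)),
     vcomp = (\<lambda>\<beta> \<alpha>. frame (fr_src \<alpha>) (vcomp K (fr_cell \<beta>) (fr_cell \<alpha>)) (fr_tgt \<alpha>)),
     hcomp = (\<lambda>\<beta> \<alpha>. frame (fr_src \<alpha>) (hcomp K (fr_cell \<beta>) (fr_cell \<alpha>)) (fr_tgt \<beta>))\<rparr>"

definition forget :: "('x \<Rightarrow> 'o) \<Rightarrow> ('x, ('x, 'm) framed, ('x, 't) framed, 'o, 'm, 't) two_map" where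
  "forget u = \<lparr>on0 = u, on1 = fr_cell, on2 = fr_cell\<rparr>"

definition two_prod ::
  "('o, 'm, 't) two_cat \<Rightarrow> ('p, 'n, 's) two_cat \<Rightarrow> ('o \<times> 'p, 'm \<times> 'n, 't \<times> 's) two_cat" where
  "two_prod K L = \<lparr>
     Ob = Ob K \<times> Ob L, Cell1 = Cell1 K \<times> Cell1 L, Cell2 = Cell2 K \<times> Cell2 L,
     src1 = map_prod (src1 K) (src1 L), tgt1 = map_prod (tgt1 K) (tgt1 L),
     src2 = map_prod (src2 K) (src2 L), tgt2 = map_prod (tgt2 K) (tgt2 L),
     id1 = map_prod (id1 K) (id1 L), id2 = map_prod (id2 K) (id2 L),
     comp1 = (\<lambda>g f. (comp1 K (fst g) (fst f), comp1 L (snd g) (snd f))),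
     vcomp = (\<lambda>\<beta> \<alpha>. (vcomp K (fst \<beta>) (fst \<alpha>), vcomp L (snd \<beta>) (snd \<alpha>))),
     hcomp = (\<lambda>\<beta> \<alpha>. (hcomp K (fst \<beta>) (fst \<alpha>), hcomp L (snd \<beta>) (snd \<alpha>)))\<rparr>"

text \<open>The strict arrow 2-category: an object is a 1-cell \<open>P\<close>, a 1-cell from \<open>P\<close> to \<open>Q\<close> is
  \<open>frame P (T, S) Q\<close> with \<open>QT = SP\<close>, a 2-cell is \<open>frame P (\<beta>, \<alpha>) Q\<close> with \<open>Q\<beta> = \<alpha>P\<close>.\<close>

definition arrow2 ::
  "('o, 'm, 't) two_cat \<Rightarrow> ('m, ('m, 'm \<times> 'm) framed, ('m, 't \<times> 't) framed) two_cat" where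
  "arrow2 K = structured (two_prod K K) (Cell1 K) (\<lambda>P. (src1 K P, tgt1 K P))
     (\<lambda>P (T, S) Q. comp1 K Q T = comp1 K S P)
     (\<lambda>P (\<beta>, \<alpha>) Q. whisker_left K Q \<beta> = whisker_right K \<alpha> P)"

definition Dom2 ::
  "('o, 'm, 't) two_cat \<Rightarrow> ('m, ('m, 'm \<times> 'm) framed, ('m, 't \<times> 't) framed, 'o, 'm, 't) two_map" where
  "Dom2 K = \<lparr>on0 = src1 K, on1 = fst \<circ> fr_cell, on2 = fst \<circ> fr_cell\<rparr>"

section \<open>Strict 2-monads, strict algebras, colax morphisms\<close>

record ('o, 'm, 't) two_monad =
  endo :: "('o, 'm, 't, 'o, 'm, 't) two_map"
  unit2 :: "'o \<Rightarrow> 'm"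
  mult2 :: "'o \<Rightarrow> 'm"

definition strict_two_monad :: "('o, 'm, 't) two_cat \<Rightarrow> ('o, 'm, 't) two_monad \<Rightarrow> bool" where
  "strict_two_monad K M \<longleftrightarrow>
     two_functor K K (endo M) \<and>
     two_natural K K two_id (endo M) (unit2 M) \<and>
     two_natural K K (two_comp (endo M) (endo M)) (endo M) (mult2 M) \<and>
     (\<forall>x \<in> Ob K.
        comp1 K (mult2 M x) (on1 (endo M) (unit2 M x)) = id1 K (on0 (endo M) x) \<and>
        comp1 K (mult2 M x) (unit2 M (on0 (endo M) x)) = id1 K (on0 (endo M) x) \<and>
        comp1 K (mult2 M x) (on1 (endo M) (mult2 M x)) =
          comp1 K (mult2 M x) (mult2 M (on0 (endo M) x)))"

definition is_strict_algebra :: "('o, 'm, 't) two_cat \<Rightarrow> ('o, 'm, 't) two_monad \<Rightarrow> 'o \<times> 'm \<Rightarrow> bool" where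
  "is_strict_algebra K M = (\<lambda>(x, a). x \<in> Ob K \<and> a \<in> Cell1 K \<and>
     src1 K a = on0 (endo M) x \<and> tgt1 K a = x \<and>
     comp1 K a (unit2 M x) = id1 K x \<and>
     comp1 K a (mult2 M x) = comp1 K a (on1 (endo M) a))"

definition Alg ::
  "('o, 'm, 't) two_cat \<Rightarrow> ('o, 'm, 't) two_monad \<Rightarrow>
   ('o \<times> 'm, ('o \<times> 'm, 'm) framed, ('o \<times> 'm, 't) framed) two_cat" where
  "Alg K M = structured K {X. is_strict_algebra K M X} fst
     (\<lambda>(x, a) f (y, b). comp1 K f a = comp1 K b (on1 (endo M) f))
     (\<lambda>(x, a) \<alpha> (y, b). whisker_right K \<alpha> a = whisker_left K b (on2 (endo M) \<alpha>))"

definition colax_morphism ::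
  "('o, 'm, 't) two_cat \<Rightarrow> ('o, 'm, 't) two_monad \<Rightarrow> ('p, 'n, 's) two_cat \<Rightarrow> ('p, 'n, 's) two_monad \<Rightarrow>
   ('o, 'm, 't, 'p, 'n, 's) two_map \<Rightarrow> ('o \<Rightarrow> 'n) \<Rightarrow> bool" where
  "colax_morphism K M L N D \<kappa> \<longleftrightarrow>
     strict_two_monad K M \<and> strict_two_monad L N \<and> two_functor K L D \<and>
     two_natural K L (two_comp (endo N) D) (two_comp D (endo M)) \<kappa> \<and>
     (\<forall>x \<in> Ob K.
        comp1 L (\<kappa> x) (unit2 N (on0 D x)) = on1 D (unit2 M x) \<and>
        comp1 L (\<kappa> x) (mult2 N (on0 D x)) =
          comp1 L (on1 D (mult2 M x)) (comp1 L (\<kappa> (on0 (endo M) x)) (on1 (endo N) (\<kappa> x))))"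

text \<open>The 2-functor between 2-categories of strict algebras induced by a colax morphism.\<close>

definition alg_pull ::
  "('p, 'n, 's) two_cat \<Rightarrow> ('o, 'm, 't, 'p, 'n, 's) two_map \<Rightarrow> ('o \<Rightarrow> 'n) \<Rightarrow>
   ('o \<times> 'm, ('o \<times> 'm, 'm) framed, ('o \<times> 'm, 't) framed,
    'p \<times> 'n, ('p \<times> 'n, 'n) framed, ('p \<times> 'n, 's) framed) two_map" where
  "alg_pull L D \<kappa> = (let ob = (\<lambda>(x, a). (on0 D x, comp1 L (on1 D a) (\<kappa> x))) in
     \<lparr>on0 = ob,
      on1 = (\<lambda>f. frame (ob (fr_src f)) (on1 D (fr_cell f)) (ob (fr_tgt f))),
      on2 = (\<lambda>\<alpha>. frame (ob (fr_src \<alpha>)) (on2 D (fr_cell \<alpha>)) (ob (fr_tgt \<alpha>)))\<rparr>)"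

section \<open>The 2-category of locally small categories\<close>

text \<open>For \<open>CAT\<close> to be a single 2-category on which the comma and squaring constructions are
  endo-2-functors, all categories have their objects and arrows in one type closed under pairing:
  the type of binary trees with leaves in an arbitrary type.\<close>

datatype 'a univ = Atom 'a | Couple (left: "'a univ") (right: "'a univ")

text \<open>Any notion of smallness which is a condition on cardinality, holds for singletons and is
  stable under binary products is allowed.\<close>

definition smallness :: "('a univ set \<Rightarrow> bool) \<Rightarrow> bool" where
  "smallness small \<longleftrightarrow>
     (\<forall>x. small {x}) \<and>
     (\<forall>A B. small B \<longrightarrow> A \<lesssim> B \<longrightarrow> small A) \<and>
     (\<forall>A B. small A \<longrightarrow> small B \<longrightarrow> small {Couple a b | a b. a \<in> A \<and> b \<in> B})"

type_synonym 'a ucat = "('a univ, 'a univ) cat"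

definition locally_small :: "('a univ set \<Rightarrow> bool) \<Rightarrow> 'a ucat \<Rightarrow> bool" where
  "locally_small small C \<longleftrightarrow> (\<forall>x \<in> Obj C. \<forall>y \<in> Obj C. small (hom C x y))"

text \<open>Functors and natural transformations take the value \<open>undefined\<close> outside their domains, so that
  their equality is equality of records. The operations of a category are not normalized outside
  its objects and arrows: categories differing only there are different objects of \<open>CAT\<close>.\<close>

record 'a fctr =
  fsrc :: "'a ucat"
  ftgt :: "'a ucat"
  fob :: "'a univ \<Rightarrow> 'a univ"
  far :: "'a univ \<Rightarrow> 'a univ"

definition is_functor :: "'a fctr \<Rightarrow> bool" where
  "is_functor F \<longleftrightarrow> category (fsrc F) \<and> category (ftgt F) \<and>
     fob F \<in> Obj (fsrc F) \<rightarrow>\<^sub>E Obj (ftgt F) \<and>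
     far F \<in> Arr (fsrc F) \<rightarrow>\<^sub>E Arr (ftgt F) \<and>
     (\<forall>f \<in> Arr (fsrc F). Src (ftgt F) (far F f) = fob F (Src (fsrc F) f) \<and>
        Tgt (ftgt F) (far F f) = fob F (Tgt (fsrc F) f)) \<and>
     (\<forall>x \<in> Obj (fsrc F). far F (Idn (fsrc F) x) = Idn (ftgt F) (fob F x)) \<and>
     (\<forall>f \<in> Arr (fsrc F). \<forall>g \<in> Arr (fsrc F). Src (fsrc F) g = Tgt (fsrc F) f \<longrightarrow>
        far F (Cmp (fsrc F) g f) = Cmp (ftgt F) (far F g) (far F f))"

definition id_functor :: "'a ucat \<Rightarrow> 'a fctr" where
  "id_functor C = \<lparr>fsrc = C, ftgt = C, fob = (\<lambda>x \<in> Obj C. x), far = (\<lambda>f \<in> Arr C. f)\<rparr>"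

definition comp_functor :: "'a fctr \<Rightarrow> 'a fctr \<Rightarrow> 'a fctr" where
  "comp_functor G F = \<lparr>fsrc = fsrc F, ftgt = ftgt G,
     fob = compose (Obj (fsrc F)) (fob G) (fob F), far = compose (Arr (fsrc F)) (far G) (far F)\<rparr>"

record 'a ntrans =
  nsrc :: "'a fctr"
  ntgt :: "'a fctr"
  ncmp :: "'a univ \<Rightarrow> 'a univ"

definition is_nat_trans :: "'a ntrans \<Rightarrow> bool" where
  "is_nat_trans \<alpha> \<longleftrightarrow> (let F = nsrc \<alpha>; G = ntgt \<alpha>; C = fsrc F; D = ftgt F in
     is_functor F \<and> is_functor G \<and> fsrc G = C \<and> ftgt G = D \<and>
     ncmp \<alpha> \<in> extensional (Obj C) \<and>
     (\<forall>x \<in> Obj C. ncmp \<alpha> x \<in> hom D (fob F x) (fob G x)) \<and>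
     (\<forall>f \<in> Arr C. Cmp D (far G f) (ncmp \<alpha> (Src C f)) = Cmp D (ncmp \<alpha> (Tgt C f)) (far F f)))"

definition CAT :: "('a univ set \<Rightarrow> bool) \<Rightarrow> ('a ucat, 'a fctr, 'a ntrans) two_cat" where
  "CAT small = \<lparr>
     Ob = {C. category C \<and> locally_small small C},
     Cell1 = {F. is_functor F \<and> locally_small small (fsrc F) \<and> locally_small small (ftgt F)},
     Cell2 = {\<alpha>. is_nat_trans \<alpha> \<and> locally_small small (fsrc (nsrc \<alpha>)) \<and>
                 locally_small small (ftgt (nsrc \<alpha>))},
     src1 = fsrc,
     tgt1 = ftgt,
     src2 = nsrc,
     tgt2 = ntgt,
     id1 = id_functor,
     id2 = (\<lambda>F. \<lparr>nsrc = F, ntgt = F, ncmp = (\<lambda>x \<in> Obj (fsrc F). Idn (ftgt F) (fob F x))\<rparr>),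
     comp1 = comp_functor,
     vcomp = (\<lambda>\<beta> \<alpha>. \<lparr>nsrc = nsrc \<alpha>, ntgt = ntgt \<beta>,
        ncmp = (\<lambda>x \<in> Obj (fsrc (nsrc \<alpha>)). Cmp (ftgt (nsrc \<alpha>)) (ncmp \<beta> x) (ncmp \<alpha> x))\<rparr>),
     hcomp = (\<lambda>\<beta> \<alpha>. \<lparr>nsrc = comp_functor (nsrc \<beta>) (nsrc \<alpha>), ntgt = comp_functor (ntgt \<beta>) (ntgt \<alpha>),
        ncmp = (\<lambda>x \<in> Obj (fsrc (nsrc \<alpha>)). Cmp (ftgt (nsrc \<beta>))
                  (far (ntgt \<beta>) (ncmp \<alpha> x)) (ncmp \<beta> (fob (nsrc \<alpha>) x)))\<rparr>)\<rparr>"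

type_synonym 'a square1 = "('a fctr, 'a fctr \<times> 'a fctr) framed"
type_synonym 'a square2 = "('a fctr, 'a ntrans \<times> 'a ntrans) framed"

abbreviation CAT2 :: "('a univ set \<Rightarrow> bool) \<Rightarrow> ('a fctr, 'a square1, 'a square2) two_cat" where
  "CAT2 small \<equiv> arrow2 (CAT small)"

section \<open>The squaring 2-monad\<close>

text \<open>\<open>pairarr p q f v\<close> encodes the arrow \<open>(f, v)\<close> from \<open>p\<close> to \<open>q\<close> of a category of arrows or of a
  comma category.\<close>

definition pairarr :: "'a univ \<Rightarrow> 'a univ \<Rightarrow> 'a univ \<Rightarrow> 'a univ \<Rightarrow> 'a univ" where
  "pairarr p q f v = Couple (Couple p q) (Couple f v)"

definition pa_src :: "'a univ \<Rightarrow> 'a univ" where "pa_src z = left (left z)"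
definition pa_tgt :: "'a univ \<Rightarrow> 'a univ" where "pa_tgt z = right (left z)"
definition pa_fst :: "'a univ \<Rightarrow> 'a univ" where "pa_fst z = left (right z)"
definition pa_snd :: "'a univ \<Rightarrow> 'a univ" where "pa_snd z = right (right z)"

definition arrow_cat :: "'a ucat \<Rightarrow> 'a ucat" where
  "arrow_cat E = \<lparr>
     Obj = Arr E,
     Arr = {pairarr f g r s | f g r s. f \<in> Arr E \<and> g \<in> Arr E \<and>
              r \<in> hom E (Src E f) (Src E g) \<and> s \<in> hom E (Tgt E f) (Tgt E g) \<and>
              Cmp E s f = Cmp E g r},
     Src = pa_src,
     Tgt = pa_tgt,
     Idn = (\<lambda>f. pairarr f f (Idn E (Src E f)) (Idn E (Tgt E f))),
     Cmp = (\<lambda>z' z. pairarr (pa_src z) (pa_tgt z')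
              (Cmp E (pa_fst z') (pa_fst z)) (Cmp E (pa_snd z') (pa_snd z)))\<rparr>"

definition sq_functor :: "'a fctr \<Rightarrow> 'a fctr" where
  "sq_functor T = \<lparr>fsrc = arrow_cat (fsrc T), ftgt = arrow_cat (ftgt T),
     fob = far T,
     far = (\<lambda>z \<in> Arr (arrow_cat (fsrc T)).
        pairarr (far T (pa_src z)) (far T (pa_tgt z)) (far T (pa_fst z)) (far T (pa_snd z)))\<rparr>"

definition sq_ntrans :: "'a ntrans \<Rightarrow> 'a ntrans" where
  "sq_ntrans \<beta> = \<lparr>nsrc = sq_functor (nsrc \<beta>), ntgt = sq_functor (ntgt \<beta>),
     ncmp = (\<lambda>f \<in> Arr (fsrc (nsrc \<beta>)). pairarr (far (nsrc \<beta>) f) (far (ntgt \<beta>) f)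
        (ncmp \<beta> (Src (fsrc (nsrc \<beta>)) f)) (ncmp \<beta> (Tgt (fsrc (nsrc \<beta>)) f)))\<rparr>"

definition sq_unit :: "'a ucat \<Rightarrow> 'a fctr" where
  "sq_unit E = \<lparr>fsrc = E, ftgt = arrow_cat E,
     fob = (\<lambda>x \<in> Obj E. Idn E x),
     far = (\<lambda>f \<in> Arr E. pairarr (Idn E (Src E f)) (Idn E (Tgt E f)) f f)\<rparr>"

definition diagonal :: "'a ucat \<Rightarrow> 'a univ \<Rightarrow> 'a univ" where
  "diagonal E z = Cmp E (pa_snd z) (pa_src z)"

definition sq_mult :: "'a ucat \<Rightarrow> 'a fctr" where
  "sq_mult E = \<lparr>fsrc = arrow_cat (arrow_cat E), ftgt = arrow_cat E,
     fob = (\<lambda>z \<in> Arr (arrow_cat E). diagonal E z),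
     far = (\<lambda>w \<in> Arr (arrow_cat (arrow_cat E)).
        pairarr (diagonal E (pa_src w)) (diagonal E (pa_tgt w))
                (pa_fst (pa_fst w)) (pa_snd (pa_snd w)))\<rparr>"

definition squaring_monad :: "('a ucat, 'a fctr, 'a ntrans) two_monad" where
  "squaring_monad = \<lparr>endo = \<lparr>on0 = arrow_cat, on1 = sq_functor, on2 = sq_ntrans\<rparr>,
     unit2 = sq_unit, mult2 = sq_mult\<rparr>"

text \<open>The factorization of an arrow selected by \<open>F\<close>, an algebra structure on \<open>E\<close>.\<close>

definition sel_e :: "'a ucat \<Rightarrow> 'a fctr \<Rightarrow> 'a univ \<Rightarrow> 'a univ" where
  "sel_e E F f = far F (pairarr (Idn E (Src E f)) f (Idn E (Src E f)) f)"

definition sel_m :: "'a ucat \<Rightarrow> 'a fctr \<Rightarrow> 'a univ \<Rightarrow> 'a univ" where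
  "sel_m E F f = far F (pairarr f (Idn E (Tgt E f)) f (Idn E (Tgt E f)))"

definition factorization_morphism ::
  "'a ucat \<Rightarrow> 'a univ \<times> 'a univ \<Rightarrow> 'a univ \<times> 'a univ \<Rightarrow> 'a univ \<times> 'a univ \<times> 'a univ \<Rightarrow> bool" where
  "factorization_morphism E = (\<lambda>(e, m) (e', m') (r, t, s).
     r \<in> hom E (Src E e) (Src E e') \<and> t \<in> hom E (Tgt E e) (Tgt E e') \<and>
     s \<in> hom E (Tgt E m) (Tgt E m') \<and>
     Cmp E t e = Cmp E e' r \<and> Cmp E m' t = Cmp E s m)"

section \<open>The comma 2-monad\<close>

definition comma :: "'a fctr \<Rightarrow> 'a ucat" where
  "comma P = (let E = fsrc P; B = ftgt P;
       ob = {Couple x u | x u. x \<in> Obj E \<and> u \<in> Arr B \<and> Src B u = fob P x} in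
     \<lparr>Obj = ob,
      Arr = {pairarr (Couple x u) (Couple y w) f v | x u y w f v.
               Couple x u \<in> ob \<and> Couple y w \<in> ob \<and> f \<in> hom E x y \<and> v \<in> hom B (Tgt B u) (Tgt B w) \<and>
               Cmp B v u = Cmp B w (far P f)},
      Src = pa_src,
      Tgt = pa_tgt,
      Idn = (\<lambda>p. pairarr p p (Idn E (left p)) (Idn B (Tgt B (right p)))),
      Cmp = (\<lambda>z' z. pairarr (pa_src z) (pa_tgt z')
               (Cmp E (pa_fst z') (pa_fst z)) (Cmp B (pa_snd z') (pa_snd z)))\<rparr>)"

definition Cod :: "'a fctr \<Rightarrow> 'a fctr" where
  "Cod P = \<lparr>fsrc = comma P, ftgt = ftgt P,
     fob = (\<lambda>p \<in> Obj (comma P). Tgt (ftgt P) (right p)),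
     far = (\<lambda>z \<in> Arr (comma P). pa_snd z)\<rparr>"

definition comma_ob_map :: "'a fctr \<Rightarrow> 'a fctr \<Rightarrow> 'a univ \<Rightarrow> 'a univ" where
  "comma_ob_map T S p = Couple (fob T (left p)) (far S (right p))"

definition comma_functor :: "'a square1 \<Rightarrow> 'a fctr" where
  "comma_functor F = (let P = fr_src F; Q = fr_tgt F; T = fst (fr_cell F); S = snd (fr_cell F) in
     \<lparr>fsrc = comma P, ftgt = comma Q,
      fob = (\<lambda>p \<in> Obj (comma P). comma_ob_map T S p),
      far = (\<lambda>z \<in> Arr (comma P). pairarr (comma_ob_map T S (pa_src z)) (comma_ob_map T S (pa_tgt z))
               (far T (pa_fst z)) (far S (pa_snd z)))\<rparr>)"

definition comma_ntrans :: "'a square2 \<Rightarrow> 'a ntrans" where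
  "comma_ntrans \<phi> = (let P = fr_src \<phi>; Q = fr_tgt \<phi>; \<beta> = fst (fr_cell \<phi>); \<alpha> = snd (fr_cell \<phi>) in
     \<lparr>nsrc = comma_functor (frame P (nsrc \<beta>, nsrc \<alpha>) Q),
      ntgt = comma_functor (frame P (ntgt \<beta>, ntgt \<alpha>) Q),
      ncmp = (\<lambda>p \<in> Obj (comma P).
         pairarr (comma_ob_map (nsrc \<beta>) (nsrc \<alpha>) p) (comma_ob_map (ntgt \<beta>) (ntgt \<alpha>) p)
           (ncmp \<beta> (left p)) (ncmp \<alpha> (Tgt (ftgt P) (right p))))\<rparr>)"

definition comma_H :: "'a fctr \<Rightarrow> 'a fctr" where
  "comma_H P = (let E = fsrc P; B = ftgt P; h = (\<lambda>x. Couple x (Idn B (fob P x))) in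
     \<lparr>fsrc = E, ftgt = comma P,
      fob = (\<lambda>x \<in> Obj E. h x),
      far = (\<lambda>f \<in> Arr E. pairarr (h (Src E f)) (h (Tgt E f)) f (far P f))\<rparr>)"

definition comma_M :: "'a fctr \<Rightarrow> 'a fctr" where
  "comma_M P = (let m = (\<lambda>p. Couple (left (left p)) (Cmp (ftgt P) (right p) (right (left p)))) in
     \<lparr>fsrc = comma (Cod P), ftgt = comma P,
      fob = (\<lambda>p \<in> Obj (comma (Cod P)). m p),
      far = (\<lambda>z \<in> Arr (comma (Cod P)).
               pairarr (m (pa_src z)) (m (pa_tgt z)) (pa_fst (pa_fst z)) (pa_snd z))\<rparr>)"

definition comma_monad :: "('a fctr, 'a square1, 'a square2) two_monad" where
  "comma_monad = \<lparr>
     endo = \<lparr>on0 = Cod,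
        on1 = (\<lambda>F. frame (Cod (fr_src F)) (comma_functor F, snd (fr_cell F)) (Cod (fr_tgt F))),
        on2 = (\<lambda>\<phi>. frame (Cod (fr_src \<phi>)) (comma_ntrans \<phi>, snd (fr_cell \<phi>)) (Cod (fr_tgt \<phi>)))\<rparr>,
     unit2 = (\<lambda>P. frame P (comma_H P, id_functor (ftgt P)) (Cod P)),
     mult2 = (\<lambda>P. frame (Cod (Cod P)) (comma_M P, id_functor (ftgt P)) (Cod P))\<rparr>"

section \<open>Split cofibrations\<close>

definition cocartesian :: "'a fctr \<Rightarrow> 'a univ \<Rightarrow> bool" where
  "cocartesian P e \<longleftrightarrow> (let E = fsrc P; B = ftgt P; x = Src E e; y = Tgt E e in
     e \<in> Arr E \<and>
     (\<forall>z \<in> Obj E. \<forall>g \<in> hom E x z. \<forall>v \<in> hom B (fob P y) (fob P z).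
        far P g = Cmp B v (far P e) \<longrightarrow>
        (\<exists>!h. h \<in> hom E y z \<and> Cmp E h e = g \<and> far P h = v)))"

text \<open>A functor \<open>proj\<close> with a choice \<open>lift x u\<close> of lifts \<open>\<delta>\<^sup>x\<^sub>u\<close>.\<close>

record 'a cloven =
  proj :: "'a fctr"
  lift :: "'a univ \<Rightarrow> 'a univ \<Rightarrow> 'a univ"

definition total :: "'a cloven \<Rightarrow> 'a ucat" where "total X = fsrc (proj X)"
definition base :: "'a cloven \<Rightarrow> 'a ucat" where "base X = ftgt (proj X)"

definition liftable :: "'a cloven \<Rightarrow> 'a univ \<Rightarrow> 'a univ \<Rightarrow> bool" where
  "liftable X x u \<longleftrightarrow> x \<in> Obj (total X) \<and> u \<in> Arr (base X) \<and> Src (base X) u = fob (proj X) x"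

definition cleavage :: "'a cloven \<Rightarrow> bool" where
  "cleavage X \<longleftrightarrow>
     (\<forall>x u. liftable X x u \<longrightarrow> cocartesian (proj X) (lift X x u) \<and>
        Src (total X) (lift X x u) = x \<and> far (proj X) (lift X x u) = u) \<and>
     (\<forall>x u. \<not> liftable X x u \<longrightarrow> lift X x u = undefined)"

definition fibre_arr :: "'a cloven \<Rightarrow> 'a univ \<Rightarrow> 'a univ set" where
  "fibre_arr X a = {f \<in> Arr (total X). far (proj X) f = Idn (base X) a}"

definition push_ob :: "'a cloven \<Rightarrow> 'a univ \<Rightarrow> 'a univ \<Rightarrow> 'a univ" where
  "push_ob X u x = Tgt (total X) (lift X x u)"

definition push_ar :: "'a cloven \<Rightarrow> 'a univ \<Rightarrow> 'a univ \<Rightarrow> 'a univ" where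
  "push_ar X u f = (let E = total X; x = Src E f; y = Tgt E f in
     THE h. h \<in> fibre_arr X (Tgt (base X) u) \<and> h \<in> hom E (push_ob X u x) (push_ob X u y) \<and>
       Cmp E h (lift X x u) = Cmp E (lift X y u) f)"

definition split_cleavage :: "'a cloven \<Rightarrow> bool" where
  "split_cleavage X \<longleftrightarrow> (let E = total X; B = base X; P = proj X in
     cleavage X \<and>
     (\<forall>x \<in> Obj E. lift X x (Idn B (fob P x)) = Idn E x) \<and>
     (\<forall>u \<in> Arr B. \<forall>v \<in> Arr B. Src B v = Tgt B u \<longrightarrow>
        (\<forall>x \<in> Obj E. fob P x = Src B u \<longrightarrow>
           push_ob X (Cmp B v u) x = push_ob X v (push_ob X u x) \<and>
           lift X x (Cmp B v u) = Cmp E (lift X (push_ob X u x) v) (lift X x u)) \<and>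
        (\<forall>f \<in> fibre_arr X (Src B u). push_ar X (Cmp B v u) f = push_ar X v (push_ar X u f))))"

definition nu :: "'a cloven \<Rightarrow> 'a univ \<Rightarrow> 'a univ" where
  "nu X f = (let E = total X; P = proj X; x = Src E f; y = Tgt E f in
     THE h. h \<in> hom E (push_ob X (far P f) x) y \<and> Cmp E h (lift X x (far P f)) = f \<and>
       far P h = Idn (base X) (fob P y))"

definition SCoFib ::
  "('a univ set \<Rightarrow> bool) \<Rightarrow>
   ('a cloven, ('a cloven, 'a square1) framed, ('a cloven, 'a square2) framed) two_cat" where
  "SCoFib small = structured (CAT2 small) {X. proj X \<in> Ob (CAT2 small) \<and> split_cleavage X} proj
     (\<lambda>X F Y. \<forall>x u. liftable X x u \<longrightarrow>
        far (fst (fr_cell F)) (lift X x u) =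
          lift Y (fob (fst (fr_cell F)) x) (far (snd (fr_cell F)) u))
     (\<lambda>X \<phi> Y. True)"

definition L_functor :: "'a cloven \<Rightarrow> 'a fctr" where
  "L_functor X = (THE L. is_functor L \<and> fsrc L = comma (proj X) \<and> ftgt L = total X \<and>
     (\<forall>x u. Couple x u \<in> Obj (comma (proj X)) \<longrightarrow> fob L (Couple x u) = push_ob X u x) \<and>
     comp_functor (proj X) L = Cod (proj X) \<and>
     (\<forall>x u y w f v. pairarr (Couple x u) (Couple y w) f v \<in> Arr (comma (proj X)) \<longrightarrow>
        Cmp (total X) (far L (pairarr (Couple x u) (Couple y w) f v)) (lift X x u) =
          Cmp (total X) (lift X y w) f))"

definition Gamma ::
  "('a cloven, ('a cloven, 'a square1) framed, ('a cloven, 'a square2) framed,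
    'a fctr \<times> 'a square1, ('a fctr \<times> 'a square1, 'a square1) framed,
    ('a fctr \<times> 'a square1, 'a square2) framed) two_map" where
  "Gamma = (let ob = (\<lambda>X. (proj X, frame (Cod (proj X)) (L_functor X, id_functor (base X)) (proj X))) in
     \<lparr>on0 = ob,
      on1 = (\<lambda>F. frame (ob (fr_src F)) (fr_cell F) (ob (fr_tgt F))),
      on2 = (\<lambda>\<phi>. frame (ob (fr_src \<phi>)) (fr_cell \<phi>) (ob (fr_tgt \<phi>)))\<rparr>)"

section \<open>The comparison between the comma and the squaring 2-monads\<close>

definition kappa :: "'a fctr \<Rightarrow> 'a fctr" where
  "kappa P = (let E = fsrc P; k = (\<lambda>f. Couple (Src E f) (far P f)) in
     \<lparr>fsrc = arrow_cat E, ftgt = comma P,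
      fob = (\<lambda>f \<in> Arr E. k f),
      far = (\<lambda>z \<in> Arr (arrow_cat E).
               pairarr (k (pa_src z)) (k (pa_tgt z)) (pa_fst z) (far P (pa_snd z)))\<rparr>)"

abbreviation AlgC where "AlgC small \<equiv> Alg (CAT2 small) comma_monad"
abbreviation AlgS where "AlgS small \<equiv> Alg (CAT small) squaring_monad"

definition kappa_star ::
  "('a univ set \<Rightarrow> bool) \<Rightarrow>
   ('a fctr \<times> 'a square1, ('a fctr \<times> 'a square1, 'a square1) framed,
    ('a fctr \<times> 'a square1, 'a square2) framed,
    'a ucat \<times> 'a fctr, ('a ucat \<times> 'a fctr, 'a fctr) framed,
    ('a ucat \<times> 'a fctr, 'a ntrans) framed) two_map" where
  "kappa_star small = alg_pull (CAT small) (Dom2 (CAT small)) kappa"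

definition Fact ::
  "('a univ set \<Rightarrow> bool) \<Rightarrow>
   ('a cloven, ('a cloven, 'a square1) framed, ('a cloven, 'a square2) framed,
    'a ucat \<times> 'a fctr, ('a ucat \<times> 'a fctr, 'a fctr) framed,
    ('a ucat \<times> 'a fctr, 'a ntrans) framed) two_map" where
  "Fact small = two_comp (kappa_star small) Gamma"

definition F_action :: "'a cloven \<Rightarrow> 'a fctr" where
  "F_action X = comp_functor (L_functor X) (kappa (proj X))"

end

theory Submission
  imports Defs
begin

text \<open>A colax morphism \<open>(D, \<kappa>)\<close> of 2-monads induces a 2-functor on strict
  algebras, \<open>(x, a) \<mapsto> (D x, D a \<circ> \<kappa> x)\<close>; for \<open>(Dom, \<kappa>)\<close> the axioms are
  checked componentwise. For \<open>\<Gamma>\<close>, the lifts of a split cofibration are recovered from its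
  action as \<open>\<delta> = L (1, u)\<close>, where \<open>(1, u) : (x, 1) \<rightarrow> (x, u)\<close>. Conversely, the
  lifts so defined from a strict algebra are cocartesian: the multiplication law forces
  \<open>L (\<delta>, 1) = 1\<close>, so an arrow \<open>h\<close> over \<open>v\<close> with \<open>h \<delta> = g\<close> is
  \<open>h = L (h, v) L (\<delta>, 1) = L (g, v)\<close>. The remaining identities between arrows of the total
  category hold because arrows out of the codomain of a cocartesian \<open>e\<close> are determined by
  their composite with \<open>e\<close> and their image in the base.\<close>

section \<open>Strict 2-categories\<close>

text \<open>All identities are equalities of records. Functors and transformations are extensional,
  so their equality reduces to arguments in the domain; but then a value such as
  \<open>far (kappa P) z\<close> unfolds only once \<open>z\<close> is known to lie in the domain,
  and membership of a pair arrow is a conjunction which the simplifier takes apart. Hence the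
  explicit membership facts, and the proofs that disable \<open>pairarr_in_comma\<close> or
  \<open>pairarr_in_arrow_cat\<close>. To keep such verifications few, \<open>arrow2\<close>,
  \<open>Alg\<close> and \<open>SCoFib\<close> are treated as instances of
  \<open>structured\<close>, where only closure of two conditions is to be checked, and
  \<open>arrow_cat\<close> and \<open>comma\<close> as instances of \<open>pair_cat\<close>.
  \<Gamma> leaves underlying cells alone, so it is invertible once it is bijective on objects and
  its condition on 1-cells is an equivalence; the algebra condition on 2-cells then holds by itself,
  by naturality at the lifts. On objects, the unit law forces the base component of an action to be
  an identity, and the default value of lifts makes the recovered cleavage literally equal to the
  original one.\<close>

lemma two_category_1cells:
  assumes "two_category K"
  shows "f \<in> Cell1 K \<Longrightarrow> src1 K f \<in> Ob K"
    and "f \<in> Cell1 K \<Longrightarrow> tgt1 K f \<in> Ob K"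
    and "x \<in> Ob K \<Longrightarrow> id1 K x \<in> Cell1 K"
    and "x \<in> Ob K \<Longrightarrow> src1 K (id1 K x) = x"
    and "x \<in> Ob K \<Longrightarrow> tgt1 K (id1 K x) = x"
    and "f \<in> Cell1 K \<Longrightarrow> g \<in> Cell1 K \<Longrightarrow> src1 K g = tgt1 K f
      \<Longrightarrow> comp1 K g f \<in> Cell1 K"
    and "f \<in> Cell1 K \<Longrightarrow> g \<in> Cell1 K \<Longrightarrow> src1 K g = tgt1 K f
      \<Longrightarrow> src1 K (comp1 K g f) = src1 K f"
    and "f \<in> Cell1 K \<Longrightarrow> g \<in> Cell1 K \<Longrightarrow> src1 K g = tgt1 K f
      \<Longrightarrow> tgt1 K (comp1 K g f) = tgt1 K g"
    and "f \<in> Cell1 K \<Longrightarrow> src1 K f = x \<Longrightarrow> comp1 K f (id1 K x) = f"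
    and "f \<in> Cell1 K \<Longrightarrow> tgt1 K f = x \<Longrightarrow> comp1 K (id1 K x) f = f"
  using assms by (auto simp: two_category_def category_def hom_def)

lemma comp1_assoc:
  assumes "two_category K" "f \<in> Cell1 K" "g \<in> Cell1 K" "h \<in> Cell1 K"
    "src1 K g = tgt1 K f" "src1 K h = tgt1 K g"
  shows "comp1 K (comp1 K h g) f = comp1 K h (comp1 K g f)"
  using assms by (auto simp: two_category_def category_def)

lemma two_category_2cells:
  assumes "two_category K"
  shows "\<alpha> \<in> Cell2 K \<Longrightarrow> src2 K \<alpha> \<in> Cell1 K"
    and "\<alpha> \<in> Cell2 K \<Longrightarrow> tgt2 K \<alpha> \<in> Cell1 K"
    and "\<alpha> \<in> Cell2 K \<Longrightarrow> src1 K (tgt2 K \<alpha>) = src1 K (src2 K \<alpha>)"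
    and "\<alpha> \<in> Cell2 K \<Longrightarrow> tgt1 K (tgt2 K \<alpha>) = tgt1 K (src2 K \<alpha>)"
    and "f \<in> Cell1 K \<Longrightarrow> id2 K f \<in> Cell2 K"
    and "f \<in> Cell1 K \<Longrightarrow> src2 K (id2 K f) = f"
    and "f \<in> Cell1 K \<Longrightarrow> tgt2 K (id2 K f) = f"
    and "\<alpha> \<in> Cell2 K \<Longrightarrow> \<beta> \<in> Cell2 K \<Longrightarrow> src2 K \<beta> =
      tgt2 K \<alpha> \<Longrightarrow> vcomp K \<beta> \<alpha> \<in> Cell2 K"
    and "\<alpha> \<in> Cell2 K \<Longrightarrow> \<beta> \<in> Cell2 K \<Longrightarrow> src2 K \<beta> =
      tgt2 K \<alpha> \<Longrightarrow> src2 K (vcomp K \<beta> \<alpha>) = src2 K \<alpha>"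
    and "\<alpha> \<in> Cell2 K \<Longrightarrow> \<beta> \<in> Cell2 K \<Longrightarrow> src2 K \<beta> =
      tgt2 K \<alpha> \<Longrightarrow> tgt2 K (vcomp K \<beta> \<alpha>) = tgt2 K \<beta>"
    and "\<alpha> \<in> Cell2 K \<Longrightarrow> src2 K \<alpha> = f \<Longrightarrow> vcomp K \<alpha>
      (id2 K f) = \<alpha>"
    and "\<alpha> \<in> Cell2 K \<Longrightarrow> tgt2 K \<alpha> = f \<Longrightarrow> vcomp K (id2 K f)
      \<alpha> = \<alpha>"
  using assms by (auto simp: two_category_def category_def hom_def)

lemma vcomp_assoc:
  assumes "two_category K" "\<alpha> \<in> Cell2 K" "\<beta> \<in> Cell2 K" "\<gamma> \<in> Cell2 K"
    "src2 K \<beta> = tgt2 K \<alpha>" "src2 K \<gamma> = tgt2 K \<beta>"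
  shows "vcomp K (vcomp K \<gamma> \<beta>) \<alpha> = vcomp K \<gamma> (vcomp K \<beta> \<alpha>)"
  using assms by (auto simp: two_category_def category_def)

lemma two_category_hcomp:
  assumes "two_category K"
  shows "\<alpha> \<in> Cell2 K \<Longrightarrow> \<beta> \<in> Cell2 K \<Longrightarrow> src1 K (src2 K
    \<beta>) = tgt1 K (src2 K \<alpha>) \<Longrightarrow>
      hcomp K \<beta> \<alpha> \<in> Cell2 K"
    and "\<alpha> \<in> Cell2 K \<Longrightarrow> \<beta> \<in> Cell2 K \<Longrightarrow> src1 K (src2 K
      \<beta>) = tgt1 K (src2 K \<alpha>) \<Longrightarrow>
      src2 K (hcomp K \<beta> \<alpha>) = comp1 K (src2 K \<beta>) (src2 K \<alpha>)"
    and "\<alpha> \<in> Cell2 K \<Longrightarrow> \<beta> \<in> Cell2 K \<Longrightarrow> src1 K (src2 K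
      \<beta>) = tgt1 K (src2 K \<alpha>) \<Longrightarrow>
      tgt2 K (hcomp K \<beta> \<alpha>) = comp1 K (tgt2 K \<beta>) (tgt2 K \<alpha>)"
    and "\<alpha> \<in> Cell2 K \<Longrightarrow> src1 K (src2 K \<alpha>) = x \<Longrightarrow> hcomp K
      \<alpha> (id2 K (id1 K x)) = \<alpha>"
    and "\<alpha> \<in> Cell2 K \<Longrightarrow> tgt1 K (src2 K \<alpha>) = x \<Longrightarrow> hcomp K
      (id2 K (id1 K x)) \<alpha> = \<alpha>"
  using assms by (auto simp: two_category_def category_def hom_def)

lemma hcomp_assoc:
  assumes "two_category K" "\<alpha> \<in> Cell2 K" "\<beta> \<in> Cell2 K" "\<gamma> \<in> Cell2 K"
    "src1 K (src2 K \<beta>) = tgt1 K (src2 K \<alpha>)" "src1 K (src2 K \<gamma>) = tgt1 K (src2 K \<beta>)"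
  shows "hcomp K (hcomp K \<gamma> \<beta>) \<alpha> = hcomp K \<gamma> (hcomp K \<beta> \<alpha>)"
  using assms by (auto simp: two_category_def category_def)

lemma hcomp_id2:
  assumes "two_category K" "f \<in> Cell1 K" "g \<in> Cell1 K" "src1 K g = tgt1 K f"
  shows "hcomp K (id2 K g) (id2 K f) = id2 K (comp1 K g f)"
  using assms by (simp add: two_category_def)

lemma interchange:
  assumes "two_category K" "\<alpha> \<in> Cell2 K" "\<alpha>' \<in> Cell2 K" "\<beta> \<in> Cell2 K"
    "\<beta>' \<in> Cell2 K"
    "src2 K \<alpha>' = tgt2 K \<alpha>" "src2 K \<beta>' = tgt2 K \<beta>" "src1 K (src2 K \<beta>) = tgt1
      K (src2 K \<alpha>)"
  shows "hcomp K (vcomp K \<beta>' \<beta>) (vcomp K \<alpha>' \<alpha>) = vcomp K (hcomp K \<beta>'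
    \<alpha>') (hcomp K \<beta> \<alpha>)"
  using assms unfolding two_category_def by blast

text \<open>As conditional rewrite rules these propagate endpoints. The unit laws take the endpoint
  as an equation, so they also apply when the object of the identity is only provably the endpoint.
  Associativity stays out, being used in both directions.\<close>

lemmas [simp] = two_category_1cells two_category_2cells two_category_hcomp

text \<open>Interchange with one pair of factors equal to the same identity 2-cell becomes
  distributivity of whiskering over vertical composition; this collapses the doubled
  identity.\<close>

lemma vcomp_id2:
  assumes "two_category K" "f \<in> Cell1 K"
  shows "vcomp K (id2 K f) (id2 K f) = id2 K f"
  using assms by simp

lemma whisker_left_vcomp:
  assumes "two_category K" "g \<in> Cell1 K" "\<alpha> \<in> Cell2 K" "\<beta> \<in> Cell2 K" "src2 K
    \<beta> = tgt2 K \<alpha>"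
    "src1 K g = tgt1 K (src2 K \<alpha>)"
  shows "whisker_left K g (vcomp K \<beta> \<alpha>) = vcomp K (whisker_left K g \<beta>) (whisker_left K g
    \<alpha>)"
  using assms interchange[of K \<alpha> \<beta> "id2 K g" "id2 K g"] by (simp add: whisker_left_def vcomp_id2)

lemma whisker_right_vcomp:
  assumes "two_category K" "f \<in> Cell1 K" "\<alpha> \<in> Cell2 K" "\<beta> \<in> Cell2 K" "src2 K
    \<beta> = tgt2 K \<alpha>"
    "src1 K (src2 K \<alpha>) = tgt1 K f"
  shows "whisker_right K (vcomp K \<beta> \<alpha>) f = vcomp K (whisker_right K \<beta> f) (whisker_right
    K \<alpha> f)"
  using assms interchange[of K "id2 K f" "id2 K f" \<alpha> \<beta>] by (simp add: whisker_right_def vcomp_id2)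

lemma two_functor_cells:
  assumes "two_functor A B F"
  shows "two_category A" and "two_category B"
    and "x \<in> Ob A \<Longrightarrow> on0 F x \<in> Ob B"
    and "x \<in> Ob A \<Longrightarrow> on1 F (id1 A x) = id1 B (on0 F x)"
    and "f \<in> Cell1 A \<Longrightarrow> on1 F f \<in> Cell1 B"
    and "f \<in> Cell1 A \<Longrightarrow> src1 B (on1 F f) = on0 F (src1 A f)"
    and "f \<in> Cell1 A \<Longrightarrow> tgt1 B (on1 F f) = on0 F (tgt1 A f)"
    and "f \<in> Cell1 A \<Longrightarrow> on2 F (id2 A f) = id2 B (on1 F f)"
    and "\<alpha> \<in> Cell2 A \<Longrightarrow> on2 F \<alpha> \<in> Cell2 B"
    and "\<alpha> \<in> Cell2 A \<Longrightarrow> src2 B (on2 F \<alpha>) = on1 F (src2 A \<alpha>)"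
    and "\<alpha> \<in> Cell2 A \<Longrightarrow> tgt2 B (on2 F \<alpha>) = on1 F (tgt2 A \<alpha>)"
  using assms by (auto simp: two_functor_def)

lemma two_functor_comp:
  assumes "two_functor A B F"
  shows "f \<in> Cell1 A \<Longrightarrow> g \<in> Cell1 A \<Longrightarrow> src1 A g = tgt1 A f
    \<Longrightarrow>
      on1 F (comp1 A g f) = comp1 B (on1 F g) (on1 F f)"
    and "\<alpha> \<in> Cell2 A \<Longrightarrow> \<beta> \<in> Cell2 A \<Longrightarrow> src2 A \<beta> =
      tgt2 A \<alpha> \<Longrightarrow>
      on2 F (vcomp A \<beta> \<alpha>) = vcomp B (on2 F \<beta>) (on2 F \<alpha>)"
    and "\<alpha> \<in> Cell2 A \<Longrightarrow> \<beta> \<in> Cell2 A \<Longrightarrow> src1 A (src2 A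
      \<beta>) = tgt1 A (src2 A \<alpha>) \<Longrightarrow>
      on2 F (hcomp A \<beta> \<alpha>) = hcomp B (on2 F \<beta>) (on2 F \<alpha>)"
  using assms by (auto simp: two_functor_def)

lemma two_functorI:
  assumes "two_category A" "two_category B"
    and "\<And>x. x \<in> Ob A \<Longrightarrow> on0 F x \<in> Ob B \<and> on1 F (id1 A x) = id1 B (on0 F x)"
    and "\<And>f. f \<in> Cell1 A \<Longrightarrow> on1 F f \<in> Cell1 B \<and> src1 B (on1 F f) = on0 F
      (src1 A f) \<and>
      tgt1 B (on1 F f) = on0 F (tgt1 A f) \<and> on2 F (id2 A f) = id2 B (on1 F f)"
    and "\<And>\<alpha>. \<alpha> \<in> Cell2 A \<Longrightarrow> on2 F \<alpha> \<in> Cell2 B \<and> src2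
      B (on2 F \<alpha>) = on1 F (src2 A \<alpha>) \<and>
      tgt2 B (on2 F \<alpha>) = on1 F (tgt2 A \<alpha>)"
    and "\<And>f g. \<lbrakk>f \<in> Cell1 A; g \<in> Cell1 A; src1 A g = tgt1 A f\<rbrakk> \<Longrightarrow>
      on1 F (comp1 A g f) = comp1 B (on1 F g) (on1 F f)"
    and "\<And>\<alpha> \<beta>. \<lbrakk>\<alpha> \<in> Cell2 A; \<beta> \<in> Cell2 A; src2 A \<beta> =
      tgt2 A \<alpha>\<rbrakk> \<Longrightarrow>
      on2 F (vcomp A \<beta> \<alpha>) = vcomp B (on2 F \<beta>) (on2 F \<alpha>)"
    and "\<And>\<alpha> \<beta>. \<lbrakk>\<alpha> \<in> Cell2 A; \<beta> \<in> Cell2 A; src1 A (src2 A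
      \<beta>) = tgt1 A (src2 A \<alpha>)\<rbrakk> \<Longrightarrow>
      on2 F (hcomp A \<beta> \<alpha>) = hcomp B (on2 F \<beta>) (on2 F \<alpha>)"
  shows "two_functor A B F"
  using assms unfolding two_functor_def by blast

lemma two_functor_id:
  assumes "two_category A" shows "two_functor A A two_id"
  by (rule two_functorI) (simp_all add: assms two_id_def)

lemma two_functor_two_comp:
  assumes F: "two_functor A B F" and G: "two_functor B C G"
  shows "two_functor A C (two_comp G F)"
  by (rule two_functorI)
    (simp_all add: two_comp_def two_functor_comp[OF F] two_functor_comp[OF G] two_functor_cells[OF F]
      two_functor_cells[OF G])

text \<open>The endpoint conditions of the category formed by horizontal composition follow from
  those of 1-cells and from the source and target 1-cells of a horizontal composite, so they do not
  appear as separate premises.\<close>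

lemma two_categoryI:
  assumes "\<And>f. f \<in> Cell1 K \<Longrightarrow> src1 K f \<in> Ob K \<and> tgt1 K f \<in> Ob K"
    and "\<And>x. x \<in> Ob K \<Longrightarrow> id1 K x \<in> Cell1 K \<and> src1 K (id1 K x) = x \<and>
      tgt1 K (id1 K x) = x"
    and "\<And>f g. \<lbrakk>f \<in> Cell1 K; g \<in> Cell1 K; src1 K g = tgt1 K f\<rbrakk> \<Longrightarrow>
      comp1 K g f \<in> Cell1 K \<and> src1 K (comp1 K g f) = src1 K f \<and> tgt1 K (comp1 K g f) = tgt1 K g"
    and "\<And>f. f \<in> Cell1 K \<Longrightarrow> comp1 K f (id1 K (src1 K f)) = f \<and> comp1 K (id1 K
      (tgt1 K f)) f = f"
    and "\<And>f g h. \<lbrakk>f \<in> Cell1 K; g \<in> Cell1 K; h \<in> Cell1 K; src1 K g = tgt1 K f; src1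
      K h = tgt1 K g\<rbrakk> \<Longrightarrow>
      comp1 K h (comp1 K g f) = comp1 K (comp1 K h g) f"
    and "\<And>\<alpha>. \<alpha> \<in> Cell2 K \<Longrightarrow> src2 K \<alpha> \<in> Cell1 K \<and> tgt2
      K \<alpha> \<in> Cell1 K \<and>
      src1 K (src2 K \<alpha>) = src1 K (tgt2 K \<alpha>) \<and> tgt1 K (src2 K \<alpha>) = tgt1 K (tgt2 K
        \<alpha>)"
    and "\<And>f. f \<in> Cell1 K \<Longrightarrow> id2 K f \<in> Cell2 K \<and> src2 K (id2 K f) = f
      \<and> tgt2 K (id2 K f) = f"
    and "\<And>\<alpha> \<beta>. \<lbrakk>\<alpha> \<in> Cell2 K; \<beta> \<in> Cell2 K; src2 K \<beta> =
      tgt2 K \<alpha>\<rbrakk> \<Longrightarrow>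
      vcomp K \<beta> \<alpha> \<in> Cell2 K \<and> src2 K (vcomp K \<beta> \<alpha>) = src2 K \<alpha>
        \<and> tgt2 K (vcomp K \<beta> \<alpha>) = tgt2 K \<beta>"
    and "\<And>\<alpha>. \<alpha> \<in> Cell2 K \<Longrightarrow>
      vcomp K \<alpha> (id2 K (src2 K \<alpha>)) = \<alpha> \<and> vcomp K (id2 K (tgt2 K \<alpha>))
        \<alpha> = \<alpha>"
    and "\<And>\<alpha> \<beta> \<gamma>. \<lbrakk>\<alpha> \<in> Cell2 K; \<beta> \<in> Cell2 K; \<gamma>
      \<in> Cell2 K; src2 K \<beta> = tgt2 K \<alpha>; src2 K \<gamma> = tgt2 K \<beta>\<rbrakk>
        \<Longrightarrow>
      vcomp K \<gamma> (vcomp K \<beta> \<alpha>) = vcomp K (vcomp K \<gamma> \<beta>) \<alpha>"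
    and "\<And>\<alpha> \<beta>. \<lbrakk>\<alpha> \<in> Cell2 K; \<beta> \<in> Cell2 K; src1 K (src2 K
      \<beta>) = tgt1 K (src2 K \<alpha>)\<rbrakk> \<Longrightarrow>
      hcomp K \<beta> \<alpha> \<in> Cell2 K \<and> src2 K (hcomp K \<beta> \<alpha>) = comp1 K (src2 K
        \<beta>) (src2 K \<alpha>) \<and>
      tgt2 K (hcomp K \<beta> \<alpha>) = comp1 K (tgt2 K \<beta>) (tgt2 K \<alpha>)"
    and "\<And>\<alpha>. \<alpha> \<in> Cell2 K \<Longrightarrow> hcomp K \<alpha> (id2 K (id1 K (src1 K
      (src2 K \<alpha>)))) = \<alpha> \<and>
      hcomp K (id2 K (id1 K (tgt1 K (src2 K \<alpha>)))) \<alpha> = \<alpha>"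
    and "\<And>\<alpha> \<beta> \<gamma>. \<lbrakk>\<alpha> \<in> Cell2 K; \<beta> \<in> Cell2 K; \<gamma>
      \<in> Cell2 K; src1 K (src2 K \<beta>) = tgt1 K (src2 K \<alpha>);
      src1 K (src2 K \<gamma>) = tgt1 K (src2 K \<beta>)\<rbrakk> \<Longrightarrow> hcomp K \<gamma> (hcomp
        K \<beta> \<alpha>) = hcomp K (hcomp K \<gamma> \<beta>) \<alpha>"
    and "\<And>f g. \<lbrakk>f \<in> Cell1 K; g \<in> Cell1 K; src1 K g = tgt1 K f\<rbrakk> \<Longrightarrow>
      hcomp K (id2 K g) (id2 K f) = id2 K (comp1 K g f)"
    and "\<And>\<alpha> \<alpha>' \<beta> \<beta>'. \<lbrakk>\<alpha> \<in> Cell2 K; \<alpha>' \<in> Cell2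
      K; \<beta> \<in> Cell2 K; \<beta>' \<in> Cell2 K; src2 K \<alpha>' = tgt2 K \<alpha>;
      src2 K \<beta>' = tgt2 K \<beta>; src1 K (src2 K \<beta>) = tgt1 K (src2 K \<alpha>)\<rbrakk>
        \<Longrightarrow>
      hcomp K (vcomp K \<beta>' \<beta>) (vcomp K \<alpha>' \<alpha>) = vcomp K (hcomp K \<beta>'
        \<alpha>') (hcomp K \<beta> \<alpha>)"
  shows "two_category K"
  unfolding two_category_def category_def hom_def cat.simps mem_Collect_eq
  by (intro conjI ballI impI; use assms in simp; fail)

section \<open>Structured objects\<close>

lemma structured_simps [simp]:
  "Ob (structured K A u P1 P2) = A"
  "src1 (structured K A u P1 P2) = fr_src"
  "tgt1 (structured K A u P1 P2) = fr_tgt"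
  "src2 (structured K A u P1 P2) \<alpha> = frame (fr_src \<alpha>) (src2 K (fr_cell \<alpha>)) (fr_tgt
    \<alpha>)"
  "tgt2 (structured K A u P1 P2) \<alpha> = frame (fr_src \<alpha>) (tgt2 K (fr_cell \<alpha>)) (fr_tgt
    \<alpha>)"
  "id1 (structured K A u P1 P2) X = frame X (id1 K (u X)) X"
  "id2 (structured K A u P1 P2) f = frame (fr_src f) (id2 K (fr_cell f)) (fr_tgt f)"
  "comp1 (structured K A u P1 P2) g f = frame (fr_src f) (comp1 K (fr_cell g) (fr_cell f)) (fr_tgt g)"
  "vcomp (structured K A u P1 P2) \<beta> \<alpha> = frame (fr_src \<alpha>) (vcomp K (fr_cell \<beta>)
    (fr_cell \<alpha>)) (fr_tgt \<alpha>)"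
  "hcomp (structured K A u P1 P2) \<beta> \<alpha> = frame (fr_src \<alpha>) (hcomp K (fr_cell \<beta>)
    (fr_cell \<alpha>)) (fr_tgt \<beta>)"
  by (simp_all add: structured_def)

lemma framed_collect: "f \<in> {frame X c Y | X c Y. R X c Y} \<longleftrightarrow> R (fr_src f) (fr_cell
  f) (fr_tgt f)"
  by (cases f) auto

lemma structured_Cell1:
  "f \<in> Cell1 (structured K A u P1 P2) \<longleftrightarrow> fr_src f \<in> A \<and> fr_tgt f \<in> A
    \<and> fr_cell f \<in> Cell1 K \<and>
     src1 K (fr_cell f) = u (fr_src f) \<and> tgt1 K (fr_cell f) = u (fr_tgt f) \<and>
     P1 (fr_src f) (fr_cell f) (fr_tgt f)"
  unfolding structured_def by (simp only: two_cat.simps framed_collect)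

lemma structured_Cell2:
  "\<alpha> \<in> Cell2 (structured K A u P1 P2) \<longleftrightarrow> fr_src \<alpha> \<in> A \<and>
    fr_tgt \<alpha> \<in> A \<and> fr_cell \<alpha> \<in> Cell2 K \<and>
     src1 K (src2 K (fr_cell \<alpha>)) = u (fr_src \<alpha>) \<and> tgt1 K (src2 K (fr_cell \<alpha>)) = u
       (fr_tgt \<alpha>) \<and>
     P1 (fr_src \<alpha>) (src2 K (fr_cell \<alpha>)) (fr_tgt \<alpha>) \<and> P1 (fr_src \<alpha>) (tgt2 K
       (fr_cell \<alpha>)) (fr_tgt \<alpha>) \<and>
     P2 (fr_src \<alpha>) (fr_cell \<alpha>) (fr_tgt \<alpha>)"
  unfolding structured_def by (simp only: two_cat.simps framed_collect)

text \<open>The operations act on the cell fields as in \<open>K\<close>, so the equations of a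
  2-category are inherited; what remains is closure of the two conditions under identities and
  composition.\<close>

lemma structured_two_category:
  assumes K: "two_category K" and u: "\<And>X. X \<in> A \<Longrightarrow> u X \<in> Ob K"
    and P1_id: "\<And>X. X \<in> A \<Longrightarrow> P1 X (id1 K (u X)) X"
    and P1_comp: "\<And>X Y Z f g. \<lbrakk>X \<in> A; Y \<in> A; Z \<in> A; f \<in> Cell1 K; g \<in> Cell1
      K; src1 K f = u X; tgt1 K f = u Y;
        src1 K g = u Y; tgt1 K g = u Z; P1 X f Y; P1 Y g Z\<rbrakk> \<Longrightarrow> P1 X (comp1 K g f) Z"
    and P2_id: "\<And>X Y f. \<lbrakk>X \<in> A; Y \<in> A; f \<in> Cell1 K; src1 K f = u X; tgt1 K f = u
      Y; P1 X f Y\<rbrakk> \<Longrightarrow> P2 X (id2 K f) Y"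
    and P2_vcomp: "\<And>X Y \<alpha> \<beta>. \<lbrakk>X \<in> A; Y \<in> A; \<alpha> \<in> Cell2 K;
      \<beta> \<in> Cell2 K; src2 K \<beta> = tgt2 K \<alpha>;
        src1 K (src2 K \<alpha>) = u X; tgt1 K (src2 K \<alpha>) = u Y; P2 X \<alpha> Y; P2 X \<beta>
          Y\<rbrakk> \<Longrightarrow> P2 X (vcomp K \<beta> \<alpha>) Y"
    and P2_hcomp: "\<And>X Y Z \<alpha> \<beta>. \<lbrakk>X \<in> A; Y \<in> A; Z \<in> A; \<alpha> \<in>
      Cell2 K; \<beta> \<in> Cell2 K;
        src1 K (src2 K \<alpha>) = u X; tgt1 K (src2 K \<alpha>) = u Y;
        src1 K (src2 K \<beta>) = u Y; tgt1 K (src2 K \<beta>) = u Z; P2 X \<alpha> Y; P2 Y \<beta>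
          Z\<rbrakk> \<Longrightarrow> P2 X (hcomp K \<beta> \<alpha>) Z"
  shows "two_category (structured K A u P1 P2)"
proof -
  note [simp] = K u
  show ?thesis
    by (rule two_categoryI)
      (auto simp: structured_Cell1 structured_Cell2 comp1_assoc vcomp_assoc hcomp_assoc hcomp_id2 interchange
        P1_id P2_id intro: P1_comp P2_vcomp P2_hcomp)
qed

lemma two_functor_structured:
  assumes S: "two_category (structured K A u P1 P2)" and S': "two_category (structured L A' u' P1' P2')"
    and D: "two_functor K L D"
    and ob: "\<And>X. X \<in> A \<Longrightarrow> ob X \<in> A' \<and> u X \<in> Ob K \<and> u' (ob X) =
      on0 D (u X)"
    and P1: "\<And>X f Y. \<lbrakk>X \<in> A; Y \<in> A; f \<in> Cell1 K; src1 K f = u X; tgt1 K f = u Y;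
      P1 X f Y\<rbrakk> \<Longrightarrow>
      P1' (ob X) (on1 D f) (ob Y)"
    and P2: "\<And>X \<alpha> Y. \<lbrakk>X \<in> A; Y \<in> A; \<alpha> \<in> Cell2 K; src1 K (src2 K
      \<alpha>) = u X; tgt1 K (src2 K \<alpha>) = u Y;
      P1 X (src2 K \<alpha>) Y; P1 X (tgt2 K \<alpha>) Y; P2 X \<alpha> Y\<rbrakk> \<Longrightarrow> P2'
        (ob X) (on2 D \<alpha>) (ob Y)"
  shows "two_functor (structured K A u P1 P2) (structured L A' u' P1' P2')
    \<lparr>on0 = ob, on1 = (\<lambda>f. frame (ob (fr_src f)) (on1 D (fr_cell f)) (ob (fr_tgt f))),
      on2 = (\<lambda>\<alpha>. frame (ob (fr_src \<alpha>)) (on2 D (fr_cell \<alpha>)) (ob (fr_tgt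
        \<alpha>)))\<rparr>"
proof -
  note [simp] = two_functor_cells[OF D] two_functor_comp[OF D] ob
  show ?thesis
    by (rule two_functorI) (auto simp: structured_Cell1 structured_Cell2 S S' intro: P1 P2)
qed

text \<open>The case of the identity 2-functor on underlying cells, stated apart for maps that only
  change the structure on objects, namely \<Gamma> and its inverse.\<close>

lemma two_functor_structured_id:
  assumes "two_category K" "two_category (structured K A u P1 P2)" "two_category (structured K A' u' P1' P2')"
    and ob: "\<And>X. X \<in> A \<Longrightarrow> ob X \<in> A' \<and> u X \<in> Ob K \<and> u' (ob X) = u X"
    and P1: "\<And>X f Y. \<lbrakk>X \<in> A; Y \<in> A; f \<in> Cell1 K; src1 K f = u X; tgt1 K f = u Y;
      P1 X f Y\<rbrakk> \<Longrightarrow>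
      P1' (ob X) f (ob Y)"
    and P2: "\<And>X \<alpha> Y. \<lbrakk>X \<in> A; Y \<in> A; \<alpha> \<in> Cell2 K; src1 K (src2 K
      \<alpha>) = u X; tgt1 K (src2 K \<alpha>) = u Y;
      P1 X (src2 K \<alpha>) Y; P1 X (tgt2 K \<alpha>) Y; P2 X \<alpha> Y\<rbrakk> \<Longrightarrow> P2'
        (ob X) \<alpha> (ob Y)"
  shows "two_functor (structured K A u P1 P2) (structured K A' u' P1' P2')
    \<lparr>on0 = ob, on1 = (\<lambda>f. frame (ob (fr_src f)) (fr_cell f) (ob (fr_tgt f))),
      on2 = (\<lambda>\<alpha>. frame (ob (fr_src \<alpha>)) (fr_cell \<alpha>) (ob (fr_tgt \<alpha>)))\<rparr>"
  using two_functor_structured[OF assms(2,3) two_functor_id[OF assms(1)], of ob] ob P1 P2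
  by (simp add: two_id_def)

lemma two_functor_forget:
  assumes "two_category K" "two_category (structured K A u P1 P2)" "\<And>X. X \<in> A \<Longrightarrow> u
    X \<in> Ob K"
  shows "two_functor (structured K A u P1 P2) K (forget u)"
  by (rule two_functorI) (use assms in \<open>auto simp: structured_Cell1 structured_Cell2 forget_def\<close>)

section \<open>Arrow 2-categories\<close>

lemma two_prod_simps [simp]:
  "Ob (two_prod K L) = Ob K \<times> Ob L" "Cell1 (two_prod K L) = Cell1 K \<times> Cell1 L"
  "Cell2 (two_prod K L) = Cell2 K \<times> Cell2 L"
  "src1 (two_prod K L) = map_prod (src1 K) (src1 L)" "tgt1 (two_prod K L) = map_prod (tgt1 K) (tgt1 L)"
  "src2 (two_prod K L) = map_prod (src2 K) (src2 L)" "tgt2 (two_prod K L) = map_prod (tgt2 K) (tgt2 L)"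
  "id1 (two_prod K L) = map_prod (id1 K) (id1 L)" "id2 (two_prod K L) = map_prod (id2 K) (id2 L)"
  "comp1 (two_prod K L) g f = (comp1 K (fst g) (fst f), comp1 L (snd g) (snd f))"
  "vcomp (two_prod K L) \<beta> \<alpha> = (vcomp K (fst \<beta>) (fst \<alpha>), vcomp L (snd \<beta>)
    (snd \<alpha>))"
  "hcomp (two_prod K L) \<beta> \<alpha> = (hcomp K (fst \<beta>) (fst \<alpha>), hcomp L (snd \<beta>)
    (snd \<alpha>))"
  by (simp_all add: two_prod_def)

lemma two_category_two_prod:
  assumes "two_category K" "two_category L"
  shows "two_category (two_prod K L)"
  by (rule two_categoryI)
    (use assms in \<open>auto simp: comp1_assoc vcomp_assoc hcomp_assoc hcomp_id2 interchange\<close>)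

text \<open>Slide the outer 1-cell through: \<open>R\<close> \<beta>' \<beta> = \<alpha>'
  \<open>Q\<close> \<beta> = \<alpha>' \<alpha> \<open>P\<close>. In \<open>arrow2\<close> the
  1-cells \<open>P\<close>, \<open>Q\<close>, \<open>R\<close> are objects; in \<open>Alg\<close>
  they are the algebra structures, and \<beta>, \<beta>' are images under the monad.\<close>

lemma hcomp_whiskered_squares:
  assumes K: "two_category K"
    and cells: "\<beta> \<in> Cell2 K" "\<beta>' \<in> Cell2 K" "\<alpha> \<in> Cell2 K" "\<alpha>' \<in>
      Cell2 K" "P \<in> Cell1 K" "Q \<in> Cell1 K" "R \<in> Cell1 K"
    and ends: "src1 K (src2 K \<beta>) = src1 K P" "tgt1 K (src2 K \<beta>) = src1 K Q"
      "src1 K (src2 K \<beta>') = src1 K Q" "tgt1 K (src2 K \<beta>') = src1 K R"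
      "src1 K (src2 K \<alpha>) = tgt1 K P" "tgt1 K (src2 K \<alpha>) = tgt1 K Q"
      "src1 K (src2 K \<alpha>') = tgt1 K Q" "tgt1 K (src2 K \<alpha>') = tgt1 K R"
    and sq: "whisker_left K Q \<beta> = whisker_right K \<alpha> P" and sq': "whisker_left K R \<beta>' =
      whisker_right K \<alpha>' Q"
  shows "whisker_left K R (hcomp K \<beta>' \<beta>) = whisker_right K (hcomp K \<alpha>' \<alpha>) P"
proof -
  have "whisker_left K R (hcomp K \<beta>' \<beta>) = hcomp K (whisker_left K R \<beta>') \<beta>"
    using K cells ends by (simp add: whisker_left_def hcomp_assoc)
  also have "\<dots> = hcomp K \<alpha>' (whisker_left K Q \<beta>)"
    unfolding sq' using K cells ends by (simp add: whisker_left_def whisker_right_def hcomp_assoc)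
  also have "\<dots> = whisker_right K (hcomp K \<alpha>' \<alpha>) P"
    unfolding sq using K cells ends by (simp add: whisker_right_def hcomp_assoc)
  finally show ?thesis .
qed

lemma two_category_arrow2:
  assumes K: "two_category K"
  shows "two_category (arrow2 K)"
  unfolding arrow2_def
proof (rule structured_two_category, goal_cases)
  case 1 show ?case using K by (rule two_category_two_prod) (rule K)
next
  case (4 X Y Z f g)
  then show ?case using K by (cases f; cases g) (clarsimp; metis comp1_assoc)
next
  case (6 X Y \<alpha> \<beta>)
  then show ?case using K by (cases \<alpha>; cases \<beta>) (auto simp: whisker_left_vcomp whisker_right_vcomp)
next
  case (7 X Y Z \<alpha> \<beta>)
  then show ?case using K by (cases \<alpha>; cases \<beta>) (auto intro: hcomp_whiskered_squares)
qed (use K in \<open>auto simp: whisker_left_def whisker_right_def hcomp_id2\<close>)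

lemma arrow2_Cell1:
  "F \<in> Cell1 (arrow2 K) \<longleftrightarrow> fr_src F \<in> Cell1 K \<and> fr_tgt F \<in> Cell1 K \<and>
     fst (fr_cell F) \<in> Cell1 K \<and> snd (fr_cell F) \<in> Cell1 K \<and>
     src1 K (fst (fr_cell F)) = src1 K (fr_src F) \<and> src1 K (snd (fr_cell F)) = tgt1 K (fr_src F) \<and>
     tgt1 K (fst (fr_cell F)) = src1 K (fr_tgt F) \<and> tgt1 K (snd (fr_cell F)) = tgt1 K (fr_tgt F) \<and>
     comp1 K (fr_tgt F) (fst (fr_cell F)) = comp1 K (snd (fr_cell F)) (fr_src F)"
  by (cases "fr_cell F") (auto simp: arrow2_def structured_Cell1)

text \<open>Both boundary squares are phrased as frames in \<open>Cell1 (arrow2 K)\<close>, so that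
  the description of the 1-cells of \<open>CAT2\<close> rewrites them.\<close>

lemma arrow2_Cell2:
  "\<phi> \<in> Cell2 (arrow2 K) \<longleftrightarrow>
     frame (fr_src \<phi>) (src2 K (fst (fr_cell \<phi>)), src2 K (snd (fr_cell \<phi>))) (fr_tgt \<phi>)
       \<in> Cell1 (arrow2 K) \<and>
     frame (fr_src \<phi>) (tgt2 K (fst (fr_cell \<phi>)), tgt2 K (snd (fr_cell \<phi>))) (fr_tgt \<phi>)
       \<in> Cell1 (arrow2 K) \<and>
     fst (fr_cell \<phi>) \<in> Cell2 K \<and> snd (fr_cell \<phi>) \<in> Cell2 K \<and>
     whisker_left K (fr_tgt \<phi>) (fst (fr_cell \<phi>)) = whisker_right K (snd (fr_cell \<phi>)) (fr_src
       \<phi>)"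
  if "two_category K"
  by (cases "fr_cell \<phi>") (use that in \<open>auto simp: arrow2_def structured_Cell1
    structured_Cell2\<close>)

lemma arrow2_simps [simp]:
  "Ob (arrow2 K) = Cell1 K"
  "src1 (arrow2 K) = fr_src"
  "tgt1 (arrow2 K) = fr_tgt"
  "src2 (arrow2 K) \<alpha> = frame (fr_src \<alpha>) (src2 K (fst (fr_cell \<alpha>)), src2 K (snd
    (fr_cell \<alpha>))) (fr_tgt \<alpha>)"
  "tgt2 (arrow2 K) \<alpha> = frame (fr_src \<alpha>) (tgt2 K (fst (fr_cell \<alpha>)), tgt2 K (snd
    (fr_cell \<alpha>))) (fr_tgt \<alpha>)"
  "id1 (arrow2 K) X = frame X (id1 K (src1 K X), id1 K (tgt1 K X)) X"
  "id2 (arrow2 K) f = frame (fr_src f) (id2 K (fst (fr_cell f)), id2 K (snd (fr_cell f))) (fr_tgt f)"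
  "comp1 (arrow2 K) g f = frame (fr_src f) (comp1 K (fst (fr_cell g)) (fst (fr_cell f)),
     comp1 K (snd (fr_cell g)) (snd (fr_cell f))) (fr_tgt g)"
  "vcomp (arrow2 K) \<beta> \<alpha> = frame (fr_src \<alpha>) (vcomp K (fst (fr_cell \<beta>)) (fst
    (fr_cell \<alpha>)),
     vcomp K (snd (fr_cell \<beta>)) (snd (fr_cell \<alpha>))) (fr_tgt \<alpha>)"
  "hcomp (arrow2 K) \<beta> \<alpha> = frame (fr_src \<alpha>) (hcomp K (fst (fr_cell \<beta>)) (fst
    (fr_cell \<alpha>)),
     hcomp K (snd (fr_cell \<beta>)) (snd (fr_cell \<alpha>))) (fr_tgt \<beta>)"
  by (simp_all add: arrow2_def map_prod_def split_beta)

lemma two_functor_Dom2: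
  assumes "two_category K"
  shows "two_functor (arrow2 K) K (Dom2 K)"
  by (rule two_functorI)
    (use assms two_category_arrow2[OF assms] in \<open>auto simp: arrow2_Cell1 arrow2_Cell2 Dom2_def\<close>)

section \<open>Strict algebras and colax morphisms\<close>

lemma is_strict_algebraD:
  assumes "is_strict_algebra K M X"
  shows "fst X \<in> Ob K" "snd X \<in> Cell1 K" "src1 K (snd X) = on0 (endo M) (fst X)" "tgt1 K (snd X) =
    fst X"
    "comp1 K (snd X) (unit2 M (fst X)) = id1 K (fst X)"
    "comp1 K (snd X) (mult2 M (fst X)) = comp1 K (snd X) (on1 (endo M) (snd X))"
  using assms by (auto simp: is_strict_algebra_def split_beta)

lemma two_category_Alg:
  assumes M: "two_functor K K (endo M)"
  shows "two_category (Alg K M)"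
proof -
  have K: "two_category K" using M by (rule two_functor_cells)
  note [simp] = K two_functor_cells[OF M] two_functor_comp[OF M] is_strict_algebraD
  show ?thesis
    unfolding Alg_def
  proof (rule structured_two_category, goal_cases)
    case (4 X Y Z f g)
    then have alg: "is_strict_algebra K M X" "is_strict_algebra K M Y" "is_strict_algebra K M Z" by auto
    have "comp1 K (comp1 K g f) (snd X) = comp1 K g (comp1 K (snd Y) (on1 (endo M) f))"
      using alg 4 by (simp add: comp1_assoc split_beta)
    also have "\<dots> = comp1 K (comp1 K (snd Z) (on1 (endo M) g)) (on1 (endo M) f)"
      using alg 4 by (simp add: comp1_assoc[symmetric] split_beta)
    finally show ?case using alg 4 by (simp add: comp1_assoc split_beta)
  next
    case (6 X Y \<alpha> \<beta>)
    then show ?case by (auto simp: whisker_left_vcomp whisker_right_vcomp split_beta)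
  next
    case (7 X Y Z \<alpha> \<beta>)
    then have alg: "is_strict_algebra K M X" "is_strict_algebra K M Y" "is_strict_algebra K M Z" by auto
    have "on2 (endo M) (hcomp K \<beta> \<alpha>) = hcomp K (on2 (endo M) \<beta>) (on2 (endo M) \<alpha>)"
      using 7 by (simp add: two_functor_comp(3)[OF M])
    moreover have "whisker_left K (snd Z) (hcomp K (on2 (endo M) \<beta>) (on2 (endo M) \<alpha>)) =
      whisker_right K (hcomp K \<beta> \<alpha>) (snd X)"
      by (rule hcomp_whiskered_squares[of K _ _ _ _ _ "snd Y"]) (use alg 7 in \<open>auto simp:
        split_beta\<close>)
    ultimately show ?case by (simp add: split_beta)
  qed (auto simp: whisker_left_def whisker_right_def hcomp_id2 split_beta)
qed

lemma two_naturalI: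
  assumes "two_functor A B F" "two_functor A B G"
    and "\<And>x. x \<in> Ob A \<Longrightarrow> \<theta> x \<in> Cell1 B \<and> src1 B (\<theta> x) = on0
      F x \<and> tgt1 B (\<theta> x) = on0 G x"
    and "\<And>f. f \<in> Cell1 A \<Longrightarrow> comp1 B (on1 G f) (\<theta> (src1 A f)) = comp1 B
      (\<theta> (tgt1 A f)) (on1 F f)"
    and "\<And>\<alpha>. \<alpha> \<in> Cell2 A \<Longrightarrow> whisker_right B (on2 G \<alpha>)
      (\<theta> (src1 A (src2 A \<alpha>))) =
                     whisker_left B (\<theta> (tgt1 A (src2 A \<alpha>))) (on2 F \<alpha>)"
  shows "two_natural A B F G \<theta>"
  using assms unfolding two_natural_def by blast

lemma two_naturalD:
  assumes "two_natural A B F G \<theta>"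
  shows "two_functor A B F" "two_functor A B G"
    and "x \<in> Ob A \<Longrightarrow> \<theta> x \<in> Cell1 B" "x \<in> Ob A \<Longrightarrow> src1 B
      (\<theta> x) = on0 F x"
      "x \<in> Ob A \<Longrightarrow> tgt1 B (\<theta> x) = on0 G x"
    and "f \<in> Cell1 A \<Longrightarrow> comp1 B (on1 G f) (\<theta> (src1 A f)) = comp1 B (\<theta>
      (tgt1 A f)) (on1 F f)"
    and "\<alpha> \<in> Cell2 A \<Longrightarrow> whisker_right B (on2 G \<alpha>) (\<theta> (src1 A (src2
      A \<alpha>))) =
                     whisker_left B (\<theta> (tgt1 A (src2 A \<alpha>))) (on2 F \<alpha>)"
  using assms unfolding two_natural_def by blast+

locale colax =
  fixes K :: "('o, 'm, 't) two_cat" and M :: "('o, 'm, 't) two_monad"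
    and L :: "('p, 'n, 's) two_cat" and N :: "('p, 'n, 's) two_monad"
    and D :: "('o, 'm, 't, 'p, 'n, 's) two_map" and \<kappa> :: "'o \<Rightarrow> 'n"
  assumes colax_morphism: "colax_morphism K M L N D \<kappa>"
begin

lemma functors: "two_functor K K (endo M)" "two_functor L L (endo N)" "two_functor K L D"
  using colax_morphism by (auto simp: colax_morphism_def strict_two_monad_def)

lemma categories [simp]: "two_category K" "two_category L"
  using functors(3) by (auto dest: two_functor_cells(1,2))

lemmas functor_cells [simp] =
  two_functor_cells(3-)[OF functors(1)] two_functor_cells(3-)[OF functors(2)] two_functor_cells(3-)[OF
    functors(3)]

lemmas D_comp = two_functor_comp[OF functors(3)]

lemma monad_cells [simp]:
  assumes "x \<in> Ob K"
  shows "unit2 M x \<in> Cell1 K" "src1 K (unit2 M x) = x" "tgt1 K (unit2 M x) = on0 (endo M) x"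
    and "mult2 M x \<in> Cell1 K" "src1 K (mult2 M x) = on0 (endo M) (on0 (endo M) x)"
      "tgt1 K (mult2 M x) = on0 (endo M) x"
  using assms colax_morphism
  by (auto simp: colax_morphism_def strict_two_monad_def two_natural_def two_comp_def two_id_def)

lemma target_monad_cells [simp]:
  assumes "x \<in> Ob L"
  shows "unit2 N x \<in> Cell1 L" "src1 L (unit2 N x) = x" "tgt1 L (unit2 N x) = on0 (endo N) x"
    and "mult2 N x \<in> Cell1 L" "src1 L (mult2 N x) = on0 (endo N) (on0 (endo N) x)"
      "tgt1 L (mult2 N x) = on0 (endo N) x"
  using assms colax_morphism
  by (auto simp: colax_morphism_def strict_two_monad_def two_natural_def two_comp_def two_id_def)

lemma natural: "two_natural K L (two_comp (endo N) D) (two_comp D (endo M)) \<kappa>"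
  using colax_morphism by (simp add: colax_morphism_def)

lemma \<kappa>_cells [simp]:
  assumes "x \<in> Ob K"
  shows "\<kappa> x \<in> Cell1 L" "src1 L (\<kappa> x) = on0 (endo N) (on0 D x)" "tgt1 L (\<kappa> x) =
    on0 D (on0 (endo M) x)"
  using two_naturalD(3-5)[OF natural assms] by (simp_all add: two_comp_def)

lemma \<kappa>_natural:
  assumes "f \<in> Cell1 K"
  shows "comp1 L (on1 D (on1 (endo M) f)) (\<kappa> (src1 K f)) = comp1 L (\<kappa> (tgt1 K f)) (on1 (endo
    N) (on1 D f))"
  using two_naturalD(6)[OF natural assms] by (simp add: two_comp_def)

lemma \<kappa>_natural2:
  assumes "\<alpha> \<in> Cell2 K"
  shows "whisker_right L (on2 D (on2 (endo M) \<alpha>)) (\<kappa> (src1 K (src2 K \<alpha>))) =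
    whisker_left L (\<kappa> (tgt1 K (src2 K \<alpha>))) (on2 (endo N) (on2 D \<alpha>))"
  using two_naturalD(7)[OF natural assms] by (simp add: two_comp_def)

lemma \<kappa>_monad:
  assumes "x \<in> Ob K"
  shows "comp1 L (\<kappa> x) (unit2 N (on0 D x)) = on1 D (unit2 M x)"
    and "comp1 L (\<kappa> x) (mult2 N (on0 D x)) =
          comp1 L (on1 D (mult2 M x)) (comp1 L (\<kappa> (on0 (endo M) x)) (on1 (endo N) (\<kappa> x)))"
  using assms colax_morphism by (auto simp: colax_morphism_def)

abbreviation "action X \<equiv> comp1 L (on1 D (snd X)) (\<kappa> (fst X))"

text \<open>For the multiplication law, \<open>\<kappa>_monad\<close> trades the multiplication of
  \<open>N\<close> for that of \<open>M\<close>, the algebra law of \<open>a\<close> replaces the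
  latter by the monad applied to \<open>a\<close>, and naturality of \<kappa> at the 1-cell
  \<open>a\<close> carries this past \<kappa>.\<close>

lemma is_strict_algebra_action:
  assumes "is_strict_algebra K M X"
  shows "is_strict_algebra L N (on0 D (fst X), action X)"
proof -
  obtain x a where X: "X = (x, a)" by (cases X)
  note a [simp] = is_strict_algebraD[OF assms, unfolded X fst_conv snd_conv]
  have unit: "comp1 L (action X) (unit2 N (on0 D x)) = id1 L (on0 D x)"
    by (simp add: X comp1_assoc \<kappa>_monad D_comp[symmetric])
  have "comp1 L (action X) (mult2 N (on0 D x)) =
      comp1 L (on1 D (comp1 K a (mult2 M x))) (comp1 L (\<kappa> (on0 (endo M) x)) (on1 (endo N) (\<kappa> x)))"
    by (simp add: X comp1_assoc \<kappa>_monad D_comp del: a(6))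
  also have "\<dots> = comp1 L (on1 D a) (comp1 L (comp1 L (on1 D (on1 (endo M) a)) (\<kappa> (on0 (endo M)
    x))) (on1 (endo N) (\<kappa> x)))"
    by (simp add: comp1_assoc D_comp)
  also have "\<dots> = comp1 L (action X) (on1 (endo N) (action X))"
    using \<kappa>_natural[of a] by (simp add: X comp1_assoc two_functor_comp[OF functors(2)])
  finally show ?thesis using unit by (simp add: X is_strict_algebra_def)
qed

lemma action_morphism:
  assumes X: "is_strict_algebra K M X" and Y: "is_strict_algebra K M Y"
    and f: "f \<in> Cell1 K" "src1 K f = fst X" "tgt1 K f = fst Y"
    and alg: "comp1 K f (snd X) = comp1 K (snd Y) (on1 (endo M) f)"
  shows "comp1 L (on1 D f) (action X) = comp1 L (action Y) (on1 (endo N) (on1 D f))"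
proof -
  note [simp] = is_strict_algebraD[OF X] is_strict_algebraD[OF Y] f
  have "comp1 L (on1 D f) (action X) = comp1 L (on1 D (comp1 K f (snd X))) (\<kappa> (fst X))"
    by (simp add: comp1_assoc D_comp del: alg)
  also have "\<dots> = comp1 L (on1 D (snd Y)) (comp1 L (on1 D (on1 (endo M) f)) (\<kappa> (src1 K f)))"
    unfolding alg by (simp add: comp1_assoc D_comp)
  also have "\<dots> = comp1 L (action Y) (on1 (endo N) (on1 D f))"
    unfolding \<kappa>_natural[OF f(1)] by (simp add: comp1_assoc)
  finally show ?thesis .
qed

text \<open>Same route as for 1-cells: \<open>D\<close> preserves the two whiskerings in the algebra
  equation, and the 2-dimensional naturality of \<kappa> at \<alpha> moves the monad across.\<close>

lemma action_2cell:
  assumes X: "is_strict_algebra K M X" and Y: "is_strict_algebra K M Y"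
    and \<alpha>: "\<alpha> \<in> Cell2 K" "src1 K (src2 K \<alpha>) = fst X" "tgt1 K (src2 K \<alpha>) = fst Y"
    and alg: "whisker_right K \<alpha> (snd X) = whisker_left K (snd Y) (on2 (endo M) \<alpha>)"
  shows "whisker_right L (on2 D \<alpha>) (action X) = whisker_left L (action Y) (on2 (endo N) (on2 D
    \<alpha>))"
proof -
  note [simp] = is_strict_algebraD[OF X] is_strict_algebraD[OF Y] \<alpha>
  have D_wr: "on2 D (whisker_right K \<alpha> (snd X)) = whisker_right L (on2 D \<alpha>) (on1 D (snd X))"
    by (simp add: whisker_right_def D_comp)
  have D_wl: "on2 D (whisker_left K (snd Y) (on2 (endo M) \<alpha>)) =
      whisker_left L (on1 D (snd Y)) (on2 D (on2 (endo M) \<alpha>))"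
    by (simp add: whisker_left_def D_comp)
  have "whisker_right L (on2 D \<alpha>) (action X) =
      whisker_right L (whisker_right L (on2 D \<alpha>) (on1 D (snd X))) (\<kappa> (fst X))"
    by (simp add: whisker_right_def hcomp_assoc hcomp_id2)
  also have "\<dots> = whisker_left L (on1 D (snd Y)) (whisker_right L (on2 D (on2 (endo M) \<alpha>))
    (\<kappa> (src1 K (src2 K \<alpha>))))"
    unfolding D_wr[symmetric] alg D_wl by (simp add: whisker_left_def whisker_right_def hcomp_assoc)
  also have "\<dots> = whisker_left L (action Y) (on2 (endo N) (on2 D \<alpha>))"
    unfolding \<kappa>_natural2[OF \<alpha>(1)]
    by (simp add: whisker_left_def hcomp_assoc[symmetric] hcomp_id2)
  finally show ?thesis .
qed

lemma two_functor_alg_pull: "two_functor (Alg K M) (Alg L N) (alg_pull L D \<kappa>)"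
  using two_category_Alg[OF functors(1)] two_category_Alg[OF functors(2)] unfolding Alg_def alg_pull_def
    Let_def split_beta
  by (rule two_functor_structured[OF _ _ functors(3)])
    (auto simp: is_strict_algebra_action is_strict_algebraD intro: action_morphism action_2cell)

end

section \<open>The 2-category of locally small categories\<close>

lemma categoryD:
  assumes "category C"
  shows "f \<in> Arr C \<Longrightarrow> Src C f \<in> Obj C"
    and "f \<in> Arr C \<Longrightarrow> Tgt C f \<in> Obj C"
    and "x \<in> Obj C \<Longrightarrow> Idn C x \<in> Arr C"
    and "x \<in> Obj C \<Longrightarrow> Src C (Idn C x) = x"
    and "x \<in> Obj C \<Longrightarrow> Tgt C (Idn C x) = x"
    and "f \<in> Arr C \<Longrightarrow> g \<in> Arr C \<Longrightarrow> Src C g = Tgt C f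
      \<Longrightarrow> Cmp C g f \<in> Arr C"
    and "f \<in> Arr C \<Longrightarrow> g \<in> Arr C \<Longrightarrow> Src C g = Tgt C f
      \<Longrightarrow> Src C (Cmp C g f) = Src C f"
    and "f \<in> Arr C \<Longrightarrow> g \<in> Arr C \<Longrightarrow> Src C g = Tgt C f
      \<Longrightarrow> Tgt C (Cmp C g f) = Tgt C g"
    and "f \<in> Arr C \<Longrightarrow> Src C f = x \<Longrightarrow> Cmp C f (Idn C x) = f"
    and "f \<in> Arr C \<Longrightarrow> Tgt C f = x \<Longrightarrow> Cmp C (Idn C x) f = f"
    and "f \<in> Arr C \<Longrightarrow> g \<in> Arr C \<Longrightarrow> h \<in> Arr C \<Longrightarrow>
      Src C g = Tgt C f \<Longrightarrow> Src C h = Tgt C g \<Longrightarrow>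
      Cmp C (Cmp C h g) f = Cmp C h (Cmp C g f)"
  using assms unfolding category_def hom_def by auto

lemmas [simp] = categoryD(1-10)
lemmas Cmp_assoc = categoryD(11)

lemma categoryI:
  assumes "\<And>f. f \<in> Arr C \<Longrightarrow> Src C f \<in> Obj C \<and> Tgt C f \<in> Obj C"
    and "\<And>x. x \<in> Obj C \<Longrightarrow> Idn C x \<in> Arr C \<and> Src C (Idn C x) = x \<and> Tgt
      C (Idn C x) = x"
    and "\<And>f g. \<lbrakk>f \<in> Arr C; g \<in> Arr C; Src C g = Tgt C f\<rbrakk> \<Longrightarrow>
      Cmp C g f \<in> Arr C \<and> Src C (Cmp C g f) = Src C f \<and> Tgt C (Cmp C g f) = Tgt C g"
    and "\<And>f. f \<in> Arr C \<Longrightarrow> Cmp C f (Idn C (Src C f)) = f \<and> Cmp C (Idn C (Tgt C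
      f)) f = f"
    and "\<And>f g h. \<lbrakk>f \<in> Arr C; g \<in> Arr C; h \<in> Arr C; Src C g = Tgt C f; Src C h =
      Tgt C g\<rbrakk> \<Longrightarrow>
      Cmp C h (Cmp C g f) = Cmp C (Cmp C h g) f"
  shows "category C"
  using assms unfolding category_def hom_def by blast

text \<open>Source and target enter as equations, so that the rules rewrite also where a category is
  known only up to a provable equation, such as \<open>fsrc T = fsrc P\<close> for a square.\<close>

lemma is_functorD:
  assumes "is_functor F"
  shows "fsrc F = C \<Longrightarrow> category C" "ftgt F = D \<Longrightarrow> category D"
    and "fsrc F = C \<Longrightarrow> ftgt F = D \<Longrightarrow> x \<in> Obj C \<Longrightarrow> fob F x
      \<in> Obj D"
    and "fsrc F = C \<Longrightarrow> ftgt F = D \<Longrightarrow> f \<in> Arr C \<Longrightarrow> far F f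
      \<in> Arr D"
    and "fsrc F = C \<Longrightarrow> ftgt F = D \<Longrightarrow> f \<in> Arr C \<Longrightarrow> Src D
      (far F f) = fob F (Src C f)"
    and "fsrc F = C \<Longrightarrow> ftgt F = D \<Longrightarrow> f \<in> Arr C \<Longrightarrow> Tgt D
      (far F f) = fob F (Tgt C f)"
    and "fsrc F = C \<Longrightarrow> ftgt F = D \<Longrightarrow> x \<in> Obj C \<Longrightarrow> far F
      (Idn C x) = Idn D (fob F x)"
    and "fsrc F = C \<Longrightarrow> ftgt F = D \<Longrightarrow> f \<in> Arr C \<Longrightarrow> g \<in>
      Arr C \<Longrightarrow> Src C g = Tgt C f \<Longrightarrow>
      far F (Cmp C g f) = Cmp D (far F g) (far F f)"
    and "fob F \<in> extensional (Obj (fsrc F))" "far F \<in> extensional (Arr (fsrc F))"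
  using assms unfolding is_functor_def by (auto simp: PiE_iff)

lemma is_functor_categories [simp]: "is_functor F \<Longrightarrow> category (fsrc F)" "is_functor F
  \<Longrightarrow> category (ftgt F)"
  by (simp_all add: is_functorD)

lemmas [simp] = is_functorD(3-)

text \<open>The last premise supplies the composite as an arrow: functors defined by restriction
  unfold only on arguments known to lie in the domain.\<close>

lemma is_functorI:
  assumes "category (fsrc F)" "category (ftgt F)"
    and "fob F \<in> extensional (Obj (fsrc F))" "far F \<in> extensional (Arr (fsrc F))"
    and "\<And>x. x \<in> Obj (fsrc F) \<Longrightarrow> fob F x \<in> Obj (ftgt F) \<and> far F (Idn (fsrc
      F) x) = Idn (ftgt F) (fob F x)"
    and "\<And>f. f \<in> Arr (fsrc F) \<Longrightarrow> far F f \<in> Arr (ftgt F) \<and> Src (ftgt F)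
      (far F f) = fob F (Src (fsrc F) f) \<and>
      Tgt (ftgt F) (far F f) = fob F (Tgt (fsrc F) f)"
    and "\<And>f g. \<lbrakk>f \<in> Arr (fsrc F); g \<in> Arr (fsrc F); Src (fsrc F) g = Tgt (fsrc F) f;
      Cmp (fsrc F) g f \<in> Arr (fsrc F)\<rbrakk> \<Longrightarrow> far F (Cmp (fsrc F) g f) = Cmp (ftgt
        F) (far F g) (far F f)"
  shows "is_functor F"
  using assms categoryD(6)[OF assms(1)] unfolding is_functor_def PiE_iff by blast

lemma fctr_eqI:
  assumes "is_functor F" "is_functor G" and src: "fsrc F = fsrc G" and "ftgt F = ftgt G"
    and "\<And>x. x \<in> Obj (fsrc F) \<Longrightarrow> fob F x = fob G x"
    and "\<And>f. f \<in> Arr (fsrc F) \<Longrightarrow> far F f = far G f"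
  shows "F = G"
proof -
  have "fob F = fob G"
    by (rule extensionalityI[of _ "Obj (fsrc F)"]) (use assms is_functorD(9)[OF assms(1)] is_functorD(9)[OF
      assms(2)] in auto)
  moreover have "far F = far G"
    by (rule extensionalityI[of _ "Arr (fsrc F)"]) (use assms is_functorD(10)[OF assms(1)]
      is_functorD(10)[OF assms(2)] in auto)
  ultimately show ?thesis using assms by simp
qed

lemma is_nat_transD:
  assumes "is_nat_trans \<alpha>"
  shows "is_functor (nsrc \<alpha>)" "is_functor (ntgt \<alpha>)"
    and "fsrc (ntgt \<alpha>) = fsrc (nsrc \<alpha>)" "ftgt (ntgt \<alpha>) = ftgt (nsrc \<alpha>)"
    and "fsrc (nsrc \<alpha>) = C \<Longrightarrow> ftgt (nsrc \<alpha>) = D \<Longrightarrow> x \<in> Obj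
      C \<Longrightarrow> ncmp \<alpha> x \<in> Arr D"
    and "fsrc (nsrc \<alpha>) = C \<Longrightarrow> ftgt (nsrc \<alpha>) = D \<Longrightarrow> x \<in> Obj
      C \<Longrightarrow> Src D (ncmp \<alpha> x) = fob (nsrc \<alpha>) x"
    and "fsrc (nsrc \<alpha>) = C \<Longrightarrow> ftgt (nsrc \<alpha>) = D \<Longrightarrow> x \<in> Obj
      C \<Longrightarrow> Tgt D (ncmp \<alpha> x) = fob (ntgt \<alpha>) x"
    and "ncmp \<alpha> \<in> extensional (Obj (fsrc (nsrc \<alpha>)))"
    and "fsrc (nsrc \<alpha>) = C \<Longrightarrow> ftgt (nsrc \<alpha>) = D \<Longrightarrow> f \<in> Arr
      C \<Longrightarrow>
      Cmp D (far (ntgt \<alpha>) f) (ncmp \<alpha> (Src C f)) = Cmp D (ncmp \<alpha> (Tgt C f)) (far (nsrc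
        \<alpha>) f)"
  using assms unfolding is_nat_trans_def Let_def hom_def by auto

lemmas [simp] = is_nat_transD(1-8)

text \<open>Naturality with the endpoints as separate variables, so that it rewrites also after
  \<open>Src C f\<close> and \<open>Tgt C f\<close> have been simplified.\<close>

lemma nat_trans_square:
  assumes "is_nat_trans \<alpha>" "fsrc (nsrc \<alpha>) = C" "ftgt (nsrc \<alpha>) = D" "f \<in> Arr C"
    "Src C f = x" "Tgt C f = y"
  shows "Cmp D (far (ntgt \<alpha>) f) (ncmp \<alpha> x) = Cmp D (ncmp \<alpha> y) (far (nsrc \<alpha>) f)"
  using assms is_nat_transD(9) by blast

lemma is_nat_transI:
  assumes "is_functor (nsrc \<alpha>)" "is_functor (ntgt \<alpha>)"
    and "fsrc (ntgt \<alpha>) = fsrc (nsrc \<alpha>)" "ftgt (ntgt \<alpha>) = ftgt (nsrc \<alpha>)"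
    and "ncmp \<alpha> \<in> extensional (Obj (fsrc (nsrc \<alpha>)))"
    and "\<And>x. x \<in> Obj (fsrc (nsrc \<alpha>)) \<Longrightarrow> ncmp \<alpha> x \<in> Arr (ftgt
      (nsrc \<alpha>)) \<and>
      Src (ftgt (nsrc \<alpha>)) (ncmp \<alpha> x) = fob (nsrc \<alpha>) x \<and> Tgt (ftgt (nsrc
        \<alpha>)) (ncmp \<alpha> x) = fob (ntgt \<alpha>) x"
    and "\<And>f. f \<in> Arr (fsrc (nsrc \<alpha>)) \<Longrightarrow>
      Cmp (ftgt (nsrc \<alpha>)) (far (ntgt \<alpha>) f) (ncmp \<alpha> (Src (fsrc (nsrc \<alpha>)) f)) =
      Cmp (ftgt (nsrc \<alpha>)) (ncmp \<alpha> (Tgt (fsrc (nsrc \<alpha>)) f)) (far (nsrc \<alpha>) f)"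
  shows "is_nat_trans \<alpha>"
  using assms unfolding is_nat_trans_def Let_def hom_def by auto

lemma ntrans_eqI:
  assumes "is_nat_trans \<alpha>" "is_nat_trans \<beta>" "nsrc \<alpha> = nsrc \<beta>" "ntgt \<alpha> =
    ntgt \<beta>"
    and "\<And>x. x \<in> Obj (fsrc (nsrc \<alpha>)) \<Longrightarrow> ncmp \<alpha> x = ncmp \<beta> x"
  shows "\<alpha> = \<beta>"
proof -
  have "ncmp \<alpha> = ncmp \<beta>"
    by (rule extensionalityI[of _ "Obj (fsrc (nsrc \<alpha>))"]) (use assms is_nat_transD(8)[OF assms(1)]
      is_nat_transD(8)[OF assms(2)] in auto)
  then show ?thesis using assms by simp
qed

lemma id_functor_simps [simp]:
  "fsrc (id_functor C) = C" "ftgt (id_functor C) = C"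
  "x \<in> Obj C \<Longrightarrow> fob (id_functor C) x = x" "f \<in> Arr C \<Longrightarrow> far
    (id_functor C) f = f"
  by (simp_all add: id_functor_def)

lemma comp_functor_simps [simp]:
  "fsrc (comp_functor G F) = fsrc F" "ftgt (comp_functor G F) = ftgt G"
  "x \<in> Obj (fsrc F) \<Longrightarrow> fob (comp_functor G F) x = fob G (fob F x)"
  "f \<in> Arr (fsrc F) \<Longrightarrow> far (comp_functor G F) f = far G (far F f)"
  "fob (comp_functor G F) \<in> extensional (Obj (fsrc F))" "far (comp_functor G F) \<in> extensional (Arr
    (fsrc F))"
  by (simp_all add: comp_functor_def compose_def)

lemma is_functor_id [simp]: "category C \<Longrightarrow> is_functor (id_functor C)"
  by (rule is_functorI) (auto simp: id_functor_def)

lemma is_functor_comp [simp]: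
  assumes "is_functor F" "is_functor G" "fsrc G = ftgt F"
  shows "is_functor (comp_functor G F)"
  by (rule is_functorI) (use assms in simp_all)

lemma comp_functor_assoc:
  assumes "is_functor F" "is_functor G" "is_functor H" "fsrc G = ftgt F" "fsrc H = ftgt G"
  shows "comp_functor (comp_functor H G) F = comp_functor H (comp_functor G F)"
  by (rule fctr_eqI) (use assms in simp_all)

lemma comp_functor_id [simp]:
  assumes "is_functor F"
  shows "fsrc F = C \<Longrightarrow> comp_functor F (id_functor C) = F"
    and "ftgt F = C \<Longrightarrow> comp_functor (id_functor C) F = F"
  by (rule fctr_eqI; use assms in force)+

lemma CAT_simps [simp]:
  "Ob (CAT small) = {C. category C \<and> locally_small small C}"
  "Cell1 (CAT small) = {F. is_functor F \<and> locally_small small (fsrc F) \<and> locally_small small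
    (ftgt F)}"
  "Cell2 (CAT small) = {\<alpha>. is_nat_trans \<alpha> \<and> locally_small small (fsrc (nsrc \<alpha>)) \<and>
     locally_small small (ftgt (nsrc \<alpha>))}"
  "src1 (CAT small) = fsrc" "tgt1 (CAT small) = ftgt" "src2 (CAT small) = nsrc" "tgt2 (CAT small) = ntgt"
  "id1 (CAT small) = id_functor" "comp1 (CAT small) = comp_functor"
  by (simp_all add: CAT_def)

lemma CAT_2cells [simp]:
  "nsrc (id2 (CAT small) F) = F" "ntgt (id2 (CAT small) F) = F"
  "x \<in> Obj (fsrc F) \<Longrightarrow> ncmp (id2 (CAT small) F) x = Idn (ftgt F) (fob F x)"
  "nsrc (vcomp (CAT small) \<beta> \<alpha>) = nsrc \<alpha>" "ntgt (vcomp (CAT small) \<beta> \<alpha>) =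
    ntgt \<beta>"
  "x \<in> Obj (fsrc (nsrc \<alpha>)) \<Longrightarrow>
     ncmp (vcomp (CAT small) \<beta> \<alpha>) x = Cmp (ftgt (nsrc \<alpha>)) (ncmp \<beta> x) (ncmp
       \<alpha> x)"
  "nsrc (hcomp (CAT small) \<beta> \<alpha>) = comp_functor (nsrc \<beta>) (nsrc \<alpha>)"
  "ntgt (hcomp (CAT small) \<beta> \<alpha>) = comp_functor (ntgt \<beta>) (ntgt \<alpha>)"
  "x \<in> Obj (fsrc (nsrc \<alpha>)) \<Longrightarrow> ncmp (hcomp (CAT small) \<beta> \<alpha>) x =
     Cmp (ftgt (nsrc \<beta>)) (far (ntgt \<beta>) (ncmp \<alpha> x)) (ncmp \<beta> (fob (nsrc \<alpha>) x))"
  by (simp_all add: CAT_def)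

lemma CAT_ncmp_extensional [simp]:
  "ncmp (id2 (CAT small) F) \<in> extensional (Obj (fsrc F))"
  "ncmp (vcomp (CAT small) \<beta> \<alpha>) \<in> extensional (Obj (fsrc (nsrc \<alpha>)))"
  "ncmp (hcomp (CAT small) \<beta> \<alpha>) \<in> extensional (Obj (fsrc (nsrc \<alpha>)))"
  by (simp_all add: CAT_def)

lemma is_nat_trans_id2 [simp]: "is_functor F \<Longrightarrow> is_nat_trans (id2 (CAT small) F)"
  by (rule is_nat_transI) auto

lemma is_nat_trans_vcomp [simp]:
  assumes "is_nat_trans \<alpha>" "is_nat_trans \<beta>" "nsrc \<beta> = ntgt \<alpha>"
  shows "is_nat_trans (vcomp (CAT small) \<beta> \<alpha>)"
proof -
  have [simp]: "fsrc (ntgt \<beta>) = fsrc (nsrc \<alpha>)" "ftgt (ntgt \<beta>) = ftgt (nsrc \<alpha>)"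
    using is_nat_transD(3,4)[OF assms(2)] assms by simp_all
  show ?thesis
  proof (rule is_nat_transI, goal_cases)
    case (7 f)
    let ?C = "fsrc (nsrc \<alpha>)" and ?D = "ftgt (nsrc \<alpha>)"
    have f: "f \<in> Arr ?C" using 7 by simp
    note [simp] = assms f
    let ?x = "Src ?C f" and ?y = "Tgt ?C f"
    have "Cmp ?D (far (ntgt \<beta>) f) (Cmp ?D (ncmp \<beta> ?x) (ncmp \<alpha> ?x)) =
      Cmp ?D (Cmp ?D (ncmp \<beta> ?y) (far (ntgt \<alpha>) f)) (ncmp \<alpha> ?x)"
      using is_nat_transD(9)[OF assms(2), of ?C ?D f] by (simp add: Cmp_assoc[symmetric])
    also have "\<dots> = Cmp ?D (Cmp ?D (ncmp \<beta> ?y) (ncmp \<alpha> ?y)) (far (nsrc \<alpha>) f)"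
      using is_nat_transD(9)[OF assms(1), of ?C ?D f] by (simp add: Cmp_assoc)
    finally show ?case by simp
  qed (use assms in auto)
qed

lemma is_nat_trans_hcomp [simp]:
  assumes "is_nat_trans \<alpha>" "is_nat_trans \<beta>" "fsrc (nsrc \<beta>) = ftgt (nsrc \<alpha>)"
  shows "is_nat_trans (hcomp (CAT small) \<beta> \<alpha>)"
proof (rule is_nat_transI, goal_cases)
  case (7 f)
  let ?C = "fsrc (nsrc \<alpha>)" and ?D = "ftgt (nsrc \<alpha>)" and ?E = "ftgt (nsrc \<beta>)"
  have f: "f \<in> Arr ?C" using 7 by simp
  note [simp] = assms f
  let ?x = "Src ?C f" and ?y = "Tgt ?C f"
  have "Cmp ?E (far (ntgt \<beta>) (far (ntgt \<alpha>) f)) (Cmp ?E (far (ntgt \<beta>) (ncmp \<alpha> ?x))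
    (ncmp \<beta> (fob (nsrc \<alpha>) ?x))) =
    Cmp ?E (far (ntgt \<beta>) (Cmp ?D (far (ntgt \<alpha>) f) (ncmp \<alpha> ?x))) (ncmp \<beta> (fob
      (nsrc \<alpha>) ?x))"
    by (simp add: Cmp_assoc)
  also have "\<dots> = Cmp ?E (far (ntgt \<beta>) (ncmp \<alpha> ?y)) (Cmp ?E (far (ntgt \<beta>) (far
    (nsrc \<alpha>) f)) (ncmp \<beta> (fob (nsrc \<alpha>) ?x)))"
    using is_nat_transD(9)[OF assms(1), of ?C ?D f] by (simp add: Cmp_assoc)
  also have "\<dots> = Cmp ?E (Cmp ?E (far (ntgt \<beta>) (ncmp \<alpha> ?y)) (ncmp \<beta> (fob (nsrc
    \<alpha>) ?y))) (far (nsrc \<beta>) (far (nsrc \<alpha>) f))"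
    using is_nat_transD(9)[OF assms(2), of ?D ?E "far (nsrc \<alpha>) f"] by (simp add: Cmp_assoc)
  finally show ?case by simp
qed (use assms in auto)

lemma two_category_CAT [simp]: "two_category (CAT small)"
proof (rule two_categoryI, goal_cases)
  case (10 \<alpha> \<beta> \<gamma>)
  then show ?case using is_nat_transD(3,4)[of \<beta>] is_nat_transD(3,4)[of \<gamma>] by (auto intro!:
    ntrans_eqI simp: Cmp_assoc)
next
  case (13 \<alpha> \<beta> \<gamma>)
  then show ?case by (auto intro!: ntrans_eqI simp: Cmp_assoc comp_functor_assoc)
next
  case (15 \<alpha> \<alpha>' \<beta> \<beta>')
  then have \<alpha>: "is_nat_trans \<alpha>" "is_nat_trans \<alpha>'" and \<beta>: "is_nat_trans \<beta>"
    "is_nat_trans \<beta>'"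
    and [simp]: "nsrc \<alpha>' = ntgt \<alpha>" "nsrc \<beta>' = ntgt \<beta>" "fsrc (nsrc \<beta>) = ftgt
      (nsrc \<alpha>)"
    by auto
  note [simp] = \<alpha> \<beta>
  have [simp]: "fsrc (ntgt \<alpha>') = fsrc (nsrc \<alpha>)" "ftgt (ntgt \<alpha>') = ftgt (nsrc \<alpha>)"
    "fsrc (ntgt \<beta>') = ftgt (nsrc \<alpha>)" "ftgt (ntgt \<beta>') = ftgt (nsrc \<beta>)"
    using is_nat_transD(3,4)[OF \<alpha>(2)] is_nat_transD(3,4)[OF \<beta>(2)] by simp_all
  let ?D = "ftgt (nsrc \<alpha>)" and ?E = "ftgt (nsrc \<beta>)"
  show ?case
  proof (rule ntrans_eqI, goal_cases)
    case (5 x)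
    then have [simp]: "x \<in> Obj (fsrc (nsrc \<alpha>))" by simp
    \<comment> \<open>The two middle factors of the interchange law are exchanged by naturality of
      \<beta>' at the component of \<alpha> at \<open>x\<close>.\<close>
    have "Cmp ?E (far (ntgt \<beta>') (ncmp \<alpha> x)) (Cmp ?E (ncmp \<beta>' (fob (nsrc \<alpha>) x))
      (ncmp \<beta> (fob (nsrc \<alpha>) x))) =
      Cmp ?E (ncmp \<beta>' (fob (ntgt \<alpha>) x)) (Cmp ?E (far (ntgt \<beta>) (ncmp \<alpha> x)) (ncmp
        \<beta> (fob (nsrc \<alpha>) x)))"
      using is_nat_transD(9)[OF \<beta>(2), of ?D ?E "ncmp \<alpha> x"] by (simp add: Cmp_assoc[symmetric])
    then show ?case by (simp add: Cmp_assoc)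
  qed simp_all
qed (auto simp: comp_functor_assoc intro!: ntrans_eqI)

lemma is_nat_trans_whisker [simp]:
  "is_nat_trans \<alpha> \<Longrightarrow> is_functor G \<Longrightarrow> fsrc G = ftgt (nsrc \<alpha>)
    \<Longrightarrow> is_nat_trans (whisker_left (CAT small) G \<alpha>)"
  "is_nat_trans \<alpha> \<Longrightarrow> is_functor F \<Longrightarrow> ftgt F = fsrc (nsrc \<alpha>)
    \<Longrightarrow> is_nat_trans (whisker_right (CAT small) \<alpha> F)"
  by (simp_all add: whisker_left_def whisker_right_def)

lemma CAT_whisker [simp]:
  "nsrc (whisker_left (CAT small) G \<alpha>) = comp_functor G (nsrc \<alpha>)"
  "ntgt (whisker_left (CAT small) G \<alpha>) = comp_functor G (ntgt \<alpha>)"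
  "is_nat_trans \<alpha> \<Longrightarrow> is_functor G \<Longrightarrow> fsrc G = ftgt (nsrc \<alpha>)
    \<Longrightarrow> x \<in> Obj (fsrc (nsrc \<alpha>)) \<Longrightarrow>
    ncmp (whisker_left (CAT small) G \<alpha>) x = far G (ncmp \<alpha> x)"
  "nsrc (whisker_right (CAT small) \<alpha> F) = comp_functor (nsrc \<alpha>) F"
  "ntgt (whisker_right (CAT small) \<alpha> F) = comp_functor (ntgt \<alpha>) F"
  "is_nat_trans \<alpha> \<Longrightarrow> is_functor F \<Longrightarrow> ftgt F = fsrc (nsrc \<alpha>)
    \<Longrightarrow> x \<in> Obj (fsrc F) \<Longrightarrow>
    ncmp (whisker_right (CAT small) \<alpha> F) x = ncmp \<alpha> (fob F x)"
  by (simp_all add: whisker_left_def whisker_right_def)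

section \<open>Categories whose arrows are encoded as pairs\<close>

lemma small_inj:
  assumes "smallness small" "small B" "inj_on f A" "f ` A \<subseteq> B"
  shows "small A"
  using assms unfolding smallness_def lepoll_def by blast

lemma small_Couple:
  assumes "smallness small" "small A" "small B"
  shows "small {Couple a b | a b. a \<in> A \<and> b \<in> B}"
  using assms unfolding smallness_def by blast

lemma pairarr_simps [simp]:
  "pa_src (pairarr p q f v) = p" "pa_tgt (pairarr p q f v) = q"
  "pa_fst (pairarr p q f v) = f" "pa_snd (pairarr p q f v) = v"
  "pairarr p q f v = pairarr p' q' f' v' \<longleftrightarrow> p = p' \<and> q = q' \<and> f = f' \<and> v = v'"
  by (auto simp: pairarr_def pa_src_def pa_tgt_def pa_fst_def pa_snd_def)

text \<open>Both \<open>arrow_cat\<close> and \<open>comma\<close> are of the following form: an arrow from \<open>p\<close> to \<open>q\<close> consists of an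
  arrow of \<open>C\<close> from \<open>l p\<close> to \<open>l q\<close> and one of \<open>D\<close> from
    \<open>r p\<close> to \<open>r q\<close> which are related by \<open>R\<close>.\<close>

definition pair_cat ::
  "'a univ set \<Rightarrow> ('a univ \<Rightarrow> 'a univ) \<Rightarrow> ('a univ \<Rightarrow> 'a univ)
    \<Rightarrow>
   ('a univ \<Rightarrow> 'a univ \<Rightarrow> 'a univ \<Rightarrow> 'a univ \<Rightarrow> bool)
     \<Rightarrow> 'a ucat \<Rightarrow> 'a ucat \<Rightarrow> 'a ucat" where
  "pair_cat ob l r R C D = \<lparr>
     Obj = ob,
     Arr = {pairarr p q f v | p q f v. p \<in> ob \<and> q \<in> ob \<and> f \<in> hom C (l p) (l q) \<and>
       v \<in> hom D (r p) (r q) \<and> R p q f v},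
     Src = pa_src,
     Tgt = pa_tgt,
     Idn = (\<lambda>p. pairarr p p (Idn C (l p)) (Idn D (r p))),
     Cmp = (\<lambda>z' z. pairarr (pa_src z) (pa_tgt z') (Cmp C (pa_fst z') (pa_fst z)) (Cmp D (pa_snd z')
       (pa_snd z)))\<rparr>"

lemma category_pair_cat:
  assumes "category C" "category D"
    and "\<And>p. p \<in> ob \<Longrightarrow> l p \<in> Obj C \<and> r p \<in> Obj D \<and> R p p (Idn C
      (l p)) (Idn D (r p))"
    and "\<And>p q s f v g w. \<lbrakk>p \<in> ob; q \<in> ob; s \<in> ob; f \<in> hom C (l p) (l q); v
      \<in> hom D (r p) (r q); R p q f v;
      g \<in> hom C (l q) (l s); w \<in> hom D (r q) (r s); R q s g w\<rbrakk> \<Longrightarrow> R p s (Cmp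
        C g f) (Cmp D w v)"
  shows "category (pair_cat ob l r R C D)"
  by (rule categoryI) (use assms in \<open>auto simp: pair_cat_def hom_def Cmp_assoc\<close>)

text \<open>Between fixed objects an arrow is determined by its two components, so the hom-set
  injects into the couples formed from two small hom-sets.\<close>

lemma locally_small_pair_cat:
  assumes small: "smallness small" and C: "locally_small small C" "locally_small small D"
    and ob: "\<And>p. p \<in> ob \<Longrightarrow> l p \<in> Obj C \<and> r p \<in> Obj D"
  shows "locally_small small (pair_cat ob l r R C D)"
  unfolding locally_small_def
proof (intro ballI)
  fix p q assume pq: "p \<in> Obj (pair_cat ob l r R C D)" "q \<in> Obj (pair_cat ob l r R C D)"
  let ?h = "\<lambda>z. Couple (pa_fst z) (pa_snd z)"
  show "small (hom (pair_cat ob l r R C D) p q)"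
  proof (rule small_inj[OF small small_Couple[OF small]])
    show "small (hom C (l p) (l q))" "small (hom D (r p) (r q))"
      using C ob pq by (auto simp: locally_small_def pair_cat_def)
    show "inj_on ?h (hom (pair_cat ob l r R C D) p q)"
      by (auto simp: inj_on_def pair_cat_def hom_def)
    show "?h ` hom (pair_cat ob l r R C D) p q \<subseteq>
      {Couple a b | a b. a \<in> hom C (l p) (l q) \<and> b \<in> hom D (r p) (r q)}"
      by (auto simp: pair_cat_def hom_def)
  qed
qed

text \<open>Pasting of two squares along the edge \<open>b\<close>. It gives the compatibility
  condition of composites in \<open>arrow_cat\<close> and \<open>comma\<close>, and that of the
  values of both monad multiplications on arrows.\<close>

lemma Cmp_paste:
  assumes "category C" "f \<in> Arr C" "f' \<in> Arr C" "a \<in> Arr C" "b \<in> Arr C" "c \<in> Arr C" "g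
    \<in> Arr C" "g' \<in> Arr C"
    and "Src C f' = Tgt C f" "Src C g' = Tgt C g" "Src C b = Tgt C f" "Src C c = Tgt C f'" "Src C g = Tgt C a"
      "Src C g' = Tgt C b"
    and "Cmp C b f = Cmp C g a" "Cmp C c f' = Cmp C g' b"
  shows "Cmp C c (Cmp C f' f) = Cmp C g' (Cmp C g a)"
proof -
  have "Cmp C c (Cmp C f' f) = Cmp C (Cmp C c f') f" using assms(1-14) by (simp add: Cmp_assoc)
  also have "\<dots> = Cmp C g' (Cmp C b f)" using assms(1-14) unfolding assms(16) by (simp add: Cmp_assoc)
  finally show ?thesis using assms(15) by simp
qed

lemma functor_Cmp_eq:
  assumes "is_functor F" "fsrc F = C" "ftgt F = D" "f \<in> Arr C" "g \<in> Arr C" "f' \<in> Arr C" "g'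
    \<in> Arr C"
    and "Src C g = Tgt C f" "Src C g' = Tgt C f'" "Cmp C g f = Cmp C g' f'"
  shows "Cmp D (far F g) (far F f) = Cmp D (far F g') (far F f')"
  using assms is_functorD(8)[OF assms(1-3), of f g] is_functorD(8)[OF assms(1-3), of f' g'] by simp

text \<open>Functoriality read from right to left, for goals where an equation between composites
  has to be used inside the functor. As a rewrite rule it must replace
  \<open>is_functorD(8)\<close>, with which it would loop.\<close>

lemma functor_Cmp_fold:
  "is_functor F \<Longrightarrow> fsrc F = C \<Longrightarrow> ftgt F = D \<Longrightarrow> f \<in> Arr C
    \<Longrightarrow> g \<in> Arr C \<Longrightarrow> Src C g = Tgt C f \<Longrightarrow>
    Cmp D (far F g) (far F f) = far F (Cmp C g f)"
  by simp

text \<open>The intermediate values come with their memberships, obtained once from functoriality,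
  because the outer functors are restricted functions and can be evaluated only with them.\<close>

lemma comp_functor_eqI:
  assumes "is_functor F" "is_functor G" "is_functor F'" "is_functor G'" "fsrc G = ftgt F" "fsrc G' = ftgt F'"
    and "fsrc F = fsrc F'" "ftgt G = ftgt G'"
    and "\<And>x. x \<in> Obj (fsrc F) \<Longrightarrow> fob F x \<in> Obj (fsrc G) \<Longrightarrow> fob
      F' x \<in> Obj (fsrc G') \<Longrightarrow>
      fob G (fob F x) = fob G' (fob F' x)"
    and "\<And>f. f \<in> Arr (fsrc F) \<Longrightarrow> far F f \<in> Arr (fsrc G) \<Longrightarrow> far
      F' f \<in> Arr (fsrc G') \<Longrightarrow>
      far G (far F f) = far G' (far F' f)"
  shows "comp_functor G F = comp_functor G' F'"
proof (rule fctr_eqI)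
  show "is_functor (comp_functor G F)" "is_functor (comp_functor G' F')" using assms(1-6) by simp_all
qed (use assms in simp_all)

section \<open>The squaring 2-monad\<close>

lemma arrow_cat_pair_cat:
  "arrow_cat E = pair_cat (Arr E) (Src E) (Tgt E) (\<lambda>f g r s. Cmp E s f = Cmp E g r) E E"
  by (simp add: arrow_cat_def pair_cat_def)

lemma arrow_cat_simps [simp]:
  "Obj (arrow_cat E) = Arr E" "Src (arrow_cat E) = pa_src" "Tgt (arrow_cat E) = pa_tgt"
  "Idn (arrow_cat E) f = pairarr f f (Idn E (Src E f)) (Idn E (Tgt E f))"
  "Cmp (arrow_cat E) z' z = pairarr (pa_src z) (pa_tgt z')
     (Cmp E (pa_fst z') (pa_fst z)) (Cmp E (pa_snd z') (pa_snd z))"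
  by (simp_all add: arrow_cat_def)

lemma pairarr_in_arrow_cat [simp]:
  "pairarr f g r s \<in> Arr (arrow_cat E) \<longleftrightarrow> f \<in> Arr E \<and> g \<in> Arr E \<and>
    r \<in> Arr E \<and> s \<in> Arr E \<and>
     Src E r = Src E f \<and> Tgt E r = Src E g \<and> Src E s = Tgt E f \<and> Tgt E s = Tgt E g \<and>
       Cmp E s f = Cmp E g r"
  by (auto simp: arrow_cat_def hom_def)

lemma arrow_cat_ArrE [elim!]:
  assumes "z \<in> Arr (arrow_cat E)"
  obtains f g r s where "z = pairarr f g r s" "f \<in> Arr E" "g \<in> Arr E" "r \<in> Arr E" "s \<in> Arr E"
    "Src E r = Src E f" "Tgt E r = Src E g" "Src E s = Tgt E f" "Tgt E s = Tgt E g" "Cmp E s f = Cmp E g r"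
  using assms by (auto simp: arrow_cat_def hom_def)

text \<open>In contrast to the elimination rule, these keep \<open>z\<close> a variable, so that
  membership facts about terms containing \<open>z\<close> continue to match.\<close>

lemma arrow_cat_ArrD:
  assumes "z \<in> Arr (arrow_cat E)"
  shows "pa_src z \<in> Arr E" "pa_tgt z \<in> Arr E" "pa_fst z \<in> Arr E" "pa_snd z \<in> Arr E"
    and "Src E (pa_fst z) = Src E (pa_src z)" "Tgt E (pa_fst z) = Src E (pa_tgt z)"
    and "Src E (pa_snd z) = Tgt E (pa_src z)" "Tgt E (pa_snd z) = Tgt E (pa_tgt z)"
    and "Cmp E (pa_snd z) (pa_src z) = Cmp E (pa_tgt z) (pa_fst z)"
  using assms by auto

lemma category_arrow_cat [simp]: "category E \<Longrightarrow> category (arrow_cat E)"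
  unfolding arrow_cat_pair_cat by (rule category_pair_cat) (auto simp: hom_def Cmp_assoc intro: Cmp_paste)

lemma locally_small_arrow_cat:
  "smallness small \<Longrightarrow> category E \<Longrightarrow> locally_small small E \<Longrightarrow>
    locally_small small (arrow_cat E)"
  unfolding arrow_cat_pair_cat by (rule locally_small_pair_cat) auto

lemma sq_functor_simps [simp]:
  "fsrc (sq_functor T) = arrow_cat (fsrc T)" "ftgt (sq_functor T) = arrow_cat (ftgt T)" "fob (sq_functor T)
    = far T"
  "z \<in> Arr (arrow_cat (fsrc T)) \<Longrightarrow> far (sq_functor T) z =
     pairarr (far T (pa_src z)) (far T (pa_tgt z)) (far T (pa_fst z)) (far T (pa_snd z))"
  "far (sq_functor T) \<in> extensional (Arr (arrow_cat (fsrc T)))"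
  by (simp_all add: sq_functor_def)

lemma sq_ntrans_simps [simp]:
  "nsrc (sq_ntrans \<beta>) = sq_functor (nsrc \<beta>)" "ntgt (sq_ntrans \<beta>) = sq_functor (ntgt \<beta>)"
  "f \<in> Arr (fsrc (nsrc \<beta>)) \<Longrightarrow> ncmp (sq_ntrans \<beta>) f = pairarr (far (nsrc
    \<beta>) f) (far (ntgt \<beta>) f)
     (ncmp \<beta> (Src (fsrc (nsrc \<beta>)) f)) (ncmp \<beta> (Tgt (fsrc (nsrc \<beta>)) f))"
  "ncmp (sq_ntrans \<beta>) \<in> extensional (Arr (fsrc (nsrc \<beta>)))"
  by (simp_all add: sq_ntrans_def)

lemma sq_unit_simps [simp]:
  "fsrc (sq_unit E) = E" "ftgt (sq_unit E) = arrow_cat E"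
  "x \<in> Obj E \<Longrightarrow> fob (sq_unit E) x = Idn E x"
  "f \<in> Arr E \<Longrightarrow> far (sq_unit E) f = pairarr (Idn E (Src E f)) (Idn E (Tgt E f)) f f"
  "fob (sq_unit E) \<in> extensional (Obj E)" "far (sq_unit E) \<in> extensional (Arr E)"
  by (simp_all add: sq_unit_def)

lemma diagonal_pairarr [simp]: "diagonal E (pairarr f g r s) = Cmp E s f"
  by (simp add: diagonal_def)

lemma sq_mult_simps [simp]:
  "fsrc (sq_mult E) = arrow_cat (arrow_cat E)" "ftgt (sq_mult E) = arrow_cat E"
  "z \<in> Arr (arrow_cat E) \<Longrightarrow> fob (sq_mult E) z = diagonal E z"
  "w \<in> Arr (arrow_cat (arrow_cat E)) \<Longrightarrow> far (sq_mult E) w =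
     pairarr (diagonal E (pa_src w)) (diagonal E (pa_tgt w)) (pa_fst (pa_fst w)) (pa_snd (pa_snd w))"
  "fob (sq_mult E) \<in> extensional (Arr (arrow_cat E))"
  "far (sq_mult E) \<in> extensional (Arr (arrow_cat (arrow_cat E)))"
  by (simp_all add: sq_mult_def)

lemma is_functor_sq_functor [simp]: "is_functor T \<Longrightarrow> is_functor (sq_functor T)"
  by (rule is_functorI) (auto intro: functor_Cmp_eq)

lemma is_nat_trans_sq_ntrans [simp]: "is_nat_trans \<beta> \<Longrightarrow> is_nat_trans (sq_ntrans \<beta>)"
  by (rule is_nat_transI) (auto simp: nat_trans_square)

lemma is_functor_sq_unit [simp]: "category E \<Longrightarrow> is_functor (sq_unit E)"
  by (rule is_functorI) auto

text \<open>A square of squares is a commutative cube: the four memberships and the two equations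
  are its six faces.\<close>

lemma arrow_cat_arrow_catE:
  assumes "w \<in> Arr (arrow_cat (arrow_cat E))"
  obtains f g r s f' g' r' s' a a' b b' where
    "w = pairarr (pairarr f g r s) (pairarr f' g' r' s') (pairarr f f' a a') (pairarr g g' b b')"
    "pairarr f g r s \<in> Arr (arrow_cat E)" "pairarr f' g' r' s' \<in> Arr (arrow_cat E)"
    "pairarr f f' a a' \<in> Arr (arrow_cat E)" "pairarr g g' b b' \<in> Arr (arrow_cat E)"
    "Cmp E b r = Cmp E r' a" "Cmp E b' s = Cmp E s' a'"
  using assms
proof (rule arrow_cat_ArrE)
  fix z z' v v'
  assume *: "w = pairarr z z' v v'" "z \<in> Arr (arrow_cat E)" "z' \<in> Arr (arrow_cat E)"
    "v \<in> Arr (arrow_cat E)" "v' \<in> Arr (arrow_cat E)"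
    "Src (arrow_cat E) v = Src (arrow_cat E) z" "Tgt (arrow_cat E) v = Src (arrow_cat E) z'"
    "Src (arrow_cat E) v' = Tgt (arrow_cat E) z" "Tgt (arrow_cat E) v' = Tgt (arrow_cat E) z'"
    "Cmp (arrow_cat E) v' z = Cmp (arrow_cat E) z' v"
  have "y = pairarr (pa_src y) (pa_tgt y) (pa_fst y) (pa_snd y)" if "y \<in> Arr (arrow_cat E)" for y
    using that by auto
  note y = this[OF *(2)] this[OF *(3)] this[OF *(4)] this[OF *(5)]
  show thesis
    by (rule that[of "pa_src z" "pa_tgt z" "pa_fst z" "pa_snd z" "pa_src z'" "pa_tgt z'" "pa_fst z'" "pa_snd z'"
          "pa_fst v" "pa_snd v" "pa_fst v'" "pa_snd v'"]) (use * y in simp_all)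
qed

lemma sq_mult_arr:
  assumes "category E" and w: "w \<in> Arr (arrow_cat (arrow_cat E))"
  shows "far (sq_mult E) w \<in> Arr (arrow_cat E)"
  using w
proof (rule arrow_cat_arrow_catE)
  fix f g r s f' g' r' s' a a' b b'
  assume w_eq: "w = pairarr (pairarr f g r s) (pairarr f' g' r' s') (pairarr f f' a a') (pairarr g g' b b')"
    and sq: "pairarr f g r s \<in> Arr (arrow_cat E)" "pairarr f' g' r' s' \<in> Arr (arrow_cat E)"
      "pairarr f f' a a' \<in> Arr (arrow_cat E)" "pairarr g g' b b' \<in> Arr (arrow_cat E)"
    and "Cmp E b r = Cmp E r' a" "Cmp E b' s = Cmp E s' a'"
  \<comment> \<open>The faces \<open>a' f = f' a\<close> and \<open>b' s = s' a'\<close> share the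
    edge \<open>a'\<close>; their pasting relates the diagonals of the two opposite faces.\<close>
  then have "Cmp E b' (Cmp E s f) = Cmp E s' (Cmp E f' a)"
    by (intro Cmp_paste[of E _ _ _ a']) (simp_all add: assms(1))
  moreover have "Cmp E (Cmp E s' f') a = Cmp E s' (Cmp E f' a)"
    by (rule Cmp_assoc) (use sq assms(1) in simp_all)
  ultimately have diag: "Cmp E b' (Cmp E s f) = Cmp E (Cmp E s' f') a" by (simp only:)
  have "far (sq_mult E) w = pairarr (Cmp E s f) (Cmp E s' f') a b'"
    using w unfolding w_eq by (simp only: sq_mult_simps diagonal_pairarr pairarr_simps)
  moreover have "pairarr (Cmp E s f) (Cmp E s' f') a b' \<in> Arr (arrow_cat E)"
    unfolding pairarr_in_arrow_cat diag using sq assms(1) by simp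
  ultimately show ?thesis by simp
qed

lemma is_functor_sq_mult [simp]:
  assumes E: "category E"
  shows "is_functor (sq_mult E)"
proof (rule is_functorI, goal_cases)
  case (6 w)
  then show ?case using sq_mult_arr[OF E, of w] arrow_cat_ArrD(1,2)[of w "arrow_cat E"] by simp
next
  case (7 w w')
  then show ?case by (simp del: pairarr_in_arrow_cat)
qed (use E in auto)

lemma sq_functor_id: "category E \<Longrightarrow> sq_functor (id_functor E) = id_functor (arrow_cat E)"
  by (rule fctr_eqI) auto

lemma sq_functor_comp:
  "is_functor F \<Longrightarrow> is_functor G \<Longrightarrow> fsrc G = ftgt F \<Longrightarrow>
    sq_functor (comp_functor G F) = comp_functor (sq_functor G) (sq_functor F)"
  by (rule fctr_eqI) (auto simp: functor_Cmp_fold simp del: is_functorD(8))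

lemma sq_ntrans_id2: "is_functor F \<Longrightarrow> sq_ntrans (id2 (CAT small) F) = id2 (CAT small)
  (sq_functor F)"
  by (rule ntrans_eqI) auto

lemma sq_ntrans_vcomp:
  "is_nat_trans \<alpha> \<Longrightarrow> is_nat_trans \<beta> \<Longrightarrow> nsrc \<beta> = ntgt
    \<alpha> \<Longrightarrow>
    sq_ntrans (vcomp (CAT small) \<beta> \<alpha>) = vcomp (CAT small) (sq_ntrans \<beta>) (sq_ntrans \<alpha>)"
  by (rule ntrans_eqI) auto

lemma sq_ntrans_hcomp:
  assumes "is_nat_trans \<alpha>" "is_nat_trans \<beta>" "fsrc (nsrc \<beta>) = ftgt (nsrc \<alpha>)"
  shows "sq_ntrans (hcomp (CAT small) \<beta> \<alpha>) = hcomp (CAT small) (sq_ntrans \<beta>) (sq_ntrans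
    \<alpha>)"
proof (rule ntrans_eqI, goal_cases)
  case (5 f)
  then have f: "f \<in> Arr (fsrc (nsrc \<alpha>))" by simp
  then have "ncmp (sq_ntrans \<alpha>) f \<in> Arr (arrow_cat (ftgt (nsrc \<alpha>)))"
    using is_nat_transD(5)[of "sq_ntrans \<alpha>", OF _ refl refl, of f] assms by simp
  then show ?case using f assms by simp
qed (use assms in \<open>simp_all add: sq_functor_comp\<close>)

section \<open>2-functoriality, 2-naturality and the monad laws of squaring\<close>

lemma two_functor_squaring:
  assumes "smallness small"
  shows "two_functor (CAT small) (CAT small) (endo squaring_monad)"
  by (rule two_functorI)
    (auto simp: squaring_monad_def locally_small_arrow_cat assms sq_functor_id sq_functor_comp sq_ntrans_id2
      sq_ntrans_vcomp sq_ntrans_hcomp)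

lemma sq_unit_natural:
  "is_functor F \<Longrightarrow> fsrc F = C \<Longrightarrow> ftgt F = D \<Longrightarrow>
    comp_functor (sq_functor F) (sq_unit C) = comp_functor (sq_unit D) F"
  by (rule comp_functor_eqI) auto

lemma sq_mult_natural:
  assumes "is_functor F" "fsrc F = C" "ftgt F = D"
  shows "comp_functor (sq_functor F) (sq_mult C) = comp_functor (sq_mult D) (sq_functor (sq_functor F))"
proof (rule comp_functor_eqI, goal_cases)
  case (9 z)
  then have z: "z \<in> Arr (arrow_cat C)" and mem: "far (sq_functor F) z \<in> Arr (arrow_cat D)"
    using assms by (simp_all only: sq_functor_simps sq_mult_simps arrow_cat_simps)
  show ?case
    using sq_mult_simps(3)[OF mem] z assms arrow_cat_ArrD(1-8)[OF z] by (simp add: diagonal_def)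
next
  case (10 w)
  then have w: "w \<in> Arr (arrow_cat (arrow_cat C))" and mem: "far (sq_mult C) w \<in> Arr (arrow_cat C)"
    "far (sq_functor (sq_functor F)) w \<in> Arr (arrow_cat (arrow_cat D))"
    using assms by (simp_all only: sq_functor_simps sq_mult_simps)
  note w' = arrow_cat_ArrD(1-8)[OF w, simplified]
  show ?case
    using sq_mult_simps(4)[OF mem(2)] sq_functor_simps(4)[of "far (sq_mult C) w" F] mem(1) w w'(1-4) assms
      arrow_cat_ArrD(1-8)[OF w'(1)] arrow_cat_ArrD(1-8)[OF w'(2)]
    by (simp add: diagonal_def del: pairarr_in_arrow_cat)
qed (use assms is_functorD(1,2)[OF assms(1)] in simp_all)

lemma sq_unit_natural2:
  assumes "is_nat_trans \<alpha>"
  shows "whisker_right (CAT small) (sq_ntrans \<alpha>) (sq_unit (fsrc (nsrc \<alpha>))) =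
    whisker_left (CAT small) (sq_unit (ftgt (nsrc \<alpha>))) \<alpha>"
  by (rule ntrans_eqI) (use assms in \<open>simp_all add: sq_unit_natural\<close>)

lemma sq_mult_natural2:
  assumes "is_nat_trans \<alpha>"
  shows "whisker_right (CAT small) (sq_ntrans \<alpha>) (sq_mult (fsrc (nsrc \<alpha>))) =
    whisker_left (CAT small) (sq_mult (ftgt (nsrc \<alpha>))) (sq_ntrans (sq_ntrans \<alpha>))"
proof (rule ntrans_eqI, goal_cases)
  case (5 z)
  then have z: "z \<in> Arr (arrow_cat (fsrc (nsrc \<alpha>)))" by simp
  then have "ncmp (sq_ntrans (sq_ntrans \<alpha>)) z \<in> Arr (ftgt (nsrc (sq_ntrans (sq_ntrans \<alpha>))))"
    by (intro is_nat_transD(5)[OF _ refl refl]) (use assms in simp_all)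
  then have mem: "ncmp (sq_ntrans (sq_ntrans \<alpha>)) z \<in> Arr (arrow_cat (arrow_cat (ftgt (nsrc
    \<alpha>))))"
    by (simp only: sq_ntrans_simps(1) sq_functor_simps(2))
  show ?case
    using sq_mult_simps(4)[OF mem] z assms arrow_cat_ArrD(1-8)[OF z]
    by (simp add: diagonal_def del: pairarr_in_arrow_cat)
qed (use assms in \<open>simp_all add: sq_mult_natural\<close>)

lemma two_natural_sq_unit:
  assumes "smallness small"
  shows "two_natural (CAT small) (CAT small) two_id (endo squaring_monad) (unit2 squaring_monad)"
  by (rule two_naturalI[OF two_functor_id two_functor_squaring[OF assms]])
   (auto simp: squaring_monad_def two_id_def locally_small_arrow_cat assms sq_unit_natural sq_unit_natural2)

lemma two_natural_sq_mult:
  assumes "smallness small"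
  shows "two_natural (CAT small) (CAT small) (two_comp (endo squaring_monad) (endo squaring_monad))
    (endo squaring_monad) (mult2 squaring_monad)"
  by (rule two_naturalI[OF two_functor_two_comp[OF two_functor_squaring[OF assms] two_functor_squaring[OF
    assms]]
      two_functor_squaring[OF assms]])
   (auto simp: squaring_monad_def two_comp_def locally_small_arrow_cat assms sq_mult_natural sq_mult_natural2)

text \<open>Both sides are the long diagonal of a cube, computed along the same path of three edges
  with different bracketings. This is associativity of the multiplication on objects.\<close>

lemma diagonal_sq_mult:
  assumes E: "category E" and z: "z \<in> Arr (arrow_cat (arrow_cat E))"
  shows "diagonal E (far (sq_mult E) z) = diagonal E (diagonal (arrow_cat E) z)"
proof -
  note z' = arrow_cat_ArrD(1-8)[OF z, simplified]
  note src = arrow_cat_ArrD(1-8)[OF z'(1)] and snd = arrow_cat_ArrD(1-8)[OF z'(4)]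
  have "diagonal E (far (sq_mult E) z) = Cmp E (pa_snd (pa_snd z)) (Cmp E (pa_snd (pa_src z)) (pa_src
    (pa_src z)))"
    using z by (simp add: diagonal_def)
  moreover have "diagonal E (diagonal (arrow_cat E) z) =
      Cmp E (Cmp E (pa_snd (pa_snd z)) (pa_snd (pa_src z))) (pa_src (pa_src z))"
    by (simp add: diagonal_def)
  ultimately show ?thesis using E src snd z' by (simp add: Cmp_assoc)
qed

lemma sq_monad_laws:
  assumes E: "category E"
  shows "comp_functor (sq_mult E) (sq_functor (sq_unit E)) = id_functor (arrow_cat E)" (is ?right)
    and "comp_functor (sq_mult E) (sq_unit (arrow_cat E)) = id_functor (arrow_cat E)" (is ?left)
    and "comp_functor (sq_mult E) (sq_functor (sq_mult E)) = comp_functor (sq_mult E) (sq_mult (arrow_cat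
      E))" (is ?assoc)
proof -
  show ?right
    by (rule fctr_eqI) (use assms in auto)
  show ?left
    by (rule fctr_eqI) (use assms in auto)
  show ?assoc
  proof (rule comp_functor_eqI, goal_cases)
    case (9 z)
    then have z: "z \<in> Arr (arrow_cat (arrow_cat E))"
      and mem: "far (sq_mult E) z \<in> Arr (arrow_cat E)" "diagonal (arrow_cat E) z \<in> Arr (arrow_cat E)"
      by (simp_all only: sq_functor_simps sq_mult_simps arrow_cat_simps(1))
    show ?case
      using sq_mult_simps(3)[OF mem(1)] sq_mult_simps(3)[OF mem(2)] diagonal_sq_mult[OF E z] z
      by (simp only: sq_functor_simps sq_mult_simps(3))
  next
    case (10 w)
    then have w: "w \<in> Arr (arrow_cat (arrow_cat (arrow_cat E)))"
      and mem: "far (sq_functor (sq_mult E)) w \<in> Arr (arrow_cat (arrow_cat E))"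
        "far (sq_mult (arrow_cat E)) w \<in> Arr (arrow_cat (arrow_cat E))"
      by (simp_all only: sq_functor_simps(1) sq_mult_simps(1))
    note w' = arrow_cat_ArrD(1-4)[OF w]
    show ?case
      \<comment> \<open>The source and target fields agree by \<open>diagonal_sq_mult\<close>; the
        two component fields unfold to the same projections of \<open>w\<close>.\<close>
      unfolding sq_mult_simps(4)[OF mem(1)] sq_mult_simps(4)[OF mem(2)]
      using w w' diagonal_sq_mult[OF E w'(1)] diagonal_sq_mult[OF E w'(2)]
      by (simp only: sq_functor_simps sq_mult_simps pairarr_simps simp_thms)
  qed (use assms in simp_all)
qed

lemma strict_two_monad_squaring:
  assumes "smallness small"
  shows "strict_two_monad (CAT small) squaring_monad"
  unfolding strict_two_monad_def
  using two_functor_squaring[OF assms] two_natural_sq_unit[OF assms] two_natural_sq_mult[OF assms]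
  by (auto simp: squaring_monad_def sq_monad_laws)

section \<open>The comma 2-monad\<close>

text \<open>The second leg of an object (x, u) is the codomain of u rather than u, since the base
  component of an arrow runs between codomains.\<close>

lemma comma_pair_cat:
  "comma P = pair_cat {Couple x u | x u. x \<in> Obj (fsrc P) \<and> u \<in> Arr (ftgt P) \<and> Src (ftgt
    P) u = fob P x}
     left (\<lambda>p. Tgt (ftgt P) (right p))
     (\<lambda>p q f v. Cmp (ftgt P) v (right p) = Cmp (ftgt P) (right q) (far P f)) (fsrc P) (ftgt P)"
  unfolding comma_def pair_cat_def Let_def by (simp, fastforce)

lemma comma_simps [simp]:
  "Src (comma P) = pa_src" "Tgt (comma P) = pa_tgt"
  "Idn (comma P) p = pairarr p p (Idn (fsrc P) (left p)) (Idn (ftgt P) (Tgt (ftgt P) (right p)))"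
  "Cmp (comma P) z' z = pairarr (pa_src z) (pa_tgt z')
     (Cmp (fsrc P) (pa_fst z') (pa_fst z)) (Cmp (ftgt P) (pa_snd z') (pa_snd z))"
  by (simp_all add: comma_def Let_def)

lemma Couple_in_comma [simp]:
  "Couple x u \<in> Obj (comma P) \<longleftrightarrow> x \<in> Obj (fsrc P) \<and> u \<in> Arr (ftgt P)
    \<and> Src (ftgt P) u = fob P x"
  by (simp add: comma_def Let_def)

lemma pairarr_in_comma [simp]:
  "pairarr p q f v \<in> Arr (comma P) \<longleftrightarrow> p \<in> Obj (comma P) \<and> q \<in> Obj
    (comma P) \<and> f \<in> Arr (fsrc P) \<and>
     Src (fsrc P) f = left p \<and> Tgt (fsrc P) f = left q \<and> v \<in> Arr (ftgt P) \<and>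
     Src (ftgt P) v = Tgt (ftgt P) (right p) \<and> Tgt (ftgt P) v = Tgt (ftgt P) (right q) \<and>
     Cmp (ftgt P) v (right p) = Cmp (ftgt P) (right q) (far P f)"
  by (auto simp: comma_pair_cat pair_cat_def hom_def)

lemma comma_ObjD:
  assumes "p \<in> Obj (comma P)"
  shows "left p \<in> Obj (fsrc P)" "right p \<in> Arr (ftgt P)" "Src (ftgt P) (right p) = fob P (left p)"
    "Couple (left p) (right p) = p"
  using assms by (auto simp: comma_def Let_def)

lemma comma_ArrD:
  assumes "z \<in> Arr (comma P)"
  shows "pa_src z \<in> Obj (comma P)" "pa_tgt z \<in> Obj (comma P)" "pa_fst z \<in> Arr (fsrc P)" "pa_snd
    z \<in> Arr (ftgt P)"
    and "Src (fsrc P) (pa_fst z) = left (pa_src z)" "Tgt (fsrc P) (pa_fst z) = left (pa_tgt z)"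
    and "Src (ftgt P) (pa_snd z) = Tgt (ftgt P) (right (pa_src z))"
    and "Tgt (ftgt P) (pa_snd z) = Tgt (ftgt P) (right (pa_tgt z))"
    and "Cmp (ftgt P) (pa_snd z) (right (pa_src z)) = Cmp (ftgt P) (right (pa_tgt z)) (far P (pa_fst z))"
    and "pairarr (pa_src z) (pa_tgt z) (pa_fst z) (pa_snd z) = z"
  using assms by (auto simp: comma_pair_cat pair_cat_def hom_def)

lemma category_comma [simp]:
  assumes P: "is_functor P"
  shows "category (comma P)"
  unfolding comma_pair_cat
proof (rule category_pair_cat, goal_cases)
  case (4 p q s f v g w)
  then have "Cmp (ftgt P) (right s) (Cmp (ftgt P) (far P g) (far P f)) = Cmp (ftgt P) w (Cmp (ftgt P) v
    (right p))"
    by (intro Cmp_paste[of "ftgt P" _ _ _ "right q"]) (use P in \<open>auto simp: hom_def\<close>)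
  moreover have "\<dots> = Cmp (ftgt P) (Cmp (ftgt P) w v) (right p)"
    by (rule Cmp_assoc[symmetric]) (use P 4 in \<open>auto simp: hom_def\<close>)
  ultimately show ?case using P 4(4,5,7) by (simp add: hom_def)
qed (use P in \<open>auto simp: hom_def\<close>)

lemma locally_small_comma:
  "smallness small \<Longrightarrow> is_functor P \<Longrightarrow> locally_small small (fsrc P)
    \<Longrightarrow> locally_small small (ftgt P) \<Longrightarrow>
    locally_small small (comma P)"
  unfolding comma_pair_cat by (rule locally_small_pair_cat) auto

lemma Cod_simps [simp]:
  "fsrc (Cod P) = comma P" "ftgt (Cod P) = ftgt P"
  "p \<in> Obj (comma P) \<Longrightarrow> fob (Cod P) p = Tgt (ftgt P) (right p)"
  "z \<in> Arr (comma P) \<Longrightarrow> far (Cod P) z = pa_snd z"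
  "fob (Cod P) \<in> extensional (Obj (comma P))" "far (Cod P) \<in> extensional (Arr (comma P))"
  by (simp_all add: Cod_def)

lemma is_functor_Cod [simp]:
  assumes P: "is_functor P"
  shows "is_functor (Cod P)"
proof (rule is_functorI, goal_cases)
  case (5 p)
  then show ?case using P comma_ObjD[of p P] categoryD(3)[OF category_comma[OF P], of p] by (simp del:
    pairarr_in_comma)
next
  case (6 z)
  then show ?case using P comma_ArrD[of z P] by simp
next
  case (7 z w)
  then show ?case by (simp del: pairarr_in_comma)
qed (use P in simp_all)

text \<open>\<open>is_square P T S Q\<close> says that \<open>(T, S)\<close> is a 1-cell from \<open>P\<close> to \<open>Q\<close> in the arrow 2-category, and
  \<open>is_square2 P \<beta> \<alpha> Q\<close> that \<open>(\<beta>, \<alpha>)\<close> is a 2-cell.\<close>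

definition is_square :: "'a fctr \<Rightarrow> 'a fctr \<Rightarrow> 'a fctr \<Rightarrow> 'a fctr
  \<Rightarrow> bool" where
  "is_square P T S Q \<longleftrightarrow> is_functor P \<and> is_functor T \<and> is_functor S \<and>
    is_functor Q \<and>
     fsrc T = fsrc P \<and> ftgt T = fsrc Q \<and> fsrc S = ftgt P \<and> ftgt S = ftgt Q \<and>
     comp_functor Q T = comp_functor S P"

definition is_square2 :: "'a fctr \<Rightarrow> 'a ntrans \<Rightarrow> 'a ntrans \<Rightarrow> 'a fctr
  \<Rightarrow> bool" where
  "is_square2 P \<beta> \<alpha> Q \<longleftrightarrow> is_nat_trans \<beta> \<and> is_nat_trans \<alpha>
    \<and>
     is_square P (nsrc \<beta>) (nsrc \<alpha>) Q \<and> is_square P (ntgt \<beta>) (ntgt \<alpha>) Q \<and>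
     (\<forall>x \<in> Obj (fsrc P). far Q (ncmp \<beta> x) = ncmp \<alpha> (fob P x))"

lemma is_squareD:
  assumes "is_square P T S Q"
  shows "is_functor P" "is_functor T" "is_functor S" "is_functor Q"
    and "fsrc T = fsrc P" "ftgt T = fsrc Q" "fsrc S = ftgt P" "ftgt S = ftgt Q"
    and "x \<in> Obj (fsrc P) \<Longrightarrow> fob Q (fob T x) = fob S (fob P x)"
    and "f \<in> Arr (fsrc P) \<Longrightarrow> far Q (far T f) = far S (far P f)"
    and "comp_functor Q T = comp_functor S P"
proof -
  show "fob Q (fob T x) = fob S (fob P x)" if "x \<in> Obj (fsrc P)"
    using assms comp_functor_simps(3)[of x T Q] comp_functor_simps(3)[of x P S] that by (simp add:
      is_square_def)
  show "far Q (far T f) = far S (far P f)" if "f \<in> Arr (fsrc P)"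
    using assms comp_functor_simps(4)[of f T Q] comp_functor_simps(4)[of f P S] that by (simp add:
      is_square_def)
qed (use assms in \<open>simp_all add: is_square_def\<close>)

lemma is_squareI:
  assumes "is_functor P" "is_functor T" "is_functor S" "is_functor Q"
    and "fsrc T = fsrc P" "ftgt T = fsrc Q" "fsrc S = ftgt P" "ftgt S = ftgt Q"
    and "\<And>x. x \<in> Obj (fsrc P) \<Longrightarrow> fob T x \<in> Obj (fsrc Q) \<Longrightarrow> fob Q
      (fob T x) = fob S (fob P x)"
    and "\<And>f. f \<in> Arr (fsrc P) \<Longrightarrow> far T f \<in> Arr (fsrc Q) \<Longrightarrow> far Q
      (far T f) = far S (far P f)"
  shows "is_square P T S Q"
proof -
  have "comp_functor Q T = comp_functor S P" by (rule comp_functor_eqI) (use assms in simp_all)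
  then show ?thesis using assms by (simp add: is_square_def)
qed

lemma is_square2D:
  assumes "is_square2 P \<beta> \<alpha> Q"
  shows "is_nat_trans \<beta>" "is_nat_trans \<alpha>" "is_square P (nsrc \<beta>) (nsrc \<alpha>) Q"
    "is_square P (ntgt \<beta>) (ntgt \<alpha>) Q"
    and "x \<in> Obj (fsrc P) \<Longrightarrow> far Q (ncmp \<beta> x) = ncmp \<alpha> (fob P x)"
  using assms by (simp_all add: is_square2_def)

lemma CAT2_Cell1 [simp]:
  "frame P (T, S) Q \<in> Cell1 (CAT2 small) \<longleftrightarrow> is_square P T S Q \<and> locally_small
    small (fsrc P) \<and>
     locally_small small (ftgt P) \<and> locally_small small (fsrc Q) \<and> locally_small small (ftgt Q)"
  by (auto simp: arrow2_Cell1 is_square_def)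

text \<open>Passes from the whiskered equation of \<open>arrow2\<close> to components, which can
  serve as a rewrite rule.\<close>

lemma is_square2_iff_whisker:
  assumes \<beta>: "is_nat_trans \<beta>" and \<alpha>: "is_nat_trans \<alpha>" and sq: "is_square P (nsrc
    \<beta>) (nsrc \<alpha>) Q"
    and sq': "is_square P (ntgt \<beta>) (ntgt \<alpha>) Q"
  shows "is_square2 P \<beta> \<alpha> Q \<longleftrightarrow> whisker_left (CAT small) Q \<beta> =
    whisker_right (CAT small) \<alpha> P"
proof
  note [simp] = \<alpha> \<beta> is_squareD(1-8,11)[OF sq] is_squareD(11)[OF sq']
  show "whisker_left (CAT small) Q \<beta> = whisker_right (CAT small) \<alpha> P" if "is_square2 P \<beta>
    \<alpha> Q"
    by (rule ntrans_eqI) (use is_square2D(5)[OF that] in simp_all)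
  assume *: "whisker_left (CAT small) Q \<beta> = whisker_right (CAT small) \<alpha> P"
  have "far Q (ncmp \<beta> x) = ncmp \<alpha> (fob P x)" if "x \<in> Obj (fsrc P)" for x
    using arg_cong[OF *, of "\<lambda>\<phi>. ncmp \<phi> x"] that by simp
  then show "is_square2 P \<beta> \<alpha> Q" using sq sq' by (simp add: is_square2_def)
qed

lemma CAT2_Cell2 [simp]:
  "frame P (\<beta>, \<alpha>) Q \<in> Cell2 (CAT2 small) \<longleftrightarrow> is_square2 P \<beta>
    \<alpha> Q \<and> locally_small small (fsrc P) \<and>
     locally_small small (ftgt P) \<and> locally_small small (fsrc Q) \<and> locally_small small (ftgt Q)"
  using is_square2_iff_whisker[of \<beta> \<alpha> P Q small] is_squareD[of P "nsrc \<beta>" "nsrc \<alpha>" Q]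
  by (auto simp: arrow2_Cell2 is_square2_def)

lemma framed_pair_cases: obtains P T S Q where "F = frame P (T, S) Q"
  by (metis framed.surjective old.unit.exhaust surj_pair)

section \<open>The comma construction on squares and 2-cells\<close>

lemma comma_functor_simps [simp]:
  "fsrc (comma_functor (frame P (T, S) Q)) = comma P" "ftgt (comma_functor (frame P (T, S) Q)) = comma Q"
  "p \<in> Obj (comma P) \<Longrightarrow> fob (comma_functor (frame P (T, S) Q)) p = Couple (fob T (left
    p)) (far S (right p))"
  "z \<in> Arr (comma P) \<Longrightarrow> far (comma_functor (frame P (T, S) Q)) z =
     pairarr (Couple (fob T (left (pa_src z))) (far S (right (pa_src z))))
       (Couple (fob T (left (pa_tgt z))) (far S (right (pa_tgt z)))) (far T (pa_fst z)) (far S (pa_snd z))"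
  "fob (comma_functor (frame P (T, S) Q)) \<in> extensional (Obj (comma P))"
  "far (comma_functor (frame P (T, S) Q)) \<in> extensional (Arr (comma P))"
  by (simp_all add: comma_functor_def comma_ob_map_def Let_def)

lemma is_functor_comma_functor:
  assumes sq: "is_square P T S Q"
  shows "is_functor (comma_functor (frame P (T, S) Q))"
proof (rule is_functorI, goal_cases)
  note [simp] = is_squareD(1-10)[OF sq]
  case (5 p)
  then show ?case using comma_ObjD[of p P] categoryD(3)[of "comma P" p] by (simp del: pairarr_in_comma)
next
  note [simp] = is_squareD(1-10)[OF sq]
  case (6 z)
  then have z: "z \<in> Arr (comma P)" by simp
  note z' = comma_ArrD[OF z]
  note objs = comma_ObjD[OF z'(1)] comma_ObjD[OF z'(2)]
  \<comment> \<open>\<open>S\<close> carries the square of the comma arrow along, and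
    \<open>SP = QT\<close> turns its last factor into \<open>Q\<close> of the new first component,
    as \<open>comma Q\<close> requires.\<close>
  have "Cmp (ftgt Q) (far S (pa_snd z)) (far S (right (pa_src z))) =
      Cmp (ftgt Q) (far S (right (pa_tgt z))) (far S (far P (pa_fst z)))"
    by (rule functor_Cmp_eq[of S "ftgt P"]) (use z' objs in simp_all)
  then show ?case using z z'(1-8) objs by simp
next
  case (7 z w)
  then show ?case
    using is_squareD(1-8)[OF sq] comma_ArrD(3-8)[of z P] comma_ArrD(3-8)[of w P] by (simp del: pairarr_in_comma)
qed (use is_squareD(1-8)[OF sq] in simp_all)

lemma is_square_comma_functor:
  assumes sq: "is_square P T S Q"
  shows "is_square (Cod P) (comma_functor (frame P (T, S) Q)) S (Cod Q)"
proof (rule is_squareI, goal_cases)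
  case (9 p)
  then show ?case using is_squareD(1-10)[OF sq] comma_ObjD[of p P] by simp
next
  case (10 z)
  then have z: "z \<in> Arr (comma P)" and mem: "far (comma_functor (frame P (T, S) Q)) z \<in> Arr (comma
    Q)" by simp_all
  show ?case using Cod_simps(4)[OF mem] is_squareD(1-10)[OF sq] z by simp
qed (use is_squareD(1-8)[OF sq] is_functor_comma_functor[OF sq] in simp_all)

lemma comma_ntrans_simps [simp]:
  "nsrc (comma_ntrans (frame P (\<beta>, \<alpha>) Q)) = comma_functor (frame P (nsrc \<beta>, nsrc
    \<alpha>) Q)"
  "ntgt (comma_ntrans (frame P (\<beta>, \<alpha>) Q)) = comma_functor (frame P (ntgt \<beta>, ntgt
    \<alpha>) Q)"
  "p \<in> Obj (comma P) \<Longrightarrow> ncmp (comma_ntrans (frame P (\<beta>, \<alpha>) Q)) p =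
     pairarr (Couple (fob (nsrc \<beta>) (left p)) (far (nsrc \<alpha>) (right p)))
       (Couple (fob (ntgt \<beta>) (left p)) (far (ntgt \<alpha>) (right p)))
       (ncmp \<beta> (left p)) (ncmp \<alpha> (Tgt (ftgt P) (right p)))"
  "ncmp (comma_ntrans (frame P (\<beta>, \<alpha>) Q)) \<in> extensional (Obj (comma P))"
  by (simp_all add: comma_ntrans_def comma_ob_map_def Let_def)

lemma is_nat_trans_comma_ntrans:
  assumes sq: "is_square2 P \<beta> \<alpha> Q"
  shows "is_nat_trans (comma_ntrans (frame P (\<beta>, \<alpha>) Q))"
proof -
  note [simp] = is_square2D[OF sq] is_squareD(1-10)[OF is_square2D(3)[OF sq]] is_squareD(9,10)[OF
    is_square2D(4)[OF sq]]
  show ?thesis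
  proof (rule is_nat_transI, goal_cases)
    case (6 p)
    then have p: "p \<in> Obj (comma P)" by simp
    note p' = comma_ObjD[OF p]
    \<comment> \<open>Naturality of \<alpha> at u, together with \<alpha> at \<open>P x\<close>
      being \<open>Q\<close> of \<beta> at x, is the commutativity required of the component at (x,
      u).\<close>
    show ?case using p p' nat_trans_square[of \<alpha> "ftgt P" "ftgt Q" "right p" "fob P (left p)", OF _ _
      _ _ _ refl] by simp
  next
    case (7 z)
    then have z: "z \<in> Arr (comma P)" by simp
    note z' = comma_ArrD(1-8)[OF z]
    note objs = comma_ObjD[OF z'(1)] comma_ObjD[OF z'(2)]
    show ?case using z z' objs by (simp add: nat_trans_square)
  qed (simp_all add: is_functor_comma_functor)
qed

lemma is_square2_comma_ntrans:
  assumes sq: "is_square2 P \<beta> \<alpha> Q"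
  shows "is_square2 (Cod P) (comma_ntrans (frame P (\<beta>, \<alpha>) Q)) \<alpha> (Cod Q)"
proof -
  note [simp] = is_square2D(1-4)[OF sq] is_squareD(1-8)[OF is_square2D(3)[OF sq]]
  have "far (Cod Q) (ncmp (comma_ntrans (frame P (\<beta>, \<alpha>) Q)) p) = ncmp \<alpha> (fob (Cod P)
    p)" if p: "p \<in> Obj (comma P)" for p
  proof -
    have "ncmp (comma_ntrans (frame P (\<beta>, \<alpha>) Q)) p \<in> Arr (comma Q)"
      by (rule is_nat_transD(5)[OF is_nat_trans_comma_ntrans[OF sq]]) (use p in simp_all)
    from Cod_simps(4)[OF this] show ?thesis using p by simp
  qed
  then show ?thesis by (simp add: is_square2_def is_nat_trans_comma_ntrans[OF sq] is_square_comma_functor)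
qed

lemma CAT2_Cell1E [elim!]:
  assumes "F \<in> Cell1 (CAT2 small)"
  obtains P T S Q where "F = frame P (T, S) Q" "is_square P T S Q" "locally_small small (fsrc P)"
    "locally_small small (ftgt P)" "locally_small small (fsrc Q)" "locally_small small (ftgt Q)"
proof -
  obtain P T S Q where "F = frame P (T, S) Q" by (rule framed_pair_cases)
  with assms that show thesis by auto
qed

lemma CAT2_Cell2E [elim!]:
  assumes "\<phi> \<in> Cell2 (CAT2 small)"
  obtains P \<beta> \<alpha> Q where "\<phi> = frame P (\<beta>, \<alpha>) Q" "is_square2 P \<beta>
    \<alpha> Q" "locally_small small (fsrc P)"
    "locally_small small (ftgt P)" "locally_small small (fsrc Q)" "locally_small small (ftgt Q)"
proof -
  obtain P \<beta> \<alpha> Q where "\<phi> = frame P (\<beta>, \<alpha>) Q" by (rule framed_pair_cases)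
  with assms that show thesis by auto
qed

lemma comma_functor_id:
  assumes P: "is_functor P"
  shows "comma_functor (frame P (id_functor (fsrc P), id_functor (ftgt P)) P) = id_functor (comma P)"
proof -
  have sq: "is_square P (id_functor (fsrc P)) (id_functor (ftgt P)) P" using P by (simp add: is_square_def)
  show ?thesis
  proof (rule fctr_eqI, goal_cases)
    case (5 p) then show ?case using comma_ObjD[of p P] by simp
  next
    case (6 z)
    then have z: "z \<in> Arr (comma P)" by simp
    then show ?case
      using comma_ArrD(3,4,10)[OF z] comma_ObjD[OF comma_ArrD(1)[OF z]] comma_ObjD[OF comma_ArrD(2)[OF z]]
        by simp
  qed (use P sq in \<open>simp_all add: is_functor_comma_functor\<close>)
qed

lemma is_square_comp:
  assumes "is_square P T S Q" "is_square Q T' S' R"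
  shows "is_square P (comp_functor T' T) (comp_functor S' S) R"
proof -
  note [simp] = is_squareD(1-10)[OF assms(1)] is_squareD(1-10)[OF assms(2)]
  show ?thesis by (rule is_squareI) simp_all
qed

lemma comma_functor_comp:
  assumes "is_square P T S Q" "is_square Q T' S' R"
  shows "comma_functor (frame P (comp_functor T' T, comp_functor S' S) R) =
    comp_functor (comma_functor (frame Q (T', S') R)) (comma_functor (frame P (T, S) Q))"
proof (rule fctr_eqI, goal_cases)
  note [simp] = is_squareD(1-10)[OF assms(1)] is_squareD(1-10)[OF assms(2)]
  case (5 p) then show ?case using comma_ObjD[of p P] by simp
next
  note [simp] = is_squareD(1-10)[OF assms(1)] is_squareD(1-10)[OF assms(2)]
  case (6 z)
  then have z: "z \<in> Arr (comma P)" by simp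
  then have "far (comma_functor (frame P (T, S) Q)) z \<in> Arr (comma Q)"
    using is_functorD(4)[OF is_functor_comma_functor[OF assms(1)] refl refl, of z]
    by (simp only: comma_functor_simps(1,2))
  from comma_functor_simps(4)[OF this, of T' S' R] show ?case
    using z comma_ArrD(3,4)[OF z] comma_ObjD[OF comma_ArrD(1)[OF z]] comma_ObjD[OF comma_ArrD(2)[OF z]] by simp
qed (use is_functor_comma_functor[OF assms(1)] is_functor_comma_functor[OF assms(2)]
    is_functor_comma_functor[OF is_square_comp[OF assms]] in simp_all)

lemma is_square2_id2:
  "is_square P T S Q \<Longrightarrow> is_square2 P (id2 (CAT small) T) (id2 (CAT small) S) Q"
  unfolding is_square2_def using is_squareD[of P T S Q] by simp

lemma comma_ntrans_id2:
  assumes sq: "is_square P T S Q"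
  shows "comma_ntrans (frame P (id2 (CAT small) T, id2 (CAT small) S) Q) =
    id2 (CAT small) (comma_functor (frame P (T, S) Q))"
proof (rule ntrans_eqI, goal_cases)
  case (5 p)
  then show ?case using comma_ObjD[of p P] is_squareD(1-10)[OF sq] by simp
qed (use is_functor_comma_functor[OF sq] is_nat_trans_comma_ntrans[OF is_square2_id2[OF sq]] in simp_all)

lemma is_square2_vcomp:
  assumes "is_square2 P \<beta> \<alpha> Q" "is_square2 P \<beta>' \<alpha>' Q" "nsrc \<beta>' = ntgt
    \<beta>" "nsrc \<alpha>' = ntgt \<alpha>"
  shows "is_square2 P (vcomp (CAT small) \<beta>' \<beta>) (vcomp (CAT small) \<alpha>' \<alpha>) Q"
proof -
  note [simp] = is_square2D[OF assms(1)] is_square2D[OF assms(2)] is_squareD(1-10)[OF is_square2D(3)[OF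
    assms(1)]]
    is_squareD(1-10)[OF is_square2D(4)[OF assms(1)]] is_squareD(1-10)[OF is_square2D(4)[OF assms(2)]] assms(3,4)
  show ?thesis by (auto simp: is_square2_def)
qed

lemma comma_ntrans_vcomp:
  assumes "is_square2 P \<beta> \<alpha> Q" "is_square2 P \<beta>' \<alpha>' Q" "nsrc \<beta>' = ntgt
    \<beta>" "nsrc \<alpha>' = ntgt \<alpha>"
  shows "comma_ntrans (frame P (vcomp (CAT small) \<beta>' \<beta>, vcomp (CAT small) \<alpha>' \<alpha>) Q) =
    vcomp (CAT small) (comma_ntrans (frame P (\<beta>', \<alpha>') Q)) (comma_ntrans (frame P (\<beta>,
      \<alpha>) Q))"
proof (rule ntrans_eqI, goal_cases)
  note [simp] = is_square2D[OF assms(1)] is_square2D[OF assms(2)] is_squareD(1-10)[OF is_square2D(3)[OF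
    assms(1)]]
    is_squareD(1-10)[OF is_square2D(4)[OF assms(1)]] is_squareD(1-10)[OF is_square2D(4)[OF assms(2)]] assms(3,4)
  case (5 p)
  then show ?case using comma_ObjD[of p P] by simp
qed (use is_nat_trans_comma_ntrans[OF is_square2_vcomp[OF assms]] is_nat_trans_comma_ntrans[OF assms(1)]
   is_nat_trans_comma_ntrans[OF assms(2)] assms(3,4) in simp_all)

lemma is_square2_hcomp:
  assumes "is_square2 P \<beta> \<alpha> Q" "is_square2 Q \<beta>' \<alpha>' R"
  shows "is_square2 P (hcomp (CAT small) \<beta>' \<beta>) (hcomp (CAT small) \<alpha>' \<alpha>) R"
proof -
  note [simp] = is_square2D[OF assms(1)] is_square2D[OF assms(2)] is_squareD(1-10)[OF is_square2D(3)[OF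
    assms(1)]]
    is_squareD(1-10)[OF is_square2D(4)[OF assms(1)]] is_squareD(1-10)[OF is_square2D(4)[OF assms(2)]]
    is_squareD(1-10)[OF is_square2D(3)[OF assms(2)]]
  show ?thesis
    using is_square_comp[OF is_square2D(3)[OF assms(1)] is_square2D(3)[OF assms(2)]]
      is_square_comp[OF is_square2D(4)[OF assms(1)] is_square2D(4)[OF assms(2)]]
    by (simp add: is_square2_def)
qed

lemma comma_ntrans_hcomp:
  assumes "is_square2 P \<beta> \<alpha> Q" "is_square2 Q \<beta>' \<alpha>' R"
  shows "comma_ntrans (frame P (hcomp (CAT small) \<beta>' \<beta>, hcomp (CAT small) \<alpha>' \<alpha>) R) =
    hcomp (CAT small) (comma_ntrans (frame Q (\<beta>', \<alpha>') R)) (comma_ntrans (frame P (\<beta>,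
      \<alpha>) Q))"
proof (rule ntrans_eqI, goal_cases)
  note [simp] = is_square2D[OF assms(1)] is_square2D[OF assms(2)] is_squareD(1-10)[OF is_square2D(3)[OF
    assms(1)]]
    is_squareD(1-10)[OF is_square2D(4)[OF assms(1)]] is_squareD(1-10)[OF is_square2D(4)[OF assms(2)]]
    is_squareD(1-10)[OF is_square2D(3)[OF assms(2)]]
  case (5 p)
  then have p: "p \<in> Obj (comma P)" by simp
  have "ncmp (comma_ntrans (frame P (\<beta>, \<alpha>) Q)) p \<in> Arr (comma Q)"
    by (rule is_nat_transD(5)[OF is_nat_trans_comma_ntrans[OF assms(1)]]) (use p in simp_all)
  from comma_functor_simps(4)[OF this, of "ntgt \<beta>'" "ntgt \<alpha>'" R] show ?case using
    comma_ObjD[OF p] p by simp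
qed (use is_nat_trans_comma_ntrans[OF is_square2_hcomp[OF assms]] is_nat_trans_comma_ntrans[OF assms(1)]
   is_nat_trans_comma_ntrans[OF assms(2)] is_square2D(3,4)[OF assms(1)] is_square2D(3,4)[OF assms(2)]
   in \<open>simp_all add: comma_functor_comp\<close>)

lemma is_square2_functors: "is_square2 P \<beta> \<alpha> Q \<Longrightarrow> is_functor P" "is_square2 P
  \<beta> \<alpha> Q \<Longrightarrow> is_functor Q"
  by (simp_all add: is_square2_def is_square_def)

lemma two_functor_comma:
  assumes small: "smallness small"
  shows "two_functor (CAT2 small) (CAT2 small) (endo comma_monad)"
proof (rule two_functorI, goal_cases)
  case 3
  then show ?case
    by (auto simp: comma_monad_def locally_small_comma[OF small] comma_functor_id)
next
  case 4
  then show ?case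
    by (auto simp: comma_monad_def locally_small_comma[OF small] comma_ntrans_id2 is_square_comma_functor
      is_squareD(1,4))
next
  case 5
  then show ?case
    by (auto simp: comma_monad_def locally_small_comma[OF small] is_square2_comma_ntrans
      is_square2_functors)
next
  case 6
  then show ?case by (auto simp: comma_monad_def comma_functor_comp)
next
  case 7
  then show ?case by (auto simp: comma_monad_def comma_ntrans_vcomp)
next
  case 8
  then show ?case by (auto simp: comma_monad_def comma_ntrans_hcomp)
qed (simp_all add: two_category_arrow2)

section \<open>Unit of the comma 2-monad\<close>

lemma comma_H_simps [simp]:
  "fsrc (comma_H P) = fsrc P" "ftgt (comma_H P) = comma P"
  "x \<in> Obj (fsrc P) \<Longrightarrow> fob (comma_H P) x = Couple x (Idn (ftgt P) (fob P x))"
  "f \<in> Arr (fsrc P) \<Longrightarrow> far (comma_H P) f =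
     pairarr (Couple (Src (fsrc P) f) (Idn (ftgt P) (fob P (Src (fsrc P) f))))
       (Couple (Tgt (fsrc P) f) (Idn (ftgt P) (fob P (Tgt (fsrc P) f)))) f (far P f)"
  "fob (comma_H P) \<in> extensional (Obj (fsrc P))" "far (comma_H P) \<in> extensional (Arr (fsrc P))"
  by (simp_all add: comma_H_def Let_def)

lemma is_functor_comma_H [simp]: "is_functor P \<Longrightarrow> is_functor (comma_H P)"
  by (rule is_functorI) simp_all

lemma is_square_comma_H: "is_functor P \<Longrightarrow> is_square P (comma_H P) (id_functor (ftgt P)) (Cod P)"
  by (rule is_squareI) simp_all

lemma comma_H_natural:
  assumes sq: "is_square P T S Q"
  shows "comp_functor (comma_functor (frame P (T, S) Q)) (comma_H P) = comp_functor (comma_H Q) T"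
  by (rule comp_functor_eqI) (use is_squareD(1-10)[OF sq] is_functor_comma_functor[OF sq] in simp_all)

lemma comma_H_natural2:
  assumes sq: "is_square2 P \<beta> \<alpha> Q"
  shows "whisker_right (CAT small) (comma_ntrans (frame P (\<beta>, \<alpha>) Q)) (comma_H P) =
    whisker_left (CAT small) (comma_H Q) \<beta>"
  by (rule ntrans_eqI)
   (use is_square2D[OF sq] is_squareD(1-10)[OF is_square2D(3)[OF sq]] is_squareD(9)[OF is_square2D(4)[OF sq]]
     is_nat_trans_comma_ntrans[OF sq] in \<open>simp_all add: comma_H_natural\<close>)

section \<open>Multiplication of the comma 2-monad and the monad laws\<close>

lemma comma_M_simps [simp]:
  "fsrc (comma_M P) = comma (Cod P)" "ftgt (comma_M P) = comma P"
  "p \<in> Obj (comma (Cod P)) \<Longrightarrow>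
    fob (comma_M P) p = Couple (left (left p)) (Cmp (ftgt P) (right p) (right (left p)))"
  "z \<in> Arr (comma (Cod P)) \<Longrightarrow> far (comma_M P) z =
     pairarr (Couple (left (left (pa_src z))) (Cmp (ftgt P) (right (pa_src z)) (right (left (pa_src z)))))
       (Couple (left (left (pa_tgt z))) (Cmp (ftgt P) (right (pa_tgt z)) (right (left (pa_tgt z)))))
       (pa_fst (pa_fst z)) (pa_snd z)"
  "fob (comma_M P) \<in> extensional (Obj (comma (Cod P)))" "far (comma_M P) \<in> extensional (Arr (comma
    (Cod P)))"
  by (simp_all add: comma_M_def Let_def)

lemma comma_Cod_ObjD:
  assumes "p \<in> Obj (comma (Cod P))"
  shows "left p \<in> Obj (comma P)" "right p \<in> Arr (ftgt P)" "Src (ftgt P) (right p) = Tgt (ftgt P)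
    (right (left p))"
    "Couple (left p) (right p) = p" "left (left p) \<in> Obj (fsrc P)" "right (left p) \<in> Arr (ftgt P)"
    "Src (ftgt P) (right (left p)) = fob P (left (left p))" "Couple (left (left p)) (right (left p)) = left p"
proof -
  note p = comma_ObjD[OF assms, simplified]
  show "left p \<in> Obj (comma P)" "right p \<in> Arr (ftgt P)" "Src (ftgt P) (right p) = Tgt (ftgt P)
    (right (left p))"
    "Couple (left p) (right p) = p" using p by simp_all
  then show "left (left p) \<in> Obj (fsrc P)" "right (left p) \<in> Arr (ftgt P)"
    "Src (ftgt P) (right (left p)) = fob P (left (left p))" "Couple (left (left p)) (right (left p)) = left p"
    using comma_ObjD[of "left p" P] by simp_all
qed

lemma comma_Cod_ArrD:
  assumes "z \<in> Arr (comma (Cod P))"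
  shows "pa_src z \<in> Obj (comma (Cod P))" "pa_tgt z \<in> Obj (comma (Cod P))" "pa_fst z \<in> Arr (comma P)"
    "pa_snd z \<in> Arr (ftgt P)" "pa_src (pa_fst z) = left (pa_src z)" "pa_tgt (pa_fst z) = left (pa_tgt z)"
    "Src (ftgt P) (pa_snd z) = Tgt (ftgt P) (right (pa_src z))"
    "Tgt (ftgt P) (pa_snd z) = Tgt (ftgt P) (right (pa_tgt z))"
    and "Cmp (ftgt P) (pa_snd z) (right (pa_src z)) = Cmp (ftgt P) (right (pa_tgt z)) (pa_snd (pa_fst z))"
  using comma_ArrD[OF assms] by simp_all

text \<open>The squares of the inner and of the outer arrow share the edge
  \<open>pa_snd (pa_fst z)\<close>; pasted along it they give the square over the composite base
  arrows.\<close>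

lemma comma_M_arr:
  assumes P: "is_functor P" and z: "z \<in> Arr (comma (Cod P))"
  shows "far (comma_M P) z \<in> Arr (comma P)"
proof -
  note z' = comma_Cod_ArrD[OF z]
  note src = comma_Cod_ObjD[OF z'(1)] and tgt = comma_Cod_ObjD[OF z'(2)] and f = comma_ArrD[OF z'(3)]
  have "Cmp (ftgt P) (pa_snd z) (Cmp (ftgt P) (right (pa_src z)) (right (left (pa_src z)))) =
    Cmp (ftgt P) (right (pa_tgt z)) (Cmp (ftgt P) (right (left (pa_tgt z))) (far P (pa_fst (pa_fst z))))"
    by (rule Cmp_paste[OF _ _ _ _ _ _ _ _ _ _ _ _ _ _ f(9)[unfolded z'(5,6)] z'(9)])
      (use P src tgt f(1-8) z'(1-8) in simp_all)
  also have "\<dots> = Cmp (ftgt P) (Cmp (ftgt P) (right (pa_tgt z)) (right (left (pa_tgt z)))) (far P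
    (pa_fst (pa_fst z)))"
    by (rule Cmp_assoc[symmetric]) (use P src tgt f(1-8) z'(1-8) in simp_all)
  finally show ?thesis using P src tgt f(1-8) z z'(1-8) by simp
qed

lemma is_functor_comma_M [simp]:
  assumes P: "is_functor P"
  shows "is_functor (comma_M P)"
proof (rule is_functorI, goal_cases)
  case (5 p)
  then have p: "p \<in> Obj (comma (Cod P))" by simp
  then have "Idn (comma (Cod P)) p \<in> Arr (comma (Cod P))" using P by (intro categoryD(3)) simp_all
  then show ?case using P comma_Cod_ObjD[OF p] p by (simp del: pairarr_in_comma)
next
  case (6 z)
  then have z: "z \<in> Arr (comma (Cod P))" by simp
  then show ?case using comma_M_arr[OF P z] comma_Cod_ArrD(1,2)[OF z] by (simp del: pairarr_in_comma)
next
  case (7 z w)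
  then show ?case by (simp del: pairarr_in_comma)
qed (use P in simp_all)

lemma is_square_comma_M:
  assumes P: "is_functor P"
  shows "is_square (Cod (Cod P)) (comma_M P) (id_functor (ftgt P)) (Cod P)"
proof (rule is_squareI, goal_cases)
  case (9 p)
  then show ?case using P comma_Cod_ObjD[of p P] by simp
next
  case (10 z)
  then have z: "z \<in> Arr (comma (Cod P))" by simp
  then show ?case using P Cod_simps(4)[OF comma_M_arr[OF P z]] comma_Cod_ArrD(4)[OF z] by simp
qed (use P in simp_all)

lemma comma_M_natural:
  assumes sq: "is_square P T S Q"
  shows "comp_functor (comma_functor (frame P (T, S) Q)) (comma_M P) =
    comp_functor (comma_M Q) (comma_functor (frame (Cod P) (comma_functor (frame P (T, S) Q), S) (Cod Q)))"
proof (rule comp_functor_eqI, goal_cases)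
  case (9 p)
  then have p: "p \<in> Obj (comma (Cod P))" and mem: "fob (comma_M P) p \<in> Obj (comma P)"
      "fob (comma_functor (frame (Cod P) (comma_functor (frame P (T, S) Q), S) (Cod Q))) p \<in> Obj (comma
        (Cod Q))"
    by (simp_all only: comma_M_simps comma_functor_simps Cod_simps)
  show ?case
    using comma_M_simps(3)[OF mem(2)] comma_functor_simps(3)[OF mem(1), of T S Q] p
      comma_Cod_ObjD[OF p] is_squareD(1-8)[OF sq]
    by (simp del: Couple_in_comma)
next
  case (10 z)
  then have z: "z \<in> Arr (comma (Cod P))" and mem: "far (comma_M P) z \<in> Arr (comma P)"
      "far (comma_functor (frame (Cod P) (comma_functor (frame P (T, S) Q), S) (Cod Q))) z \<in> Arr (comma
        (Cod Q))"
    by (simp_all only: comma_M_simps comma_functor_simps)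
  note z' = comma_Cod_ArrD(1-8)[OF z]
  show ?case
    using comma_M_simps(4)[OF mem(2)] comma_functor_simps(4)[OF mem(1), of T S Q] z z'
      comma_Cod_ObjD[OF z'(1)] comma_Cod_ObjD[OF z'(2)] is_squareD(1-8)[OF sq]
    by (simp del: pairarr_in_comma)
qed (use is_squareD(1-8)[OF sq] is_functor_comma_functor[OF sq]
    is_functor_comma_functor[OF is_square_comma_functor[OF sq]] in simp_all)

lemma comma_M_natural2:
  assumes sq: "is_square2 P \<beta> \<alpha> Q"
  shows "whisker_right (CAT small) (comma_ntrans (frame P (\<beta>, \<alpha>) Q)) (comma_M P) =
    whisker_left (CAT small) (comma_M Q) (comma_ntrans (frame (Cod P) (comma_ntrans (frame P (\<beta>,
      \<alpha>) Q), \<alpha>) (Cod Q)))"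
proof -
  note [simp] = is_square2D(1,2)[OF sq] is_squareD(1-8)[OF is_square2D(3)[OF sq]]
    is_nat_trans_comma_ntrans[OF sq] is_nat_trans_comma_ntrans[OF is_square2_comma_ntrans[OF sq]]
  show ?thesis
  proof (rule ntrans_eqI, goal_cases)
    case (5 p)
    then have p: "p \<in> Obj (comma (Cod P))" by simp
    have "ncmp (comma_ntrans (frame (Cod P) (comma_ntrans (frame P (\<beta>, \<alpha>) Q), \<alpha>) (Cod
      Q))) p \<in> Arr (comma (Cod Q))"
      by (rule is_nat_transD(5)[OF is_nat_trans_comma_ntrans[OF is_square2_comma_ntrans[OF sq]]]) (use p in
        simp_all)
    from comma_M_simps(4)[OF this] show ?case
      using p comma_Cod_ObjD[OF p] by (simp del: pairarr_in_comma)
  qed (simp_all add: comma_M_natural is_square2D[OF sq])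
qed

text \<open>On an object (x, u) the unit laws are u 1 = u and 1 u = u, and the third law is
  associativity in the base. The components of arrows are only selected, not composed.\<close>

lemma comma_monad_laws:
  assumes P: "is_functor P"
  shows "comp_functor (comma_M P) (comma_functor (frame P (comma_H P, id_functor (ftgt P)) (Cod P))) =
    id_functor (comma P)" (is ?right)
    and "comp_functor (comma_M P) (comma_H (Cod P)) = id_functor (comma P)" (is ?left)
    and "comp_functor (comma_M P) (comma_functor (frame (Cod (Cod P)) (comma_M P, id_functor (ftgt P)) (Cod
      P))) =
      comp_functor (comma_M P) (comma_M (Cod P))" (is ?assoc)
proof -
  have CH: "is_functor (comma_functor (frame P (comma_H P, id_functor (ftgt P)) (Cod P)))"
    by (rule is_functor_comma_functor[OF is_square_comma_H[OF P]])
  have CM: "is_functor (comma_functor (frame (Cod (Cod P)) (comma_M P, id_functor (ftgt P)) (Cod P)))"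
    by (rule is_functor_comma_functor[OF is_square_comma_M[OF P]])
  show ?right
  proof (rule fctr_eqI, goal_cases)
    case (5 p)
    then have p: "p \<in> Obj (comma P)" by simp
    then show ?case using P comma_ObjD[OF p] by simp
  next
    case (6 z)
    then have z: "z \<in> Arr (comma P)" by simp
    note z' = comma_ArrD[OF z]
    have "far (comma_functor (frame P (comma_H P, id_functor (ftgt P)) (Cod P))) z \<in> Arr (comma (Cod P))"
      by (rule is_functorD(4)[OF CH]) (use z in simp_all)
    from comma_M_simps(4)[OF this] show ?case
      using P z z'(1-8,10) comma_ObjD[OF z'(1)] comma_ObjD[OF z'(2)] by (simp del: pairarr_in_comma)
  qed (use P CH in simp_all)
  show ?left
  proof (rule fctr_eqI, goal_cases)
    case (5 p)
    then have p: "p \<in> Obj (comma P)" by simp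
    then show ?case using P comma_ObjD[OF p] by simp
  next
    case (6 z)
    then have z: "z \<in> Arr (comma P)" by simp
    note z' = comma_ArrD[OF z]
    have "far (comma_H (Cod P)) z \<in> Arr (comma (Cod P))"
      by (rule is_functorD(4)[OF is_functor_comma_H]) (use P z in simp_all)
    from comma_M_simps(4)[OF this] show ?case
      using P z z'(1-8,10) comma_ObjD[OF z'(1)] comma_ObjD[OF z'(2)] by (simp del: pairarr_in_comma)
  qed (use P in simp_all)
  show ?assoc
  proof (rule comp_functor_eqI, goal_cases)
    case (9 p)
    then have p: "p \<in> Obj (comma (Cod (Cod P)))" by simp
    show ?case using 9 comma_Cod_ObjD[OF p, simplified] comma_Cod_ObjD[OF comma_Cod_ObjD(1)[OF p]] P
      by (simp add: Cmp_assoc)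
  next
    case (10 z)
    then have z: "z \<in> Arr (comma (Cod (Cod P)))" and
        mem: "far (comma_functor (frame (Cod (Cod P)) (comma_M P, id_functor (ftgt P)) (Cod P))) z \<in>
          Arr (comma (Cod P))"
        "far (comma_M (Cod P)) z \<in> Arr (comma (Cod P))"
      by (simp_all only: comma_M_simps comma_functor_simps)
    note z' = comma_Cod_ArrD(1-8)[OF z, simplified]
    note objs = comma_Cod_ObjD[OF z'(1), simplified] comma_Cod_ObjD[OF z'(2), simplified]
      comma_Cod_ObjD[OF comma_Cod_ObjD(1)[OF z'(1)]] comma_Cod_ObjD[OF comma_Cod_ObjD(1)[OF z'(2)]]
    show ?case
      using comma_M_simps(4)[OF mem(1)] comma_M_simps(4)[OF mem(2)] z z' objs P
      by (simp add: Cmp_assoc del: pairarr_in_comma)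
  qed (use P CM in simp_all)
qed

lemma arrow2_whisker:
  "whisker_left (arrow2 K) G \<phi> = frame (fr_src \<phi>) (whisker_left K (fst (fr_cell G)) (fst (fr_cell
    \<phi>)),
     whisker_left K (snd (fr_cell G)) (snd (fr_cell \<phi>))) (fr_tgt G)"
  "whisker_right (arrow2 K) \<phi> F = frame (fr_src F) (whisker_right K (fst (fr_cell \<phi>)) (fst
    (fr_cell F)),
     whisker_right K (snd (fr_cell \<phi>)) (snd (fr_cell F))) (fr_tgt \<phi>)"
  by (simp_all add: whisker_left_def whisker_right_def)

lemma CAT_whisker_id [simp]:
  assumes "is_nat_trans \<alpha>"
  shows "ftgt (nsrc \<alpha>) = C \<Longrightarrow> whisker_left (CAT small) (id_functor C) \<alpha> = \<alpha>"
    and "fsrc (nsrc \<alpha>) = C \<Longrightarrow> whisker_right (CAT small) \<alpha> (id_functor C) =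
      \<alpha>"
  by (rule ntrans_eqI; use assms in force)+

text \<open>Unit, multiplication and the actions of split cofibrations have identities as base
  components; this settles the base halves of their 2-cell equations.\<close>

lemma is_square2_whisker_id:
  assumes "is_square2 P \<beta> \<alpha> Q"
  shows "whisker_right (CAT small) \<alpha> (id_functor (ftgt P)) = \<alpha>"
    and "whisker_left (CAT small) (id_functor (ftgt Q)) \<alpha> = \<alpha>"
  using is_square2D[OF assms] is_squareD(7,8)[OF is_square2D(3)[OF assms]] by simp_all

lemma two_natural_comma_H:
  assumes small: "smallness small"
  shows "two_natural (CAT2 small) (CAT2 small) two_id (endo comma_monad) (unit2 comma_monad)"
proof (rule two_naturalI[OF two_functor_id two_functor_comma[OF small]], goal_cases)
  case 2
  then show ?case by (auto simp: comma_monad_def two_id_def locally_small_comma[OF small] is_square_comma_H)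
next
  case 3
  then show ?case by (auto simp: comma_monad_def two_id_def comma_H_natural is_squareD)
next
  case 4
  then show ?case
    by (auto simp: comma_monad_def two_id_def arrow2_whisker comma_H_natural2 is_square2_whisker_id)
qed (simp_all add: two_category_arrow2)

lemma two_natural_comma_M:
  assumes small: "smallness small"
  shows "two_natural (CAT2 small) (CAT2 small) (two_comp (endo comma_monad) (endo comma_monad)) (endo
    comma_monad)
    (mult2 comma_monad)"
proof (rule two_naturalI[OF two_functor_two_comp[OF two_functor_comma[OF small] two_functor_comma[OF small]]
      two_functor_comma[OF small]], goal_cases)
  case 1
  then show ?case by (auto simp: comma_monad_def two_comp_def locally_small_comma[OF small] is_square_comma_M)
next
  case 2
  then show ?case by (auto simp: comma_monad_def two_comp_def comma_M_natural is_squareD)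
next
  case 3
  then show ?case
    by (auto simp: comma_monad_def two_comp_def arrow2_whisker comma_M_natural2 is_square2_whisker_id)
qed

lemma strict_two_monad_comma:
  assumes small: "smallness small"
  shows "strict_two_monad (CAT2 small) comma_monad"
  unfolding strict_two_monad_def
  using two_functor_comma[OF small] two_natural_comma_H[OF small] two_natural_comma_M[OF small]
  by (auto simp: comma_monad_def comma_monad_laws)

section \<open>The comparison between the comma and the squaring 2-monads\<close>

lemma kappa_simps [simp]:
  "fsrc (kappa P) = arrow_cat (fsrc P)" "ftgt (kappa P) = comma P"
  "f \<in> Arr (fsrc P) \<Longrightarrow> fob (kappa P) f = Couple (Src (fsrc P) f) (far P f)"
  "z \<in> Arr (arrow_cat (fsrc P)) \<Longrightarrow> far (kappa P) z =
     pairarr (Couple (Src (fsrc P) (pa_src z)) (far P (pa_src z))) (Couple (Src (fsrc P) (pa_tgt z)) (far P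
       (pa_tgt z)))
       (pa_fst z) (far P (pa_snd z))"
  "fob (kappa P) \<in> extensional (Arr (fsrc P))" "far (kappa P) \<in> extensional (Arr (arrow_cat (fsrc P)))"
  by (simp_all add: kappa_def Let_def)

lemma is_functor_kappa [simp]:
  assumes P: "is_functor P"
  shows "is_functor (kappa P)"
proof (rule is_functorI, goal_cases)
  case (6 z)
  then have z: "z \<in> Arr (arrow_cat (fsrc P))" by simp
  note z' = arrow_cat_ArrD[OF z]
  have "Cmp (ftgt P) (far P (pa_snd z)) (far P (pa_src z)) = Cmp (ftgt P) (far P (pa_tgt z)) (far P (pa_fst z))"
    by (rule functor_Cmp_eq[OF P refl refl]) (use z' in simp_all)
  then show ?case using P z z'(1-8) by simp
next
  case (7 z w)
  then have "z \<in> Arr (arrow_cat (fsrc P))" "w \<in> Arr (arrow_cat (fsrc P))" by simp_all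
  then show ?case using P 7 arrow_cat_ArrD(1-8)[of z "fsrc P"] arrow_cat_ArrD(1-8)[of w "fsrc P"]
    by (simp del: pairarr_in_arrow_cat)
qed (use P in simp_all)

text \<open>On an object f both sides have the image of its source as first entry; the second
  entries are \<open>S P f\<close> and \<open>Q T f\<close>.\<close>

lemma kappa_natural:
  assumes sq: "is_square P T S Q"
  shows "comp_functor (comma_functor (frame P (T, S) Q)) (kappa P) = comp_functor (kappa Q) (sq_functor T)"
proof (rule comp_functor_eqI, goal_cases)
  case (9 f)
  then show ?case using is_squareD(1-10)[OF sq] by simp
next
  case (10 z)
  then have z: "z \<in> Arr (arrow_cat (fsrc P))" and mem: "far (kappa P) z \<in> Arr (comma P)"
    "far (sq_functor T) z \<in> Arr (arrow_cat (fsrc Q))"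
    using is_squareD(1-8)[OF sq] by (simp_all only: kappa_simps sq_functor_simps comma_functor_simps)
  show ?case
    using comma_functor_simps(4)[OF mem(1), of T S Q] kappa_simps(4)[OF mem(2)] z arrow_cat_ArrD(1-8)[OF z]
      is_squareD(1-10)[OF sq]
    by (simp del: pairarr_in_arrow_cat pairarr_in_comma)
qed (use is_squareD(1-8)[OF sq] is_functor_comma_functor[OF sq] in simp_all)

text \<open>At f : x -> y the second components are \<alpha> at \<open>P y\<close> and
  \<open>Q\<close> of \<beta> at y, which agree by the 2-cell condition.\<close>

lemma kappa_natural2:
  assumes sq: "is_square2 P \<beta> \<alpha> Q"
  shows "whisker_right (CAT small) (comma_ntrans (frame P (\<beta>, \<alpha>) Q)) (kappa P) =
    whisker_left (CAT small) (kappa Q) (sq_ntrans \<beta>)"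
proof -
  note [simp] = is_square2D[OF sq] is_squareD(1-10)[OF is_square2D(3)[OF sq]] is_squareD(9,10)[OF
    is_square2D(4)[OF sq]]
    is_nat_trans_comma_ntrans[OF sq]
  show ?thesis
  proof (rule ntrans_eqI, goal_cases)
    case (5 f)
    then have f: "f \<in> Arr (fsrc P)" by simp
    have "ncmp (sq_ntrans \<beta>) f \<in> Arr (arrow_cat (fsrc Q))"
      by (rule is_nat_transD(5)[OF is_nat_trans_sq_ntrans, where C = "arrow_cat (fsrc P)"]) (use f in simp_all)
    from kappa_simps(4)[OF this] show ?case using f by (simp del: pairarr_in_arrow_cat pairarr_in_comma)
  qed (simp_all add: kappa_natural)
qed

text \<open>On a square (r, s) from f to g, applying \<kappa> twice yields ((x, P f), P s), which
  the comma multiplication sends to (x, P s P f). By functoriality of \<open>P\<close> this is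
  \<kappa> of the diagonal s f. The unit law holds because \<open>P\<close> preserves
  identities.\<close>

lemma kappa_monad:
  assumes P: "is_functor P"
  shows "comp_functor (kappa P) (sq_unit (fsrc P)) = comma_H P" (is ?unit)
    and "comp_functor (kappa P) (sq_mult (fsrc P)) =
      comp_functor (comma_M P) (comp_functor (kappa (Cod P)) (sq_functor (kappa P)))" (is ?mult)
proof -
  show ?unit
    by (rule fctr_eqI) (use P in simp_all)
  show ?mult
  proof (rule comp_functor_eqI, goal_cases)
    case (9 z)
    then have z: "z \<in> Arr (arrow_cat (fsrc P))" and mem: "far (kappa P) z \<in> Arr (comma P)"
      "fob (comp_functor (kappa (Cod P)) (sq_functor (kappa P))) z \<in> Obj (comma (Cod P))"
      using is_functorD(4)[OF is_functor_kappa[OF P], of "arrow_cat (fsrc P)" "comma P" z] P by (simp_all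
        del: pairarr_in_comma)
    show ?case
      using comma_M_simps(3)[OF mem(2)] kappa_simps(3)[of "far (kappa P) z" "Cod P"] mem(1) z
        arrow_cat_ArrD(1-8)[OF z] P
      by (simp add: diagonal_def del: pairarr_in_comma Couple_in_comma)
  next
    case (10 w)
    then have w: "w \<in> Arr (arrow_cat (arrow_cat (fsrc P)))" and mem: "far (sq_mult (fsrc P)) w \<in>
      Arr (arrow_cat (fsrc P))"
      "far (comp_functor (kappa (Cod P)) (sq_functor (kappa P))) w \<in> Arr (comma (Cod P))"
      by (simp_all only: kappa_simps comp_functor_simps sq_mult_simps comma_M_simps)
    note w' = arrow_cat_ArrD(1-8)[OF w, simplified]
    have mem3: "far (sq_functor (kappa P)) w \<in> Arr (arrow_cat (comma P))"
      by (rule is_functorD(4)[OF is_functor_sq_functor[OF is_functor_kappa[OF P]]]) (use w in simp_all)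
    have mem4: "far (kappa P) z \<in> Arr (comma P)" if "z \<in> Arr (arrow_cat (fsrc P))" for z
      by (rule is_functorD(4)[OF is_functor_kappa[OF P]]) (use that in simp_all)
    show ?case
      using comma_M_simps(4)[OF mem(2)] kappa_simps(4)[of "far (sq_functor (kappa P)) w" "Cod P"] mem3
        kappa_simps(4)[OF mem(1)] w w' arrow_cat_ArrD(1-8)[OF w'(1)] arrow_cat_ArrD(1-8)[OF w'(2)]
        mem4[OF w'(1)] mem4[OF w'(2)] mem4[OF w'(3)] mem4[OF w'(4)] P
      by (simp add: diagonal_def del: pairarr_in_comma Couple_in_comma pairarr_in_arrow_cat)
  qed (use P in simp_all)
qed

lemma colax_morphism_kappa:
  assumes small: "smallness small"
  shows "colax_morphism (CAT2 small) comma_monad (CAT small) squaring_monad (Dom2 (CAT small)) kappa"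
proof -
  have D: "two_functor (CAT2 small) (CAT small) (Dom2 (CAT small))"
    by (rule two_functor_Dom2) simp
  have "two_natural (CAT2 small) (CAT small) (two_comp (endo squaring_monad) (Dom2 (CAT small)))
    (two_comp (Dom2 (CAT small)) (endo comma_monad)) kappa"
  proof (rule two_naturalI[OF two_functor_two_comp[OF D two_functor_squaring[OF small]]
        two_functor_two_comp[OF two_functor_comma[OF small] D]], goal_cases)
    case 1
    then show ?case
      by (auto simp: comma_monad_def squaring_monad_def two_comp_def Dom2_def locally_small_comma[OF small]
          locally_small_arrow_cat[OF small])
  next
    case 2
    then show ?case by (auto simp: comma_monad_def squaring_monad_def two_comp_def Dom2_def kappa_natural)
  next
    case 3
    then show ?case by (auto simp: comma_monad_def squaring_monad_def two_comp_def Dom2_def kappa_natural2)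
  qed
  moreover have "comp1 (CAT small) (kappa P) (unit2 squaring_monad (on0 (Dom2 (CAT small)) P)) =
      on1 (Dom2 (CAT small)) (unit2 comma_monad P)" if "P \<in> Ob (CAT2 small)" for P
    using that by (simp add: comma_monad_def squaring_monad_def Dom2_def kappa_monad)
  moreover have "comp1 (CAT small) (kappa P) (mult2 squaring_monad (on0 (Dom2 (CAT small)) P)) =
      comp1 (CAT small) (on1 (Dom2 (CAT small)) (mult2 comma_monad P))
        (comp1 (CAT small) (kappa (on0 (endo comma_monad) P)) (on1 (endo squaring_monad) (kappa P)))"
    if "P \<in> Ob (CAT2 small)" for P
    using that by (simp add: comma_monad_def squaring_monad_def Dom2_def kappa_monad)
  ultimately show ?thesis
    unfolding colax_morphism_def using D strict_two_monad_comma[OF small] strict_two_monad_squaring[OF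
      small] by blast
qed

lemma two_functor_kappa_star:
  assumes "smallness small"
  shows "two_functor (AlgC small) (AlgS small) (kappa_star small)"
  unfolding kappa_star_def using colax.two_functor_alg_pull[OF colax.intro[OF colax_morphism_kappa[OF assms]]] .

section \<open>Split cofibrations as algebras for the comma 2-monad\<close>

lemma cocartesianE:
  assumes "cocartesian P e" "g \<in> Arr (fsrc P)" "v \<in> Arr (ftgt P)" "category (fsrc P)"
    and "Src (fsrc P) g = Src (fsrc P) e" "Src (ftgt P) v = fob P (Tgt (fsrc P) e)"
    and "Tgt (ftgt P) v = fob P (Tgt (fsrc P) g)" "far P g = Cmp (ftgt P) v (far P e)"
  obtains h where "h \<in> Arr (fsrc P)" "Src (fsrc P) h = Tgt (fsrc P) e" "Tgt (fsrc P) h = Tgt (fsrc P) g"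
    "Cmp (fsrc P) h e = g" "far P h = v"
  using assms categoryD(2)[OF assms(4,2)] unfolding cocartesian_def Let_def hom_def by blast

lemma cocartesian_cancel:
  assumes "cocartesian P e" "is_functor P" "h \<in> Arr (fsrc P)" "h' \<in> Arr (fsrc P)"
    and "Src (fsrc P) h = Tgt (fsrc P) e" "Src (fsrc P) h' = Tgt (fsrc P) e"
    and "Cmp (fsrc P) h e = Cmp (fsrc P) h' e" "far P h = far P h'"
  shows "h = h'"
proof -
  let ?E = "fsrc P" and ?g = "Cmp (fsrc P) h e" and ?v = "far P h"
  have e: "e \<in> Arr ?E" using assms(1) by (simp add: cocartesian_def Let_def)
  \<comment> \<open>The common target, required before both arrows can count as fillers, comes from
    the equality of the composites with \<open>e\<close>.\<close>
  have tgt: "Tgt ?E h = Tgt ?E ?g" "Tgt ?E h' = Tgt ?E ?g"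
    using e assms(2-6) categoryD(8)[of ?E e h] categoryD(8)[of ?E e h'] unfolding assms(7) by auto
  have "\<exists>!k. k \<in> hom ?E (Tgt ?E e) (Tgt ?E ?g) \<and> Cmp ?E k e = ?g \<and> far P k = ?v"
    using assms(1) e assms(2-6) tgt(1) unfolding cocartesian_def Let_def by (auto simp: hom_def)
  moreover have "h \<in> hom ?E (Tgt ?E e) (Tgt ?E ?g) \<and> Cmp ?E h e = ?g \<and> far P h = ?v"
    "h' \<in> hom ?E (Tgt ?E e) (Tgt ?E ?g) \<and> Cmp ?E h' e = ?g \<and> far P h' = ?v"
    using assms(3-8) tgt by (simp_all add: hom_def)
  ultimately show ?thesis by blast
qed

text \<open>The predicate under the definite description in \<open>L_functor\<close>, named so that
  existence and uniqueness can be stated separately.\<close>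

definition comma_action :: "'a cloven \<Rightarrow> 'a fctr \<Rightarrow> bool" where
  "comma_action X L \<longleftrightarrow> is_functor L \<and> fsrc L = comma (proj X) \<and> ftgt L = total
    X \<and>
     (\<forall>x u. Couple x u \<in> Obj (comma (proj X)) \<longrightarrow> fob L (Couple x u) = push_ob X
       u x) \<and>
     comp_functor (proj X) L = Cod (proj X) \<and>
     (\<forall>x u y w f v. pairarr (Couple x u) (Couple y w) f v \<in> Arr (comma (proj X)) \<longrightarrow>
        Cmp (total X) (far L (pairarr (Couple x u) (Couple y w) f v)) (lift X x u) =
          Cmp (total X) (lift X y w) f)"

text \<open>Restated for arbitrary objects and arrows by their projections, since elsewhere these
  rarely occur as explicit couples.\<close>

lemma comma_actionD:
  assumes "comma_action X L" "is_functor (proj X)"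
  shows "is_functor L" "fsrc L = comma (proj X)" "ftgt L = fsrc (proj X)"
    and "p \<in> Obj (comma (proj X)) \<Longrightarrow> fob L p = Tgt (fsrc (proj X)) (lift X (left p)
      (right p))"
    and "comp_functor (proj X) L = Cod (proj X)"
    and "z \<in> Arr (comma (proj X)) \<Longrightarrow> Cmp (fsrc (proj X)) (far L z) (lift X (left (pa_src
      z)) (right (pa_src z))) =
      Cmp (fsrc (proj X)) (lift X (left (pa_tgt z)) (right (pa_tgt z))) (pa_fst z)"
    and "z \<in> Arr (comma (proj X)) \<Longrightarrow> far (proj X) (far L z) = pa_snd z"
proof -
  show fL: "is_functor L" and src: "fsrc L = comma (proj X)" and "ftgt L = fsrc (proj X)"
    and eq: "comp_functor (proj X) L = Cod (proj X)"
    using assms(1) by (simp_all add: comma_action_def total_def)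
  show "fob L p = Tgt (fsrc (proj X)) (lift X (left p) (right p))" if p: "p \<in> Obj (comma (proj X))"
    using assms(1) p comma_ObjD(4)[OF p] unfolding comma_action_def push_ob_def total_def by metis
  show "far (proj X) (far L z) = pa_snd z" if "z \<in> Arr (comma (proj X))"
    using comp_functor_simps(4)[of z L "proj X"] that src unfolding eq by simp
  show "Cmp (fsrc (proj X)) (far L z) (lift X (left (pa_src z)) (right (pa_src z))) =
      Cmp (fsrc (proj X)) (lift X (left (pa_tgt z)) (right (pa_tgt z))) (pa_fst z)"
    if z: "z \<in> Arr (comma (proj X))"
  proof -
    have z_eq: "pairarr (Couple (left (pa_src z)) (right (pa_src z))) (Couple (left (pa_tgt z)) (right
      (pa_tgt z)))
        (pa_fst z) (pa_snd z) = z"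
      using comma_ArrD[OF z] comma_ObjD(4)[OF comma_ArrD(1)[OF z]] comma_ObjD(4)[OF comma_ArrD(2)[OF z]] by simp
    have "Cmp (fsrc (proj X)) (far L (pairarr (Couple x u) (Couple y w) f v)) (lift X x u) =
        Cmp (fsrc (proj X)) (lift X y w) f" if "pairarr (Couple x u) (Couple y w) f v \<in> Arr (comma
          (proj X))" for x u y w f v
      using assms(1) that unfolding comma_action_def total_def by blast
    from this[of "left (pa_src z)" "right (pa_src z)" "left (pa_tgt z)" "right (pa_tgt z)" "pa_fst z"
      "pa_snd z"] z
    show ?thesis unfolding z_eq by blast
  qed
qed

section \<open>Cloven cofibrations: existence and uniqueness of the action\<close>

locale cloven_cofibration =
  fixes X :: "'a cloven"
  assumes is_functor_proj [simp]: "is_functor (proj X)" and cleavage: "cleavage X"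
begin

abbreviation "P \<equiv> proj X"
abbreviation "E \<equiv> fsrc (proj X)"
abbreviation "B \<equiv> ftgt (proj X)"
abbreviation "\<delta> \<equiv> lift X"

lemma total [simp]: "total X = E" and base [simp]: "base X = B"
  by (simp_all add: total_def base_def)

lemma push_ob: "push_ob X u x = Tgt E (\<delta> x u)"
  by (simp add: push_ob_def)

lemma lift_cocartesian: "x \<in> Obj E \<Longrightarrow> u \<in> Arr B \<Longrightarrow> Src B u = fob P x
  \<Longrightarrow> cocartesian P (\<delta> x u)"
  using cleavage by (simp add: cleavage_def liftable_def)

lemma lift_facts [simp]:
  assumes "x \<in> Obj E" "u \<in> Arr B" "Src B u = fob P x"
  shows "\<delta> x u \<in> Arr E" "Src E (\<delta> x u) = x" "far P (\<delta> x u) = u"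
    and "fob P (Tgt E (\<delta> x u)) = Tgt B u"
proof -
  show 1: "\<delta> x u \<in> Arr E" using lift_cocartesian[OF assms] by (simp add: cocartesian_def Let_def)
  show "Src E (\<delta> x u) = x" and 2: "far P (\<delta> x u) = u"
    using cleavage assms by (simp_all add: cleavage_def liftable_def)
  show "fob P (Tgt E (\<delta> x u)) = Tgt B u"
    using is_functorD(6)[OF is_functor_proj refl refl 1] by (simp add: 2)
qed

lemma lift_cancel:
  assumes "x \<in> Obj E" "u \<in> Arr B" "Src B u = fob P x" "h \<in> Arr E" "h' \<in> Arr E"
    and "Src E h = Tgt E (\<delta> x u)" "Src E h' = Tgt E (\<delta> x u)"
    and "Cmp E h (\<delta> x u) = Cmp E h' (\<delta> x u)" "far P h = far P h'"
  shows "h = h'"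
  using cocartesian_cancel[OF lift_cocartesian[OF assms(1-3)] is_functor_proj assms(4-9)] .

definition comma_lift :: "'a univ \<Rightarrow> 'a univ" where
  "comma_lift z = (THE h. h \<in> Arr E \<and> Src E h = Tgt E (\<delta> (left (pa_src z)) (right (pa_src
    z))) \<and>
     Tgt E h = Tgt E (\<delta> (left (pa_tgt z)) (right (pa_tgt z))) \<and>
     Cmp E h (\<delta> (left (pa_src z)) (right (pa_src z))) = Cmp E (\<delta> (left (pa_tgt z)) (right
       (pa_tgt z))) (pa_fst z) \<and>
     far P h = pa_snd z)"

lemma comma_lift:
  assumes z: "z \<in> Arr (comma P)"
  shows "comma_lift z \<in> Arr E" "Src E (comma_lift z) = Tgt E (\<delta> (left (pa_src z)) (right (pa_src
    z)))"
    "Tgt E (comma_lift z) = Tgt E (\<delta> (left (pa_tgt z)) (right (pa_tgt z)))"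
    "Cmp E (comma_lift z) (\<delta> (left (pa_src z)) (right (pa_src z))) =
      Cmp E (\<delta> (left (pa_tgt z)) (right (pa_tgt z))) (pa_fst z)"
    "far P (comma_lift z) = pa_snd z"
proof -
  note z' = comma_ArrD[OF z]
  note src = comma_ObjD[OF z'(1)] and tgt = comma_ObjD[OF z'(2)]
  let ?d = "\<delta> (left (pa_src z)) (right (pa_src z))" and ?d' = "\<delta> (left (pa_tgt z)) (right
    (pa_tgt z))"
  let ?Q = "\<lambda>h. h \<in> Arr E \<and> Src E h = Tgt E ?d \<and> Tgt E h = Tgt E ?d' \<and>
     Cmp E h ?d = Cmp E ?d' (pa_fst z) \<and> far P h = pa_snd z"
  \<comment> \<open>The commutative square that makes \<open>z\<close> an arrow of the comma
    category is precisely the base equation demanded by the cocartesian property.\<close>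
  have eq: "far P (Cmp E ?d' (pa_fst z)) = Cmp B (pa_snd z) (far P ?d)"
    using src tgt z'(1-8) by (simp add: z'(9))
  obtain h where "?Q h"
    by (rule cocartesianE[OF lift_cocartesian[OF src(1-3)], of "Cmp E ?d' (pa_fst z)" "pa_snd z"])
      (use src tgt z'(1-8) eq in auto)
  moreover have "k = h" if "?Q k" "?Q h" for k
    by (rule lift_cancel[OF src(1-3)]) (use that in auto)
  ultimately have "\<exists>!h. ?Q h" by blast
  then have "?Q (comma_lift z)" unfolding comma_lift_def by (rule theI')
  then show "comma_lift z \<in> Arr E" "Src E (comma_lift z) = Tgt E ?d" "Tgt E (comma_lift z) = Tgt E ?d'"
    "Cmp E (comma_lift z) ?d = Cmp E ?d' (pa_fst z)" "far P (comma_lift z) = pa_snd z" by blast+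
qed

definition comma_lift_functor :: "'a fctr" where
  "comma_lift_functor = \<lparr>fsrc = comma P, ftgt = E,
     fob = (\<lambda>p \<in> Obj (comma P). Tgt E (\<delta> (left p) (right p))), far = (\<lambda>z \<in>
       Arr (comma P). comma_lift z)\<rparr>"

lemma comma_lift_functor_simps [simp]:
  "fsrc comma_lift_functor = comma P" "ftgt comma_lift_functor = E"
  "p \<in> Obj (comma P) \<Longrightarrow> fob comma_lift_functor p = Tgt E (\<delta> (left p) (right p))"
  "z \<in> Arr (comma P) \<Longrightarrow> far comma_lift_functor z = comma_lift z"
  "fob comma_lift_functor \<in> extensional (Obj (comma P))" "far comma_lift_functor \<in> extensional (Arr
    (comma P))"
  by (simp_all add: comma_lift_functor_def)

lemma is_functor_comma_lift: "is_functor comma_lift_functor"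
proof (rule is_functorI, goal_cases)
  case (5 p)
  then have p: "p \<in> Obj (comma P)" by simp
  note p' = comma_ObjD[OF p]
  have i: "Idn (comma P) p \<in> Arr (comma P)" using p by (intro categoryD(3)) simp_all
  have "comma_lift (Idn (comma P) p) = Idn E (Tgt E (\<delta> (left p) (right p)))"
    by (rule lift_cancel[OF p'(1-3)]) (use comma_lift[OF i] p' in simp_all)
  then show ?case using p p' comma_lift_functor_simps(4)[OF i] by (simp del: pairarr_in_comma comma_simps)
next
  case (6 z)
  then show ?case using comma_lift[of z] comma_ArrD(1,2)[of z P] by simp
next
  case (7 z w)
  then have z: "z \<in> Arr (comma P)" and w: "w \<in> Arr (comma P)" and eq: "pa_src w = pa_tgt z"
    and wz: "Cmp (comma P) w z \<in> Arr (comma P)" by (simp_all del: comma_simps(4))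
  note z' = comma_ArrD[OF z] and w' = comma_ArrD[OF w]
  note p = comma_ObjD[OF z'(1)] and q = comma_ObjD[OF z'(2)] and r = comma_ObjD[OF w'(2)]
  note lz = comma_lift[OF z] and lw = comma_lift[OF w, unfolded eq]
  have wz': "pa_src (Cmp (comma P) w z) = pa_src z" "pa_tgt (Cmp (comma P) w z) = pa_tgt w"
    "pa_fst (Cmp (comma P) w z) = Cmp E (pa_fst w) (pa_fst z)" "pa_snd (Cmp (comma P) w z) = Cmp B (pa_snd
      w) (pa_snd z)"
    by simp_all
  note lwz = comma_lift[OF wz, unfolded wz']
  have "Cmp E (Cmp E (comma_lift w) (comma_lift z)) (\<delta> (left (pa_src z)) (right (pa_src z))) =
      Cmp E (Cmp E (comma_lift w) (\<delta> (left (pa_tgt z)) (right (pa_tgt z)))) (pa_fst z)"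
    using lz lw(1,2) p q z'(3-6) by (simp add: Cmp_assoc)
  also have "\<dots> = Cmp E (\<delta> (left (pa_tgt w)) (right (pa_tgt w))) (Cmp E (pa_fst w) (pa_fst z))"
    using lw p q r z'(3-6) w'(3-6) eq by (simp add: Cmp_assoc)
  finally have cmp: "Cmp E (Cmp E (comma_lift w) (comma_lift z)) (\<delta> (left (pa_src z)) (right (pa_src
    z))) =
      Cmp E (\<delta> (left (pa_tgt w)) (right (pa_tgt w))) (Cmp E (pa_fst w) (pa_fst z))" .
  have "comma_lift (Cmp (comma P) w z) = Cmp E (comma_lift w) (comma_lift z)"
  proof (rule lift_cancel[OF p(1-3) lwz(1) _ lwz(2)])
    show "Cmp E (comma_lift (Cmp (comma P) w z)) (\<delta> (left (pa_src z)) (right (pa_src z))) =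
        Cmp E (Cmp E (comma_lift w) (comma_lift z)) (\<delta> (left (pa_src z)) (right (pa_src z)))"
      unfolding cmp by (rule lwz(4))
    show "far P (comma_lift (Cmp (comma P) w z)) = far P (Cmp E (comma_lift w) (comma_lift z))"
      unfolding lwz(5) using lz(1-3,5) lw(1-3,5) by simp
  qed (use lz(1-3) lw(1-3) in simp_all)
  then show ?case using z w comma_lift_functor_simps(4)[OF wz] by (simp del: pairarr_in_comma comma_simps)
qed simp_all

lemma comma_action_comma_lift: "comma_action X comma_lift_functor"
proof -
  have "comp_functor P comma_lift_functor = Cod P"
  proof (rule fctr_eqI, goal_cases)
    case (5 p)
    then show ?case using comma_ObjD[of p P] by simp
  next
    case (6 z)
    then show ?case using comma_lift(5)[of z] by simp
  qed (use is_functor_comma_lift in simp_all)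
  moreover have "Cmp E (far comma_lift_functor z) (\<delta> x u) = Cmp E (\<delta> y w) f"
    if "z \<in> Arr (comma P)" "z = pairarr (Couple x u) (Couple y w) f v" for z x u y w f v
    using comma_lift(4)[OF that(1)] comma_lift_functor_simps(4)[OF that(1)] that(2) by simp
  moreover have "fob comma_lift_functor p = push_ob X u x" if "p \<in> Obj (comma P)" "p = Couple x u" for p x u
    using comma_lift_functor_simps(3)[OF that(1)] that(2) by (simp add: push_ob)
  ultimately show ?thesis
    unfolding comma_action_def total using is_functor_comma_lift comma_lift_functor_simps(1,2) by blast
qed

lemma comma_action_unique:
  assumes "comma_action X L" "comma_action X L'"
  shows "L = L'"
proof (rule fctr_eqI, goal_cases)
  note [simp] = comma_actionD[OF assms(1) is_functor_proj] comma_actionD[OF assms(2) is_functor_proj]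
  case (5 p)
  then show ?case by simp
next
  note L = comma_actionD[OF assms(1) is_functor_proj] and L' = comma_actionD[OF assms(2) is_functor_proj]
  case (6 z)
  then have z: "z \<in> Arr (comma P)" by (simp add: L)
  note p = comma_ObjD[OF comma_ArrD(1)[OF z]]
  show ?case
    by (rule lift_cancel[OF p(1-3)]) (use z comma_ArrD(1-8)[OF z] L L' in simp_all)
qed (use comma_actionD(1-3)[OF assms(1) is_functor_proj] comma_actionD(1-3)[OF assms(2) is_functor_proj] in
  simp_all)

text \<open>By uniqueness any functor with the defining properties computes
  \<open>L_functor\<close>. Besides existence this serves to identify the action of a given algebra
  with that of the cleavage built from it.\<close>

lemma L_functor_eqI: "comma_action X L \<Longrightarrow> L_functor X = L"
  unfolding L_functor_def comma_action_def[symmetric] by (rule the_equality) (auto intro: comma_action_unique)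

lemma comma_action_L_functor: "comma_action X (L_functor X)"
  using comma_action_comma_lift L_functor_eqI by metis

lemmas L_functor = comma_actionD[OF comma_action_L_functor is_functor_proj]

end

section \<open>Transport between fibres, and splitness in terms of the lifts\<close>

context cloven_cofibration
begin

lemma fibre_arr_ends:
  assumes "a \<in> Obj B" "f \<in> Arr E" "far P f = Idn B a"
  shows "fob P (Src E f) = a" "fob P (Tgt E f) = a"
proof -
  have "fob P (Src E f) = Src B (far P f)" "fob P (Tgt E f) = Tgt B (far P f)" using assms(2) by simp_all
  then show "fob P (Src E f) = a" "fob P (Tgt E f) = a" unfolding assms(3) using assms(1) by simp_all
qed

lemma push_ar:
  assumes u: "u \<in> Arr B" and f: "f \<in> Arr E" "far P f = Idn B (Src B u)"
  shows "push_ar X u f \<in> Arr E" "far P (push_ar X u f) = Idn B (Tgt B u)"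
    "Src E (push_ar X u f) = Tgt E (\<delta> (Src E f) u)" "Tgt E (push_ar X u f) = Tgt E (\<delta> (Tgt E
      f) u)"
    "Cmp E (push_ar X u f) (\<delta> (Src E f) u) = Cmp E (\<delta> (Tgt E f) u) f"
proof -
  have Pf: "fob P (Src E f) = Src B u" "fob P (Tgt E f) = Src B u"
    using fibre_arr_ends[of "Src B u" f] u f by simp_all
  let ?Q = "\<lambda>h. h \<in> fibre_arr X (Tgt B u) \<and> h \<in> hom E (Tgt E (\<delta> (Src E f) u))
    (Tgt E (\<delta> (Tgt E f) u)) \<and>
    Cmp E h (\<delta> (Src E f) u) = Cmp E (\<delta> (Tgt E f) u) f"
  obtain h where "?Q h"
    by (rule cocartesianE[OF lift_cocartesian[of "Src E f" u], of "Cmp E (\<delta> (Tgt E f) u) f" "Idn B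
      (Tgt B u)"])
      (use u f Pf in \<open>auto simp: fibre_arr_def hom_def\<close>)
  moreover have "k = h" if "?Q k" "?Q h" for k
    by (rule lift_cancel[of "Src E f" u]) (use that u f Pf in \<open>auto simp: fibre_arr_def hom_def\<close>)
  ultimately have "\<exists>!h. ?Q h" by blast
  then have "?Q (push_ar X u f)"
    unfolding push_ar_def Let_def push_ob total base by (rule theI')
  then show "push_ar X u f \<in> Arr E" "far P (push_ar X u f) = Idn B (Tgt B u)"
    "Src E (push_ar X u f) = Tgt E (\<delta> (Src E f) u)" "Tgt E (push_ar X u f) = Tgt E (\<delta> (Tgt E
      f) u)"
    "Cmp E (push_ar X u f) (\<delta> (Src E f) u) = Cmp E (\<delta> (Tgt E f) u) f"
    by (simp_all add: fibre_arr_def hom_def)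
qed

text \<open>Functoriality of transport follows from the lift equations: on objects it is the
  equality of targets, and on vertical arrows both candidates agree after the lift of
  \<open>Cmp B v u\<close>, which factors into the lifts of \<open>u\<close> and
  \<open>v\<close>.\<close>

lemma split_cleavageI:
  assumes lift_id: "\<And>x. x \<in> Obj E \<Longrightarrow> \<delta> x (Idn B (fob P x)) = Idn E x"
    and lift_comp: "\<And>x u v. \<lbrakk>x \<in> Obj E; u \<in> Arr B; v \<in> Arr B; Src B u = fob P x;
      Src B v = Tgt B u\<rbrakk> \<Longrightarrow>
      \<delta> x (Cmp B v u) = Cmp E (\<delta> (Tgt E (\<delta> x u)) v) (\<delta> x u)"
  shows "split_cleavage X"
proof -
  have push_ob_comp: "Tgt E (\<delta> x (Cmp B v u)) = Tgt E (\<delta> (Tgt E (\<delta> x u)) v)"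
    if "x \<in> Obj E" "u \<in> Arr B" "v \<in> Arr B" "Src B u = fob P x" "Src B v = Tgt B u" for x u v
    using that by (simp add: lift_comp)
  have push_ar_comp: "push_ar X (Cmp B v u) f = push_ar X v (push_ar X u f)"
    if uv: "u \<in> Arr B" "v \<in> Arr B" "Src B v = Tgt B u" and f: "f \<in> Arr E" "far P f = Idn B (Src
      B u)" for u v f
  proof -
    have Pf: "Src B u = fob P (Src E f)" "Src B u = fob P (Tgt E f)"
      using fibre_arr_ends[of "Src B u" f] uv f by simp_all
    let ?x = "Src E f" and ?y = "Tgt E f"
    note u = push_ar[OF uv(1) f]
    have v: "far P (push_ar X u f) = Idn B (Src B v)" by (simp add: u uv)
    note v = push_ar[OF uv(2) u(1) v, unfolded u(3,4)]
    have vu: "Cmp B v u \<in> Arr B" "far P f = Idn B (Src B (Cmp B v u))" using uv f(2) by simp_all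
    note vu = push_ar[OF vu(1) f(1) vu(2)]
    note types = uv f(1) Pf[symmetric]
    have "Cmp E (push_ar X v (push_ar X u f)) (\<delta> ?x (Cmp B v u)) =
      Cmp E (Cmp E (push_ar X v (push_ar X u f)) (\<delta> (Tgt E (\<delta> ?x u)) v)) (\<delta> ?x u)"
      using types v(1,3) by (simp add: lift_comp Pf Cmp_assoc)
    also have "\<dots> = Cmp E (\<delta> (Tgt E (\<delta> ?y u)) v) (Cmp E (push_ar X u f) (\<delta> ?x u))"
      unfolding v(5) using types u(1,3,4) by (simp add: Pf Cmp_assoc)
    also have "\<dots> = Cmp E (\<delta> ?y (Cmp B v u)) f"
      unfolding u(5) using types by (simp add: lift_comp Pf Cmp_assoc)
    finally have eq: "Cmp E (push_ar X v (push_ar X u f)) (\<delta> ?x (Cmp B v u)) = Cmp E (\<delta> ?y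
      (Cmp B v u)) f" .
    show ?thesis
    proof (rule lift_cancel[of ?x "Cmp B v u"])
      show "Src E (push_ar X v (push_ar X u f)) = Tgt E (\<delta> ?x (Cmp B v u))"
        unfolding v(3) by (rule push_ob_comp[symmetric]) (use types Pf in simp_all)
      show "far P (push_ar X (Cmp B v u) f) = far P (push_ar X v (push_ar X u f))"
        unfolding vu(2) v(2) using uv by simp
    qed (use types Pf vu v eq in simp_all)
  qed
  show ?thesis
    unfolding split_cleavage_def Let_def total base push_ob
    using cleavage lift_id lift_comp push_ob_comp push_ar_comp by (auto simp: fibre_arr_def)
qed

end

section \<open>From split cofibrations to strict algebras\<close>

locale split_cofibration =
  fixes X :: "'a cloven"
  assumes is_functor_proj: "is_functor (proj X)" and split_cleavage: "split_cleavage X"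

sublocale split_cofibration \<subseteq> cloven_cofibration
  by standard (use is_functor_proj split_cleavage in \<open>simp_all add: split_cleavage_def Let_def\<close>)

context split_cofibration
begin

lemma lift_id [simp]: "x \<in> Obj E \<Longrightarrow> \<delta> x (Idn B (fob P x)) = Idn E x"
  using split_cleavage by (simp add: split_cleavage_def Let_def)

lemma lift_comp:
  assumes "x \<in> Obj E" "u \<in> Arr B" "v \<in> Arr B" "Src B u = fob P x" "Src B v = Tgt B u"
  shows "\<delta> x (Cmp B v u) = Cmp E (\<delta> (Tgt E (\<delta> x u)) v) (\<delta> x u)"
    and "Tgt E (\<delta> x (Cmp B v u)) = Tgt E (\<delta> (Tgt E (\<delta> x u)) v)"
  using split_cleavage assms by (simp_all add: split_cleavage_def Let_def push_ob)

lemma L_arr: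
  assumes "z \<in> Arr (comma P)"
  shows "far (L_functor X) z \<in> Arr E" "Src E (far (L_functor X) z) = Tgt E (\<delta> (left (pa_src z))
    (right (pa_src z)))"
    "Tgt E (far (L_functor X) z) = Tgt E (\<delta> (left (pa_tgt z)) (right (pa_tgt z)))"
  using assms L_functor(1-3) comma_ArrD(1,2)[OF assms]
    is_functorD(5,6)[OF L_functor(1) refl refl, of z] by (simp_all add: L_functor(4))

text \<open>In the defining equation of \<open>L\<close> at this arrow the lift at the source is
  over an identity, hence itself an identity, and so is the first component.\<close>

lemma lift_L:
  assumes x: "x \<in> Obj E" and u: "u \<in> Arr B" "Src B u = fob P x"
  shows "far (L_functor X) (pairarr (Couple x (Idn B (fob P x))) (Couple x u) (Idn E x) u) = \<delta> x u"
proof -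
  let ?z = "pairarr (Couple x (Idn B (fob P x))) (Couple x u) (Idn E x) u"
  have z: "?z \<in> Arr (comma P)" using assms by simp
  show ?thesis using L_functor(6)[OF z] L_arr[OF z] assms by simp
qed

lemma L_unit: "comp_functor (L_functor X) (comma_H P) = id_functor E"
proof (rule fctr_eqI, goal_cases)
  case (5 x)
  then show ?case by (simp add: L_functor)
next
  case (6 f)
  then have f: "f \<in> Arr E" by simp
  have z: "far (comma_H P) f \<in> Arr (comma P)"
    by (rule is_functorD(4)[OF is_functor_comma_H]) (use f in simp_all)
  show ?case using L_functor(6)[OF z] L_arr[OF z] f by simp
qed (simp_all add: L_functor(1-3))

lemma is_square_L: "is_square (Cod P) (L_functor X) (id_functor B) P"
  using L_functor(1-3,5) by (simp add: is_square_def)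

text \<open>On objects this is the composition law for lifts. On arrows both values lie over the
  same base arrow, and the lift at the source splits into the lifts of \<open>?u\<close> and
  \<open>?v\<close>; the defining equation of \<open>L\<close> for the outer arrow
  (\<open>CL\<close>) and then for the inner one (\<open>L\<close>) moves the value across
  them.\<close>

lemma L_mult:
  "comp_functor (L_functor X) (comma_M P) =
    comp_functor (L_functor X) (comma_functor (frame (Cod P) (L_functor X, id_functor B) P))"
proof (rule comp_functor_eqI, goal_cases)
  case (9 p)
  then have p: "p \<in> Obj (comma (Cod P))" by simp
  note p' = comma_Cod_ObjD[OF p]
  show ?case using p p' lift_comp(2)[of "left (left p)" "right (left p)" "right p"] by (simp add: L_functor(4))
next
  let ?L = "L_functor X" and ?CL = "comma_functor (frame (Cod P) (L_functor X, id_functor B) P)"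
  case (10 z)
  then have z: "z \<in> Arr (comma (Cod P))" and mem: "far (comma_M P) z \<in> Arr (comma P)" "far ?CL z
    \<in> Arr (comma P)"
    using L_functor(2) by (simp_all only: comma_M_simps comma_functor_simps)
  note z' = comma_Cod_ArrD[OF z]
  note src = comma_Cod_ObjD[OF z'(1)] and tgt = comma_Cod_ObjD[OF z'(2)]
  let ?x = "left (left (pa_src z))" and ?u = "right (left (pa_src z))" and ?v = "right (pa_src z)"
  let ?y = "left (left (pa_tgt z))" and ?u' = "right (left (pa_tgt z))" and ?w = "right (pa_tgt z)"
  have M: "Cmp E (far ?L (far (comma_M P) z)) (\<delta> ?x (Cmp B ?v ?u)) = Cmp E (\<delta> ?y (Cmp B ?w
    ?u')) (pa_fst (pa_fst z))"
    using L_functor(6)[OF mem(1)] z by simp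
  have CL: "Cmp E (far ?L (far ?CL z)) (\<delta> (Tgt E (\<delta> ?x ?u)) ?v) =
      Cmp E (\<delta> (Tgt E (\<delta> ?y ?u')) ?w) (far ?L (pa_fst z))"
    using L_functor(6)[OF mem(2)] z src tgt by (simp add: L_functor(4))
  have L: "Cmp E (far ?L (pa_fst z)) (\<delta> ?x ?u) = Cmp E (\<delta> ?y ?u') (pa_fst (pa_fst z))"
    using L_functor(6)[OF z'(3)] z'(5,6) by simp
  note LM = L_arr[OF mem(1)] and LCL = L_arr[OF mem(2)] and Lf = L_arr[OF z'(3), unfolded z'(5,6)]
  have f: "pa_fst (pa_fst z) \<in> Arr E" "Src E (pa_fst (pa_fst z)) = ?x" "Tgt E (pa_fst (pa_fst z)) = ?y"
    using comma_ArrD(3,5,6)[OF z'(3)] z'(5,6) by simp_all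
  have src_CL: "Src E (far ?L (far ?CL z)) = Tgt E (\<delta> (Tgt E (\<delta> ?x ?u)) ?v)"
    using LCL(2) z src by (simp add: L_functor(4))
  have "Cmp E (far ?L (far ?CL z)) (\<delta> ?x (Cmp B ?v ?u)) =
      Cmp E (Cmp E (far ?L (far ?CL z)) (\<delta> (Tgt E (\<delta> ?x ?u)) ?v)) (\<delta> ?x ?u)"
    using src LCL(1) src_CL by (simp add: lift_comp(1) Cmp_assoc)
  also have "\<dots> = Cmp E (\<delta> (Tgt E (\<delta> ?y ?u')) ?w) (Cmp E (far ?L (pa_fst z)) (\<delta>
    ?x ?u))"
    unfolding CL using Lf src tgt by (simp add: Cmp_assoc)
  also have "\<dots> = Cmp E (\<delta> ?y (Cmp B ?w ?u')) (pa_fst (pa_fst z))"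
    unfolding L using src tgt f by (simp add: lift_comp(1) Cmp_assoc)
  finally have eq: "Cmp E (far ?L (far ?CL z)) (\<delta> ?x (Cmp B ?v ?u)) = \<dots>" .
  show ?case
  proof (rule lift_cancel[of ?x "Cmp B ?v ?u"])
    show "Src E (far ?L (far (comma_M P) z)) = Tgt E (\<delta> ?x (Cmp B ?v ?u))" using LM(2) z by simp
    show "Src E (far ?L (far ?CL z)) = Tgt E (\<delta> ?x (Cmp B ?v ?u))" using src_CL lift_comp(2) src by simp
    show "far P (far ?L (far (comma_M P) z)) = far P (far ?L (far ?CL z))"
      unfolding L_functor(7)[OF mem(1)] L_functor(7)[OF mem(2)] using z z'(4) by simp
  qed (use src LM(1) LCL(1) M eq in simp_all)
qed (use is_functor_comma_functor[OF is_square_L] L_functor(1-3) in simp_all)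

end

section \<open>From strict algebras to split cleavages\<close>

definition algebra_cloven :: "'a fctr \<Rightarrow> 'a fctr \<Rightarrow> 'a cloven" where
  "algebra_cloven P L = \<lparr>proj = P, lift = (\<lambda>x u. if Couple x u \<in> Obj (comma P)
     then far L (pairarr (Couple x (Idn (ftgt P) (fob P x))) (Couple x u) (Idn (fsrc P) x) u) else
       undefined)\<rparr>"

text \<open>A strict algebra whose base component has already been recognized as an identity;
  \<open>AlgC_objE\<close> brings every strict algebra into this form.\<close>

locale comma_algebra =
  fixes P L :: "'a fctr"
  assumes P [simp]: "is_functor P" and L [simp]: "is_functor L" "fsrc L = comma P" "ftgt L = fsrc P"
    and proj: "comp_functor P L = Cod P"
    and unit: "comp_functor L (comma_H P) = id_functor (fsrc P)"
    and mult: "comp_functor L (comma_M P) =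
      comp_functor L (comma_functor (frame (Cod P) (L, id_functor (ftgt P)) P))"
begin

abbreviation "E \<equiv> fsrc P"
abbreviation "B \<equiv> ftgt P"

lemma proj_ob: "p \<in> Obj (comma P) \<Longrightarrow> fob P (fob L p) = Tgt B (right p)"
  and proj_ar: "z \<in> Arr (comma P) \<Longrightarrow> far P (far L z) = pa_snd z"
  using comp_functor_simps(3)[of p L P] comp_functor_simps(4)[of z L P] unfolding proj by simp_all

lemma unit_ob: "x \<in> Obj E \<Longrightarrow> fob L (Couple x (Idn B (fob P x))) = x"
  and unit_ar: "f \<in> Arr E \<Longrightarrow> far L (pairarr (Couple (Src E f) (Idn B (fob P (Src E f))))
    (Couple (Tgt E f) (Idn B (fob P (Tgt E f)))) f (far P f)) = f"
  using comp_functor_simps(3)[of x "comma_H P" L] comp_functor_simps(4)[of f "comma_H P" L] unfolding unit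
    by simp_all

lemma mult_ar:
  assumes "z \<in> Arr (comma (Cod P))"
  shows "far L (far (comma_M P) z) = far L (far (comma_functor (frame (Cod P) (L, id_functor B) P)) z)"
  using comp_functor_simps(4)[of z "comma_M P" L] assms unfolding mult by simp

lemma L_cmp:
  assumes "z \<in> Arr (comma P)" "z' \<in> Arr (comma P)" "pa_src z' = pa_tgt z"
  shows "Cmp E (far L z') (far L z) = far L (pairarr (pa_src z) (pa_tgt z')
    (Cmp E (pa_fst z') (pa_fst z)) (Cmp B (pa_snd z') (pa_snd z)))"
  using is_functorD(8)[OF L(1) L(2,3) assms(1,2)] assms(3) by simp

abbreviation "d x u \<equiv> pairarr (Couple x (Idn B (fob P x))) (Couple x u) (Idn E x) u"

context
  fixes x u
  assumes x [simp]: "x \<in> Obj E" and u [simp]: "u \<in> Arr B" "Src B u = fob P x"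
begin

lemma d_arr: "d x u \<in> Arr (comma P)"
  by simp

lemma d_facts [simp]:
  "far L (d x u) \<in> Arr E" "Src E (far L (d x u)) = x" "Tgt E (far L (d x u)) = fob L (Couple x u)"
  "far P (far L (d x u)) = u"
  using is_functorD(4,5,6)[OF L d_arr] proj_ar[OF d_arr] unit_ob[of x] by simp_all

lemma fob_L [simp]: "fob L (Couple x u) \<in> Obj E" "fob P (fob L (Couple x u)) = Tgt B u"
  using proj_ob[of "Couple x u"] by simp_all

text \<open>The arrow of the comma category from \<open>u\<close> to an identity whose first component is the lift of \<open>u\<close> is
  sent to an identity; this makes the lift cocartesian.\<close>

lemma L_lift_id:
  "far L (pairarr (Couple x u) (Couple (fob L (Couple x u)) (Idn B (Tgt B u))) (far L (d x u)) (Idn B (Tgt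
    B u))) =
    Idn E (fob L (Couple x u))"
proof -
  \<comment> \<open>An arrow of \<open>comma (Cod P)\<close> from ((x, 1), u) to ((x, u), 1).
    Multiplication sends it to the identity of (x, u), and applying \<open>L\<close> componentwise
    gives the arrow in the statement; the multiplication law equates their images under
    \<open>L\<close>.\<close>
  let ?z = "pairarr (Couple (Couple x (Idn B (fob P x))) u) (Couple (Couple x u) (Idn B (Tgt B u))) (d x u)
    (Idn B (Tgt B u))"
  have z: "?z \<in> Arr (comma (Cod P))" using d_arr by (simp del: pairarr_in_comma add:
    pairarr_in_comma[of _ _ _ _ "Cod P"])
  have "far L (far (comma_M P) ?z) = far L (Idn (comma P) (Couple x u))"
    using comma_M_simps(4)[OF z] by simp
  moreover have "far L (Idn (comma P) (Couple x u)) = Idn E (fob L (Couple x u))"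
    by (rule is_functorD(7)[OF L]) simp
  moreover have "far (comma_functor (frame (Cod P) (L, id_functor B) P)) ?z =
      pairarr (Couple x u) (Couple (fob L (Couple x u)) (Idn B (Tgt B u))) (far L (d x u)) (Idn B (Tgt B u))"
    using comma_functor_simps(4)[of ?z "Cod P" L "id_functor B" P] z unit_ob[of x] by (simp del:
      pairarr_in_comma)
  ultimately show ?thesis using mult_ar[OF z] by simp
qed

lemma cocartesian_lift: "cocartesian P (far L (d x u))"
  unfolding cocartesian_def Let_def
proof (intro conjI ballI impI)
  show "far L (d x u) \<in> Arr E" by simp
  fix z g v
  assume "z \<in> Obj E" and "g \<in> hom E (Src E (far L (d x u))) z"
    and "v \<in> hom B (fob P (Tgt E (far L (d x u)))) (fob P z)" and Pg: "far P g = Cmp B v (far P (far L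
      (d x u)))"
  then have [simp]: "z \<in> Obj E" "g \<in> Arr E" "Src E g = x" "Tgt E g = z" "v \<in> Arr B" "Src B v =
    Tgt B u" "Tgt B v = fob P z"
    and Pg': "Cmp B v u = far P g" by (simp_all add: hom_def)
  \<comment> \<open>After \<open>d x u\<close> this becomes (g, v u) = (g, P g) from (x, 1) to (z,
    1), the image of \<open>g\<close> under the monad unit, so \<open>L\<close> returns
    \<open>g\<close>.\<close>
  let ?w = "pairarr (Couple x u) (Couple z (Idn B (fob P z))) g v"
  have w: "?w \<in> Arr (comma P)" by (simp add: Pg')
  have "Cmp E (far L ?w) (far L (d x u)) = far L (pairarr (Couple x (Idn B (fob P x))) (Couple z (Idn B
    (fob P z))) g (far P g))"
    using L_cmp[OF d_arr w] by (simp add: Pg')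
  also have "\<dots> = g" using unit_ar[of g] by simp
  finally have 1: "far L ?w \<in> hom E (Tgt E (far L (d x u))) z \<and> Cmp E (far L ?w) (far L (d x u)) =
    g \<and> far P (far L ?w) = v"
    using is_functorD(4,5,6)[OF L w] proj_ar[OF w] unit_ob[of z] by (simp add: hom_def)
  have uniq: "h = far L ?w" if "h \<in> hom E (Tgt E (far L (d x u))) z \<and> Cmp E h (far L (d x u)) = g
    \<and> far P h = v" for h
  proof -
    have [simp]: "h \<in> Arr E" "Src E h = fob L (Couple x u)" "Tgt E h = z" "far P h = v"
      and h: "Cmp E h (far L (d x u)) = g" using that by (simp_all add: hom_def)
    let ?y = "fob L (Couple x u)"
    let ?e = "pairarr (Couple x u) (Couple ?y (Idn B (Tgt B u))) (far L (d x u)) (Idn B (Tgt B u))"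
    let ?h = "pairarr (Couple ?y (Idn B (Tgt B u))) (Couple z (Idn B (fob P z))) h v"
    have "?e \<in> Arr (comma P)" "?h \<in> Arr (comma P)" by simp_all
    from L_cmp[OF this] have "Cmp E (far L ?h) (far L ?e) = far L ?w" using h by simp
    moreover have "far L ?h = h" using unit_ar[of h] by simp
    ultimately show ?thesis unfolding L_lift_id by simp
  qed
  show "\<exists>!h. h \<in> hom E (Tgt E (far L (d x u))) z \<and> Cmp E h (far L (d x u)) = g \<and> far
    P h = v"
    by (rule ex1I[of _ "far L ?w"], rule 1, rule uniq)
qed

lemma lift_comp:
  assumes v [simp]: "v \<in> Arr B" "Src B v = Tgt B u"
  shows "far L (d x (Cmp B v u)) = Cmp E (far L (d (fob L (Couple x u)) v)) (far L (d x u))"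
proof -
  let ?y = "fob L (Couple x u)"
  let ?w = "pairarr (Couple x u) (Couple x (Cmp B v u)) (Idn E x) v"
  let ?i = "Idn (comma P) (Couple x u)"
  \<comment> \<open>The identity of (x, u) paired with v. Multiplication gives \<open>?w\<close>,
    and applying \<open>L\<close> componentwise gives \<open>d ?y v\<close>. So the lift of v is
    also \<open>L\<close> of \<open>?w\<close>, and \<open>?w\<close> can be composed with
    \<open>d x u\<close> inside the comma category.\<close>
  let ?z = "pairarr (Couple (Couple x u) (Idn B (Tgt B u))) (Couple (Couple x u) v) ?i v"
  have i: "?i \<in> Arr (comma P)" by (rule categoryD(3)) simp_all
  have z: "?z \<in> Arr (comma (Cod P))"
    using i Cod_simps(4)[OF i] by (simp del: pairarr_in_comma add: pairarr_in_comma[of _ _ _ _ "Cod P"])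
  have L_i: "far L ?i = Idn E ?y" by (rule is_functorD(7)[OF L]) simp
  have "far (comma_functor (frame (Cod P) (L, id_functor B) P)) ?z = d ?y v"
    using comma_functor_simps(4)[of ?z "Cod P" L "id_functor B" P] z L_i by (simp del: pairarr_in_comma)
  moreover have "far (comma_M P) ?z = ?w" using comma_M_simps(4)[OF z] by simp
  ultimately have w: "far L (d ?y v) = far L ?w" using mult_ar[OF z] by simp
  have "?w \<in> Arr (comma P)" by simp
  from L_cmp[OF d_arr this] show ?thesis unfolding w by simp
qed

end

abbreviation "X \<equiv> algebra_cloven P L"

lemma X_simps [simp]:
  "proj X = P" "x \<in> Obj E \<Longrightarrow> u \<in> Arr B \<Longrightarrow> Src B u = fob P x
    \<Longrightarrow> lift X x u = far L (d x u)"
  by (simp_all add: algebra_cloven_def)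

lemma cleavage_X: "cleavage X"
  unfolding cleavage_def liftable_def total_def base_def
  by (auto simp: cocartesian_lift unit_ob) (auto simp: algebra_cloven_def)

sublocale X: cloven_cofibration X
  by standard (simp_all add: cleavage_X)

lemma split_cleavage_X: "split_cleavage X"
proof (rule X.split_cleavageI, goal_cases)
  case (1 x)
  then show ?case using unit_ar[of "Idn E x"] by simp
next
  case (2 x u v)
  then show ?case by (simp add: lift_comp)
qed

text \<open>The arrow (f, v u) from (x, 1) to (y, w) factors as (f, v) after (1, u) and, since v u =
  w P f, also as (1, w) after (f, P f). Applying \<open>L\<close> to both factorizations gives the
  defining equation, because the unit law sends (f, P f) to f.\<close>

lemma L_functor_X: "L_functor X = L"
proof (rule X.L_functor_eqI)
  have ob: "fob L (Couple x u) = push_ob X u x" if "Couple x u \<in> Obj (comma P)" for x u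
    using that by (simp add: push_ob_def total_def)
  have ar: "Cmp E (far L (pairarr (Couple x u) (Couple y w) f v)) (lift X x u) = Cmp E (lift X y w) f"
    if z: "pairarr (Couple x u) (Couple y w) f v \<in> Arr (comma P)" for x u y w f v
  proof -
    have [simp]: "x \<in> Obj E" "u \<in> Arr B" "Src B u = fob P x" "y \<in> Obj E" "w \<in> Arr B" "Src B
      w = fob P y"
      "f \<in> Arr E" "Src E f = x" "Tgt E f = y" "v \<in> Arr B" "Src B v = Tgt B u" "Tgt B v = Tgt B w"
      and eq: "Cmp B v u = Cmp B w (far P f)" using z by simp_all
    let ?f = "pairarr (Couple x (Idn B (fob P x))) (Couple y (Idn B (fob P y))) f (far P f)"
    have "Cmp E (far L (pairarr (Couple x u) (Couple y w) f v)) (far L (d x u)) =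
      far L (pairarr (Couple x (Idn B (fob P x))) (Couple y w) f (Cmp B w (far P f)))"
      using L_cmp[OF d_arr[of x u] z] by (simp add: eq)
    also have "\<dots> = Cmp E (far L (d y w)) (far L ?f)"
      using L_cmp[of ?f "d y w"] by simp
    also have "far L ?f = f" using unit_ar[of f] by simp
    finally show ?thesis by simp
  qed
  show "comma_action X L"
    unfolding comma_action_def total_def X_simps(1) using ob ar proj L by blast
qed

end

section \<open>The comparison isomorphism\<close>

definition preserves_lifts :: "'a cloven \<Rightarrow> 'a fctr \<Rightarrow> 'a fctr \<Rightarrow> 'a
  cloven \<Rightarrow> bool" where
  "preserves_lifts X T S Y \<longleftrightarrow> (\<forall>x u. liftable X x u \<longrightarrow> far T
    (lift X x u) = lift Y (fob T x) (far S u))"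

lemma SCoFib_structured:
  "SCoFib small = structured (CAT2 small)
     {X. split_cofibration X \<and> locally_small small (fsrc (proj X)) \<and> locally_small small (ftgt
       (proj X))} proj
     (\<lambda>X F Y. preserves_lifts X (fst (fr_cell F)) (snd (fr_cell F)) Y) (\<lambda>X \<phi> Y. True)"
proof -
  have "{X. proj X \<in> Ob (CAT2 small) \<and> split_cleavage X} =
      {X. split_cofibration X \<and> locally_small small (fsrc (proj X)) \<and> locally_small small (ftgt
        (proj X))}"
    by (auto simp: split_cofibration_def)
  then show ?thesis unfolding SCoFib_def preserves_lifts_def by (simp only:)
qed

lemma preserves_liftsD:
  assumes "preserves_lifts X T S Y" "x \<in> Obj (fsrc (proj X))" "u \<in> Arr (ftgt (proj X))"
    "Src (ftgt (proj X)) u = fob (proj X) x"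
  shows "far T (lift X x u) = lift Y (fob T x) (far S u)"
  using assms by (simp add: preserves_lifts_def liftable_def total_def base_def)

lemma preserves_lifts_id:
  assumes "split_cofibration X"
  shows "preserves_lifts X (id_functor (fsrc (proj X))) (id_functor (ftgt (proj X))) X"
proof -
  interpret X: split_cofibration X by fact
  show ?thesis by (simp add: preserves_lifts_def liftable_def)
qed

lemma preserves_lifts_comp:
  assumes "split_cofibration X" and sq: "is_square (proj X) T S (proj Y)"
    and "preserves_lifts X T S Y" "preserves_lifts Y T' S' Z"
  shows "preserves_lifts X (comp_functor T' T) (comp_functor S' S) Z"
proof -
  interpret X: split_cofibration X by fact
  show ?thesis
    unfolding preserves_lifts_def liftable_def X.total X.base
    using is_squareD(1-10)[OF sq] by (simp add: preserves_liftsD[OF assms(3)] preserves_liftsD[OF assms(4)])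
qed

lemma two_category_SCoFib: "two_category (SCoFib small)"
  unfolding SCoFib_structured
proof (rule structured_two_category, goal_cases)
  case (4 X Y Z F G)
  then show ?case by (auto intro: preserves_lifts_comp)
qed (auto simp: two_category_arrow2 split_cofibration.is_functor_proj preserves_lifts_id)

text \<open>If lifts are preserved, the image under \<open>T\<close> of a lift is a lift of
  \<open>Y\<close> and can be cancelled, so the two functors agree on arrows. Conversely, evaluate
  at the arrow (1, u): by \<open>lift_L\<close> both actions return lifts there.\<close>

lemma preserves_lifts_iff:
  assumes X: "split_cofibration X" and Y: "split_cofibration Y" and sq: "is_square (proj X) T S (proj Y)"
  shows "preserves_lifts X T S Y \<longleftrightarrow>
    comp_functor T (L_functor X) = comp_functor (L_functor Y) (comma_functor (frame (proj X) (T, S) (proj Y)))"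
proof
  interpret X: split_cofibration X by fact
  interpret Y: split_cofibration Y by fact
  let ?C = "comma_functor (frame (proj X) (T, S) (proj Y))"
  note sq' [simp] = is_squareD(1-10)[OF sq]
  assume pres: "preserves_lifts X T S Y"
  show "comp_functor T (L_functor X) = comp_functor (L_functor Y) ?C"
  proof (rule comp_functor_eqI, goal_cases)
    case (9 p)
    then have p: "p \<in> Obj (comma X.P)" and mem: "fob ?C p \<in> Obj (comma Y.P)"
      using X.L_functor(2) Y.L_functor(2) by (simp_all only:)
    note p' = comma_ObjD[OF p]
    have "fob T (Tgt X.E (X.\<delta> (left p) (right p))) = Tgt Y.E (far T (X.\<delta> (left p) (right p)))"
      using p' by simp
    then show ?case
      using Y.L_functor(4)[OF mem] p p' by (simp add: X.L_functor(4) preserves_liftsD[OF pres] del: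
        Couple_in_comma)
  next
    case (10 z)
    then have z: "z \<in> Arr (comma X.P)" and mem: "far ?C z \<in> Arr (comma Y.P)"
      using X.L_functor(2) Y.L_functor(2) by (simp_all only:)
    note z' = comma_ArrD[OF z]
    note src = comma_ObjD[OF z'(1)] and tgt = comma_ObjD[OF z'(2)]
    let ?x = "left (pa_src z)" and ?u = "right (pa_src z)" and ?y = "left (pa_tgt z)" and ?w = "right
      (pa_tgt z)"
    note LX = X.L_arr[OF z] and LY = Y.L_arr[OF mem]
    have C: "left (pa_src (far ?C z)) = fob T ?x" "right (pa_src (far ?C z)) = far S ?u"
      "left (pa_tgt (far ?C z)) = fob T ?y" "right (pa_tgt (far ?C z)) = far S ?w"
      "pa_fst (far ?C z) = far T (pa_fst z)" "pa_snd (far ?C z) = far S (pa_snd z)"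
      using z by simp_all
    have T\<delta>: "lift Y (fob T ?x) (far S ?u) = far T (X.\<delta> ?x ?u)" "lift Y (fob T ?y) (far S ?w)
      = far T (X.\<delta> ?y ?w)"
      using src tgt by (simp_all add: preserves_liftsD[OF pres])
    have "Cmp Y.E (far T (far (L_functor X) z)) (far T (X.\<delta> ?x ?u)) = Cmp Y.E (far T (X.\<delta> ?y
      ?w)) (far T (pa_fst z))"
      by (rule functor_Cmp_eq[of T X.E]) (use X.L_functor(6)[OF z] LX src tgt z'(1-8) in simp_all)
    then have eq: "Cmp Y.E (far T (far (L_functor X) z)) (lift Y (fob T ?x) (far S ?u)) =
        Cmp Y.E (far (L_functor Y) (far ?C z)) (lift Y (fob T ?x) (far S ?u))"
      using Y.L_functor(6)[OF mem] unfolding C T\<delta> by simp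
    show ?case
    proof (rule Y.lift_cancel[of "fob T ?x" "far S ?u"])
      show "Src Y.E (far T (far (L_functor X) z)) = Tgt Y.E (lift Y (fob T ?x) (far S ?u))"
        unfolding T\<delta> using LX src by simp
      show "Src Y.E (far (L_functor Y) (far ?C z)) = Tgt Y.E (lift Y (fob T ?x) (far S ?u))"
        using LY(2) unfolding C .
      show "far Y.P (far T (far (L_functor X) z)) = far Y.P (far (L_functor Y) (far ?C z))"
        unfolding Y.L_functor(7)[OF mem] C using LX X.L_functor(7)[OF z] by simp
    qed (use src LX(1) LY(1) eq in simp_all)
  qed (use is_functor_comma_functor[OF sq] X.L_functor(1-3) Y.L_functor(1-3) in simp_all)
next
  interpret X: split_cofibration X by fact
  interpret Y: split_cofibration Y by fact
  let ?C = "comma_functor (frame (proj X) (T, S) (proj Y))"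
  note sq' [simp] = is_squareD(1-10)[OF sq]
  assume eq: "comp_functor T (L_functor X) = comp_functor (L_functor Y) ?C"
  show "preserves_lifts X T S Y"
    unfolding preserves_lifts_def liftable_def X.total X.base
  proof (intro allI impI)
    fix x u assume xu: "x \<in> Obj X.E \<and> u \<in> Arr X.B \<and> Src X.B u = fob X.P x"
    let ?z = "pairarr (Couple x (Idn X.B (fob X.P x))) (Couple x u) (Idn X.E x) u"
    have z: "?z \<in> Arr (comma X.P)" using xu by simp
    have "far T (far (L_functor X) ?z) = far (L_functor Y) (far ?C ?z)"
      using arg_cong[OF eq, of "\<lambda>F. far F ?z"] comp_functor_simps(4)[of ?z "L_functor X" T]
        comp_functor_simps(4)[of ?z ?C "L_functor Y"] z X.L_functor(2) by (simp del: pairarr_in_comma)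
    moreover have "far ?C ?z = pairarr (Couple (fob T x) (Idn Y.B (fob Y.P (fob T x)))) (Couple (fob T x)
      (far S u))
        (Idn Y.E (fob T x)) (far S u)"
      using comma_functor_simps(4)[OF z, of T S Y.P] xu by simp
    ultimately show "far T (X.\<delta> x u) = Y.\<delta> (fob T x) (far S u)"
      using X.lift_L[of x u] Y.lift_L[of "fob T x" "far S u"] xu by simp
  qed
qed

text \<open>This is why 2-cells of \<open>SCoFib\<close> carry no condition beyond that of
  \<open>CAT2\<close>. At (x, u) the two components lie over the same base arrow and agree after the
  preserved lift, by naturality of \<beta> at the lift of u.\<close>

lemma L_functor_2cell:
  assumes X: "split_cofibration X" and Y: "split_cofibration Y" and sq: "is_square2 (proj X) \<beta>
    \<alpha> (proj Y)"
    and pres: "preserves_lifts X (nsrc \<beta>) (nsrc \<alpha>) Y" "preserves_lifts X (ntgt \<beta>) (ntgt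
      \<alpha>) Y"
  shows "whisker_right (CAT small) \<beta> (L_functor X) =
    whisker_left (CAT small) (L_functor Y) (comma_ntrans (frame (proj X) (\<beta>, \<alpha>) (proj Y)))"
proof -
  interpret X: split_cofibration X by fact
  interpret Y: split_cofibration Y by fact
  note sqs = is_square2D(3,4)[OF sq]
  note [simp] = is_square2D[OF sq] is_squareD(1-10)[OF sqs(1)] is_squareD(9,10)[OF sqs(2)]
    is_nat_trans_comma_ntrans[OF sq] X.L_functor(1-3) Y.L_functor(1-3)
  let ?C = "comma_ntrans (frame (proj X) (\<beta>, \<alpha>) (proj Y))"
  show ?thesis
  proof (rule ntrans_eqI, goal_cases)
    case (5 p)
    then have p: "p \<in> Obj (comma X.P)" by simp
    note p' = comma_ObjD[OF p]
    let ?x = "left p" and ?u = "right p"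
    have mem: "ncmp ?C p \<in> Arr (comma Y.P)"
      by (rule is_nat_transD(5)[OF is_nat_trans_comma_ntrans[OF sq]]) (use p in simp_all)
    have C: "left (pa_src (ncmp ?C p)) = fob (nsrc \<beta>) ?x" "right (pa_src (ncmp ?C p)) = far (nsrc
      \<alpha>) ?u"
      "left (pa_tgt (ncmp ?C p)) = fob (ntgt \<beta>) ?x" "right (pa_tgt (ncmp ?C p)) = far (ntgt \<alpha>) ?u"
      "pa_fst (ncmp ?C p) = ncmp \<beta> ?x" "pa_snd (ncmp ?C p) = ncmp \<alpha> (Tgt X.B ?u)"
      using p by simp_all
    have T\<delta>: "lift Y (fob (nsrc \<beta>) ?x) (far (nsrc \<alpha>) ?u) = far (nsrc \<beta>)
      (X.\<delta> ?x ?u)"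
      "lift Y (fob (ntgt \<beta>) ?x) (far (ntgt \<alpha>) ?u) = far (ntgt \<beta>) (X.\<delta> ?x ?u)"
      using p' by (simp_all add: preserves_liftsD[OF pres(1)] preserves_liftsD[OF pres(2)])
    let ?b = "ncmp \<beta> (Tgt X.E (X.\<delta> ?x ?u))"
    have "Cmp Y.E ?b (far (nsrc \<beta>) (X.\<delta> ?x ?u)) = Cmp Y.E (far (ntgt \<beta>) (X.\<delta> ?x
      ?u)) (ncmp \<beta> ?x)"
      using nat_trans_square[of \<beta> X.E Y.E "X.\<delta> ?x ?u" ?x, OF _ _ _ _ _ refl] p' by simp
    then have eq: "Cmp Y.E ?b (lift Y (fob (nsrc \<beta>) ?x) (far (nsrc \<alpha>) ?u)) =
        Cmp Y.E (far (L_functor Y) (ncmp ?C p)) (lift Y (fob (nsrc \<beta>) ?x) (far (nsrc \<alpha>) ?u))"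
      using Y.L_functor(6)[OF mem] unfolding C T\<delta> by simp
    note LY = Y.L_arr[OF mem, unfolded C]
    have "?b = far (L_functor Y) (ncmp ?C p)"
    proof (rule Y.lift_cancel[of "fob (nsrc \<beta>) ?x" "far (nsrc \<alpha>) ?u"])
      show "Src Y.E ?b = Tgt Y.E (lift Y (fob (nsrc \<beta>) ?x) (far (nsrc \<alpha>) ?u))"
        unfolding T\<delta> using p' by simp
      show "far Y.P ?b = far Y.P (far (L_functor Y) (ncmp ?C p))"
        unfolding Y.L_functor(7)[OF mem] C using p' by simp
    qed (use p' LY(1,2) eq in simp_all)
    then show ?case using p mem by (simp add: X.L_functor(4) del: comma_ntrans_simps(3))
  qed (simp_all add: preserves_lifts_iff[OF X Y sqs(1), THEN iffD1, OF pres(1)]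
      preserves_lifts_iff[OF X Y sqs(2), THEN iffD1, OF pres(2)])
qed

section \<open>\<Gamma> on objects and cells, and its inverse\<close>

abbreviation "Gamma_ob X \<equiv> (proj X, frame (Cod (proj X)) (L_functor X, id_functor (base X)) (proj X))"

lemma is_strict_algebra_Gamma:
  assumes small: "smallness small" and X: "split_cofibration X"
    and ls: "locally_small small (fsrc (proj X))" "locally_small small (ftgt (proj X))"
  shows "is_strict_algebra (CAT2 small) comma_monad (Gamma_ob X)"
proof -
  interpret X: split_cofibration X by fact
  show ?thesis
    unfolding is_strict_algebra_def
    by (simp add: comma_monad_def ls X.is_square_L locally_small_comma[OF small] X.L_unit X.L_mult)
qed

text \<open>The base half of the unit law says that the base component composed with an identity is
  an identity, so the only datum of the action besides \<open>P\<close> is \<open>L\<close>.\<close>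

lemma AlgC_objE:
  assumes "is_strict_algebra (CAT2 small) comma_monad Pa"
  obtains P L where "Pa = (P, frame (Cod P) (L, id_functor (ftgt P)) P)" "comma_algebra P L"
    "locally_small small (fsrc P)" "locally_small small (ftgt P)"
proof -
  obtain P a where Pa: "Pa = (P, a)" by (cases Pa)
  note alg = is_strict_algebraD[OF assms, unfolded Pa fst_conv snd_conv]
  have P: "is_functor P" and ls: "locally_small small (fsrc P)" "locally_small small (ftgt P)"
    using alg(1) by simp_all
  have ends: "fr_src a = Cod P" "fr_tgt a = P"
    using alg(3,4) by (simp_all add: comma_monad_def)
  from alg(2) obtain L S where a_eq: "a = frame (Cod P) (L, S) P" and sq: "is_square (Cod P) L S P"
    by (rule CAT2_Cell1E) (use ends in simp)
  note unit = alg(5) and mult = alg(6)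
  note sq' = is_squareD[OF sq]
  have "comp_functor S (id_functor (ftgt P)) = S" by (rule comp_functor_id) (use sq' in simp_all)
  then have S: "S = id_functor (ftgt P)" using unit by (simp add: a_eq comma_monad_def)
  have "comp_functor S (Cod P) = Cod P" unfolding S by (rule comp_functor_id) (use P in simp_all)
  then have "comma_algebra P L"
    using sq' unit mult P by unfold_locales (simp_all add: a_eq S comma_monad_def)
  then show thesis using that Pa a_eq S ls by blast
qed

lemma Gamma_structured:
  "Gamma = \<lparr>on0 = \<lambda>X. Gamma_ob X, on1 = (\<lambda>F. frame (Gamma_ob (fr_src F)) (fr_cell F)
    (Gamma_ob (fr_tgt F))),
     on2 = (\<lambda>\<phi>. frame (Gamma_ob (fr_src \<phi>)) (fr_cell \<phi>) (Gamma_ob (fr_tgt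
       \<phi>)))\<rparr>"
  by (simp add: Gamma_def Let_def)

text \<open>The base half of the algebra equation is \<open>S 1 = 1 S\<close>; the total half is the
  equation treated in \<open>preserves_lifts_iff\<close>.\<close>

lemma Gamma_morphism:
  assumes "split_cofibration X" "split_cofibration Y" "is_square (proj X) T S (proj Y)"
  shows "preserves_lifts X T S Y \<longleftrightarrow>
    comp1 (CAT2 small) (frame (proj X) (T, S) (proj Y)) (snd (Gamma_ob X)) =
    comp1 (CAT2 small) (snd (Gamma_ob Y)) (on1 (endo comma_monad) (frame (proj X) (T, S) (proj Y)))"
  using preserves_lifts_iff[OF assms] is_squareD(3,7,8)[OF assms(3)]
  by (simp add: comma_monad_def base_def)

lemma two_functor_Gamma:
  assumes small: "smallness small"
  shows "two_functor (SCoFib small) (AlgC small) Gamma"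
proof -
  have "two_category (AlgC small)" by (rule two_category_Alg[OF two_functor_comma[OF small]])
  then show ?thesis
    using two_category_SCoFib[of small]
    unfolding Gamma_structured SCoFib_structured Alg_def
  proof (intro two_functor_structured_id, goal_cases)
    case 1 show ?case by (simp add: two_category_arrow2)
  next
    case (4 X)
    then show ?case
      using is_strict_algebra_Gamma[OF small, of X] split_cofibration.is_functor_proj[of X] by (simp add: )
  next
    case (5 X F Y)
    then have XY: "split_cofibration X" "split_cofibration Y" and F: "F \<in> Cell1 (CAT2 small)" "fr_src F
      = proj X" "fr_tgt F = proj Y"
      and pres: "preserves_lifts X (fst (fr_cell F)) (snd (fr_cell F)) Y" by simp_all
    from F(1) obtain T S where F_eq: "F = frame (proj X) (T, S) (proj Y)" and sq: "is_square (proj X) T S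
      (proj Y)"
      by (rule CAT2_Cell1E) (use F in simp)
    show ?case using Gamma_morphism[OF XY sq, of small] pres by (simp add: F_eq )
  next
    case (6 X \<phi> Y)
    then have XY: "split_cofibration X" "split_cofibration Y" and \<phi>: "\<phi> \<in> Cell2 (CAT2 small)"
      "fr_src \<phi> = proj X" "fr_tgt \<phi> = proj Y"
      and pres: "preserves_lifts X (nsrc (fst (fr_cell \<phi>))) (nsrc (snd (fr_cell \<phi>))) Y"
        "preserves_lifts X (ntgt (fst (fr_cell \<phi>))) (ntgt (snd (fr_cell \<phi>))) Y" by simp_all
    from \<phi>(1) obtain \<beta> \<alpha> where \<phi>_eq: "\<phi> = frame (proj X) (\<beta>, \<alpha>)
      (proj Y)" and sq: "is_square2 (proj X) \<beta> \<alpha> (proj Y)"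
      by (rule CAT2_Cell2E) (use \<phi> in simp)
    show ?case
      using L_functor_2cell[OF XY sq, of small] pres is_square2_whisker_id[OF sq, of small]
      by (simp add: \<phi>_eq arrow2_whisker comma_monad_def base_def)
  qed
qed

definition Gamma_inverse ::
  "('a fctr \<times> 'a square1, ('a fctr \<times> 'a square1, 'a square1) framed, ('a fctr \<times> 'a
    square1, 'a square2) framed,
    'a cloven, ('a cloven, 'a square1) framed, ('a cloven, 'a square2) framed) two_map" where
  "Gamma_inverse = (let ob = (\<lambda>(P, a). algebra_cloven P (fst (fr_cell a))) in
     \<lparr>on0 = ob, on1 = (\<lambda>F. frame (ob (fr_src F)) (fr_cell F) (ob (fr_tgt F))),
       on2 = (\<lambda>\<phi>. frame (ob (fr_src \<phi>)) (fr_cell \<phi>) (ob (fr_tgt \<phi>)))\<rparr>)"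

lemma proj_algebra_cloven [simp]: "proj (algebra_cloven P L) = P"
  by (simp add: algebra_cloven_def)

lemma split_cofibration_algebra_cloven:
  assumes "comma_algebra P L"
  shows "split_cofibration (algebra_cloven P L)"
proof -
  interpret comma_algebra P L by fact
  show ?thesis by standard (simp_all add: split_cleavage_X)
qed

lemma Gamma_ob_algebra_cloven:
  assumes "comma_algebra P L"
  shows "Gamma_ob (algebra_cloven P L) = (P, frame (Cod P) (L, id_functor (ftgt P)) P)"
proof -
  interpret comma_algebra P L by fact
  show ?thesis by (simp add: L_functor_X base_def)
qed

text \<open>Where a lift exists this is \<open>lift_L\<close>. Elsewhere \<open>cleavage\<close> and
  \<open>algebra_cloven\<close> prescribe the same default \<open>undefined\<close>, which makes the
  equality of records strict.\<close>

lemma algebra_cloven_L_functor: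
  assumes "split_cofibration X"
  shows "algebra_cloven (proj X) (L_functor X) = X"
proof -
  interpret X: split_cofibration X by fact
  have "(if Couple x u \<in> Obj (comma X.P) then far (L_functor X)
      (pairarr (Couple x (Idn X.B (fob X.P x))) (Couple x u) (Idn X.E x) u) else undefined) = lift X x u"
        for x u
    using X.cleavage X.lift_L[of x u] by (auto simp: cleavage_def liftable_def)
  then show ?thesis by (simp add: algebra_cloven_def)
qed

lemma two_functor_Gamma_inverse:
  assumes small: "smallness small"
  shows "two_functor (AlgC small) (SCoFib small) Gamma_inverse"
proof -
  have "two_category (AlgC small)" by (rule two_category_Alg[OF two_functor_comma[OF small]])
  then show ?thesis
    using two_category_SCoFib[of small]
    unfolding Gamma_inverse_def Let_def SCoFib_structured Alg_def
  proof (intro two_functor_structured_id, goal_cases)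
    case 1 show ?case by (simp add: two_category_arrow2)
  next
    case (4 Pa)
    then have "is_strict_algebra (CAT2 small) comma_monad Pa" by simp
    then show ?case
      by (rule AlgC_objE) (simp add: split_cofibration_algebra_cloven comma_algebra.P)
  next
    case (5 Pa F Qb)
    then have "is_strict_algebra (CAT2 small) comma_monad Pa" "is_strict_algebra (CAT2 small) comma_monad
      Qb" by simp_all
    then obtain P L Q M where PL: "Pa = (P, frame (Cod P) (L, id_functor (ftgt P)) P)" "comma_algebra P L"
      and QM: "Qb = (Q, frame (Cod Q) (M, id_functor (ftgt Q)) Q)" "comma_algebra Q M"
      by (elim AlgC_objE) blast
    let ?X = "algebra_cloven P L" and ?Y = "algebra_cloven Q M"
    note XY = split_cofibration_algebra_cloven[OF PL(2)] split_cofibration_algebra_cloven[OF QM(2)]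
    have F: "F \<in> Cell1 (CAT2 small)" "fr_src F = P" "fr_tgt F = Q" using 5 by (simp_all add: PL(1) QM(1))
    from F(1) obtain T S where F_eq: "F = frame P (T, S) Q" and sq: "is_square P T S Q"
      by (rule CAT2_Cell1E) (use F in simp)
    \<comment> \<open>\<Gamma> returns the two given algebras, so the converse direction of
      \<open>Gamma_morphism\<close> turns the algebra equation for the square into preservation of
      lifts.\<close>
    show ?case
      using Gamma_morphism[OF XY, unfolded proj_algebra_cloven, OF sq, of small] 5(8)
      unfolding Gamma_ob_algebra_cloven[OF PL(2), unfolded proj_algebra_cloven] Gamma_ob_algebra_cloven[OF
        QM(2), unfolded proj_algebra_cloven]
      by (simp add: F_eq PL(1) QM(1))
  \<comment> \<open>What is left are the two structured 2-categories, already available, and the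
    condition on 2-cells, which in \<open>SCoFib\<close> is \<open>True\<close>.\<close>
  qed (assumption | rule TrueI)+
qed

text \<open>Cells are carried unchanged inside their frames, so both round trips reduce to the
  objects at the ends of the frame.\<close>

lemma two_isomorphism_Gamma:
  assumes small: "smallness small"
  shows "two_isomorphism (SCoFib small) (AlgC small) Gamma"
proof -
  let ?G = "Gamma_inverse"
  have GX: "on0 ?G (on0 Gamma X) = X" if "X \<in> Ob (SCoFib small)" for X
    using that algebra_cloven_L_functor[of X] by (simp add: SCoFib_structured Gamma_structured
      Gamma_inverse_def Let_def)
  have XG: "on0 Gamma (on0 ?G Pa) = Pa" if "Pa \<in> Ob (AlgC small)" for Pa
  proof -
    have "is_strict_algebra (CAT2 small) comma_monad Pa" using that by (simp add: Alg_def)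
    then show ?thesis
      by (rule AlgC_objE) (simp add: Gamma_structured Gamma_inverse_def comma_algebra.L_functor_X base_def
        Let_def)
  qed
  have "two_functor_eq (SCoFib small) (two_comp ?G Gamma) two_id"
    using GX unfolding two_functor_eq_def two_comp_def two_id_def
    by (auto simp: SCoFib_structured structured_Cell1 structured_Cell2 Gamma_structured Gamma_inverse_def
      Let_def)
  moreover have "two_functor_eq (AlgC small) (two_comp Gamma ?G) two_id"
    using XG unfolding two_functor_eq_def two_comp_def two_id_def
    by (auto simp: Alg_def structured_Cell1 structured_Cell2 Gamma_structured Gamma_inverse_def Let_def)
  ultimately show ?thesis
    unfolding two_isomorphism_def using two_functor_Gamma[OF small] two_functor_Gamma_inverse[OF small] by blast
qed

section \<open>The factorization selected by a split cofibration\<close>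

context split_cofibration
begin

lemma nu:
  assumes f: "f \<in> Arr E"
  shows "nu X f \<in> Arr E" "Src E (nu X f) = Tgt E (\<delta> (Src E f) (far P f))" "Tgt E (nu X f) = Tgt E f"
    "Cmp E (nu X f) (\<delta> (Src E f) (far P f)) = f" "far P (nu X f) = Idn B (fob P (Tgt E f))"
proof -
  let ?d = "\<delta> (Src E f) (far P f)"
  let ?Q = "\<lambda>h. h \<in> hom E (Tgt E ?d) (Tgt E f) \<and> Cmp E h ?d = f \<and> far P h = Idn B
    (fob P (Tgt E f))"
  obtain h where "?Q h"
    by (rule cocartesianE[OF lift_cocartesian[of "Src E f" "far P f"], of f "Idn B (fob P (Tgt E f))"])
      (use f in \<open>auto simp: hom_def\<close>)
  moreover have "k = h" if "?Q k" "?Q h" for k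
    by (rule lift_cancel[of "Src E f" "far P f"]) (use that f in \<open>auto simp: hom_def\<close>)
  ultimately have "\<exists>!h. ?Q h" by blast
  then have "?Q (nu X f)" unfolding nu_def Let_def push_ob total base by (rule theI')
  then show "nu X f \<in> Arr E" "Src E (nu X f) = Tgt E ?d" "Tgt E (nu X f) = Tgt E f"
    "Cmp E (nu X f) ?d = f" "far P (nu X f) = Idn B (fob P (Tgt E f))"
    by (simp_all add: hom_def)
qed

text \<open>Used to recognize \<nu>: as the right factor selected by the algebra, and as the image
  of \<nu> under a square that preserves lifts.\<close>

lemma nu_unique:
  assumes f: "f \<in> Arr E" and h: "h \<in> Arr E" "Src E h = Tgt E (\<delta> (Src E f) (far P f))"
    "Cmp E h (\<delta> (Src E f) (far P f)) = f" "far P h = Idn B (fob P (Tgt E f))"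
  shows "h = nu X f"
  by (rule lift_cancel[of "Src E f" "far P f"]) (use f h nu[OF f] in simp_all)

lemma is_functor_F_action: "is_functor (F_action X)" "fsrc (F_action X) = arrow_cat E" "ftgt (F_action X) = E"
  by (simp_all add: F_action_def L_functor(1-3))

lemma fob_F_action: "f \<in> Arr E \<Longrightarrow> fob (F_action X) f = Tgt E (\<delta> (Src E f) (far P f))"
  by (simp add: F_action_def L_functor(4))

lemma far_F_action:
  assumes z: "z \<in> Arr (arrow_cat E)"
  defines "t \<equiv> far (F_action X) z"
  shows "t \<in> Arr E" "Src E t = Tgt E (\<delta> (Src E (pa_src z)) (far P (pa_src z)))"
    "Tgt E t = Tgt E (\<delta> (Src E (pa_tgt z)) (far P (pa_tgt z)))"
    "Cmp E t (\<delta> (Src E (pa_src z)) (far P (pa_src z))) = Cmp E (\<delta> (Src E (pa_tgt z)) (far P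
      (pa_tgt z))) (pa_fst z)"
    "far P t = far P (pa_snd z)"
proof -
  have mem: "far (kappa P) z \<in> Arr (comma P)"
    by (rule is_functorD(4)[OF is_functor_kappa]) (use z in simp_all)
  have t: "t = far (L_functor X) (far (kappa P) z)"
    using z by (simp add: t_def F_action_def)
  show "t \<in> Arr E" "Src E t = Tgt E (\<delta> (Src E (pa_src z)) (far P (pa_src z)))"
    "Tgt E t = Tgt E (\<delta> (Src E (pa_tgt z)) (far P (pa_tgt z)))"
    "Cmp E t (\<delta> (Src E (pa_src z)) (far P (pa_src z))) = Cmp E (\<delta> (Src E (pa_tgt z)) (far P
      (pa_tgt z))) (pa_fst z)"
    "far P t = far P (pa_snd z)"
    using L_arr[OF mem] L_functor(6,7)[OF mem] unfolding t by (simp_all add: kappa_simps(4)[OF z])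
qed

text \<open>After the lift at the source both sides become the diagonal of \<open>z\<close>, and
  both lie over the image of \<open>pa_snd z\<close> because \<nu> is vertical; the lift
  cancels.\<close>

lemma nu_F_action:
  assumes z: "z \<in> Arr (arrow_cat E)"
  shows "Cmp E (nu X (pa_tgt z)) (far (F_action X) z) = Cmp E (pa_snd z) (nu X (pa_src z))"
proof -
  note z' = arrow_cat_ArrD(1-8)[OF z]
  note f = nu[OF z'(1)] and g = nu[OF z'(2)] and t = far_F_action[OF z]
  let ?d = "\<delta> (Src E (pa_src z)) (far P (pa_src z))"
  have "Cmp E (Cmp E (nu X (pa_tgt z)) (far (F_action X) z)) ?d = Cmp E (nu X (pa_tgt z)) (Cmp E (far
    (F_action X) z) ?d)"
    by (rule Cmp_assoc) (use z' g t(1-3) in simp_all)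
  also have "\<dots> = Cmp E (Cmp E (nu X (pa_tgt z)) (\<delta> (Src E (pa_tgt z)) (far P (pa_tgt z))))
    (pa_fst z)"
    unfolding t(4) by (rule Cmp_assoc[symmetric]) (use z' g(1-3) in simp_all)
  also have "\<dots> = Cmp E (pa_snd z) (Cmp E (nu X (pa_src z)) ?d)"
    unfolding g(4) f(4) by (rule arrow_cat_ArrD(9)[OF z, symmetric])
  also have "\<dots> = Cmp E (Cmp E (pa_snd z) (nu X (pa_src z))) ?d"
    by (rule Cmp_assoc[symmetric]) (use z' f(1-3) in simp_all)
  finally have eq: "Cmp E (Cmp E (nu X (pa_tgt z)) (far (F_action X) z)) ?d = \<dots>" .
  show ?thesis
  proof (rule lift_cancel[OF _ _ _ _ _ _ _ eq])
    show "far P (Cmp E (nu X (pa_tgt z)) (far (F_action X) z)) = far P (Cmp E (pa_snd z) (nu X (pa_src z)))"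
      using z' f(1-3,5) g(1-3,5) t(1-3,5) by simp
  qed (use z' f(1-3) g(1-3) t(1-3) in simp_all)
qed

text \<open>In each of the two squares one side is an identity, whose lift is an identity by
  splitness. For \<open>sel_e\<close> the equation for the action then gives the lift itself. For
  \<open>sel_m\<close> it gives a vertical arrow whose composite with the lift is \<open>f\<close>,
  that is, \<nu>.\<close>

lemma sel_F_action:
  assumes f: "f \<in> Arr E"
  shows "sel_e E (F_action X) f = \<delta> (Src E f) (far P f)" "sel_m E (F_action X) f = nu X f"
proof -
  let ?e = "pairarr (Idn E (Src E f)) f (Idn E (Src E f)) f" and ?m = "pairarr f (Idn E (Tgt E f)) f (Idn E
    (Tgt E f))"
  have e: "?e \<in> Arr (arrow_cat E)" and m: "?m \<in> Arr (arrow_cat E)" using f by simp_all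
  show "sel_e E (F_action X) f = \<delta> (Src E f) (far P f)"
    unfolding sel_e_def using far_F_action[OF e] f by simp
  show "sel_m E (F_action X) f = nu X f"
    unfolding sel_m_def by (rule nu_unique) (use far_F_action[OF m] f in simp_all)
qed

end

text \<open>A square over \<open>S\<close> sends vertical arrows to vertical arrows, and the lift
  that \<open>f\<close> factors through to the corresponding lift of \<open>Y\<close>; so the image
  of \<nu> has the characterizing properties of \<nu> at \<open>far T f\<close>.\<close>

lemma preserves_nu:
  assumes "split_cofibration X" "split_cofibration Y" and sq: "is_square (proj X) T S (proj Y)"
    and pres: "preserves_lifts X T S Y" and f: "f \<in> Arr (fsrc (proj X))"
  shows "far T (lift X (Src (fsrc (proj X)) f) (far (proj X) f)) =
      lift Y (fob T (Src (fsrc (proj X)) f)) (far (proj Y) (far T f))"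
    and "far T (nu X f) = nu Y (far T f)"
proof -
  interpret X: split_cofibration X by fact
  interpret Y: split_cofibration Y by fact
  note [simp] = is_squareD(1-10)[OF sq] f
  let ?d = "X.\<delta> (Src X.E f) (far X.P f)"
  show T\<delta>: "far T ?d = Y.\<delta> (fob T (Src X.E f)) (far Y.P (far T f))"
    by (simp add: preserves_liftsD[OF pres])
  note n = X.nu[OF f]
  show "far T (nu X f) = nu Y (far T f)"
  proof (rule Y.nu_unique)
    have "Cmp Y.E (far T (nu X f)) (far T ?d) = far T (Cmp X.E (nu X f) ?d)"
      by (rule functor_Cmp_fold) (use n(1-3) in simp_all)
    then show "Cmp Y.E (far T (nu X f)) (Y.\<delta> (Src Y.E (far T f)) (far Y.P (far T f))) = far T f"
      using n(4) T\<delta> by simp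
    have "Src Y.E (far T (nu X f)) = Tgt Y.E (far T ?d)" using n(1-3) by simp
    then show "Src Y.E (far T (nu X f)) = Tgt Y.E (Y.\<delta> (Src Y.E (far T f)) (far Y.P (far T f)))"
      unfolding T\<delta> by simp
  qed (use n in simp_all)
qed

lemma two_functor_Fact:
  assumes small: "smallness small"
  shows "two_functor (SCoFib small) (AlgS small) (Fact small)"
  unfolding Fact_def by (rule two_functor_two_comp[OF two_functor_Gamma[OF small] two_functor_kappa_star[OF
    small]])

lemma Fact_simps:
  "on0 (Fact small) X = (fsrc (proj X), F_action X)"
  "on1 (Fact small) F = frame (on0 (Fact small) (fr_src F)) (fst (fr_cell (fr_cell F))) (on0 (Fact small)
    (fr_tgt F))"
  "on2 (Fact small) \<phi> = frame (on0 (Fact small) (fr_src \<phi>)) (fst (fr_cell (fr_cell \<phi>))) (on0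
    (Fact small) (fr_tgt \<phi>))"
  by (simp_all add: Fact_def kappa_star_def alg_pull_def Gamma_def two_comp_def Dom2_def F_action_def Let_def)

theorem theorem6p6:
  fixes small :: "'a univ set \<Rightarrow> bool"
  assumes "smallness small"
  shows
    "colax_morphism (CAT2 small) comma_monad (CAT small) squaring_monad (Dom2 (CAT small)) kappa \<and>
     two_isomorphism (SCoFib small) (AlgC small) Gamma \<and>
     two_functor (AlgC small) (AlgS small) (kappa_star small) \<and>
     two_functor (SCoFib small) (AlgS small) (Fact small) \<and>
     two_functor_eq (SCoFib small) (Fact small) (two_comp (kappa_star small) Gamma) \<and>
     two_functor (SCoFib small) (CAT2 small) (forget proj) \<and>
     two_functor (AlgS small) (CAT small) (forget fst) \<and>
     two_functor_eq (SCoFib small)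
       (two_comp (forget fst) (Fact small)) (two_comp (Dom2 (CAT small)) (forget proj)) \<and>
     (\<forall>X \<in> Ob (SCoFib small). let E = total X; B = base X; P = proj X; \<delta> = lift X; F = F_action X in
        on0 (Fact small) X = (E, F) \<and>
        F = comp_functor (L_functor X) (kappa P) \<and>
        is_functor F \<and> fsrc F = arrow_cat E \<and> ftgt F = E \<and>
        (\<forall>f \<in> Arr E. fob F f = push_ob X (far P f) (Src E f)) \<and>
        (\<forall>f g r s. pairarr f g r s \<in> Arr (arrow_cat E) \<longrightarrow>
           (let x = Src E f; x' = Src E g; t = far F (pairarr f g r s) in
              far P t = far P s \<and>
              Cmp E t (\<delta> x (far P f)) = Cmp E (\<delta> x' (far P g)) r \<and>
              Cmp E (nu X g) t = Cmp E s (nu X f) \<and>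
              factorization_morphism E (\<delta> x (far P f), nu X f) (\<delta> x' (far P g), nu X g) (r, t, s))) \<and>
        (\<forall>f \<in> Arr E. let x = Src E f; y = Tgt E f in
           nu X f \<in> hom E (push_ob X (far P f) x) y \<and>
           sel_e E F f = \<delta> x (far P f) \<and> sel_m E F f = nu X f \<and>
           f = Cmp E (nu X f) (\<delta> x (far P f)) \<and>
           far P (nu X f) = Idn B (fob P y))) \<and>
     (\<forall>X Y T S. frame X (frame (proj X) (T, S) (proj Y)) Y \<in> Cell1 (SCoFib small) \<longrightarrow>
        on1 (Fact small) (frame X (frame (proj X) (T, S) (proj Y)) Y) =
          frame (on0 (Fact small) X) T (on0 (Fact small) Y) \<and>
        comp_functor T (F_action X) = comp_functor (F_action Y) (sq_functor T) \<and>
        (\<forall>f \<in> Arr (total X).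
           far T (lift X (Src (total X) f) (far (proj X) f)) =
             lift Y (fob T (Src (total X) f)) (far (proj Y) (far T f)) \<and>
           far T (nu X f) = nu Y (far T f))) \<and>
     (\<forall>X Y \<beta> \<alpha>. frame X (frame (proj X) (\<beta>, \<alpha>) (proj Y)) Y \<in> Cell2 (SCoFib small) \<longrightarrow>
        on2 (Fact small) (frame X (frame (proj X) (\<beta>, \<alpha>) (proj Y)) Y) =
          frame (on0 (Fact small) X) \<beta> (on0 (Fact small) Y) \<and>
        whisker_right (CAT small) \<beta> (F_action X) =
          whisker_left (CAT small) (F_action Y) (sq_ntrans \<beta>))"
proof (intro conjI ballI allI impI, goal_cases)
  note Fact = two_functor_Fact[OF assms]
  have square: "split_cofibration X \<and> split_cofibration Y \<and> is_square (proj X) T S (proj Y)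
    \<and> preserves_lifts X T S Y"
    if "frame X (frame (proj X) (T, S) (proj Y)) Y \<in> Cell1 (SCoFib small)" for X Y T S
    using that by (simp add: SCoFib_structured structured_Cell1)
  {
    case 1 show ?case using assms by (rule colax_morphism_kappa)
  next
    case 2 show ?case using assms by (rule two_isomorphism_Gamma)
  next
    case 3 show ?case using assms by (rule two_functor_kappa_star)
  next
    case 4 show ?case by (rule Fact)
  next
    case 5 show ?case by (simp add: two_functor_eq_def Fact_def)
  next
    case 6 show ?case
      using two_category_SCoFib[of small] unfolding SCoFib_structured
      by (intro two_functor_forget) (simp_all add: two_category_arrow2 split_cofibration.is_functor_proj)
  next
    case 7 show ?case
      using two_category_Alg[OF two_functor_squaring[OF assms]] unfolding Alg_def
      by (intro two_functor_forget) (auto dest: is_strict_algebraD(1))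
  next
    case 8 show ?case by (simp add: two_functor_eq_def two_comp_def forget_def Dom2_def Fact_simps)
  next
    case (9 X)
    interpret X: split_cofibration X using 9 by (simp add: SCoFib_structured)
    have ar: "far X.P t = far X.P s \<and>
        Cmp X.E t (X.\<delta> (Src X.E f) (far X.P f)) = Cmp X.E (X.\<delta> (Src X.E g) (far X.P g)) r \<and>
        Cmp X.E (nu X g) t = Cmp X.E s (nu X f) \<and>
        factorization_morphism X.E (X.\<delta> (Src X.E f) (far X.P f), nu X f) (X.\<delta> (Src X.E g)
          (far X.P g), nu X g) (r, t, s)"
      if z: "pairarr f g r s \<in> Arr (arrow_cat X.E)" and t: "t = far (F_action X) (pairarr f g r s)" for
        f g r s t
    proof -
      note z' = arrow_cat_ArrD(1-8)[OF z, simplified pairarr_simps]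
      note F = X.far_F_action[OF z, folded t, simplified pairarr_simps]
      note n = X.nu_F_action[OF z, folded t, simplified pairarr_simps]
      show ?thesis
        unfolding factorization_morphism_def using F n X.nu(1-3)[OF z'(1)] X.nu(1-3)[OF z'(2)] z' by (simp
          add: hom_def)
    qed
    show ?case
      unfolding Let_def X.total X.base X.push_ob
      using ar X.nu X.sel_F_action X.fob_F_action X.is_functor_F_action
      by (auto simp: Fact_simps F_action_def[symmetric] hom_def)
  next
    case 10 show ?case by (simp add: Fact_simps)
  next
    case 11
    \<comment> \<open>The image lies among the 1-cells of \<open>AlgS\<close>, and the algebra
      equation contained in this membership is the claim.\<close>
    from two_functor_cells(5)[OF Fact this] show ?case
      by (simp add: Fact_simps Alg_def structured_Cell1 squaring_monad_def)
  next
    case (12 X Y T S f)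
    then show ?case using preserves_nu(1)[of X Y T S f] square[OF 12(1)] by (simp add: total_def)
  next
    case (13 X Y T S f)
    then show ?case using preserves_nu(2)[of X Y T S f] square[OF 13(1)] by (simp add: total_def)
  next
    case 14 show ?case by (simp add: Fact_simps)
  next
    case 15
    \<comment> \<open>Likewise the whiskered equation is part of membership in the 2-cells of
      \<open>AlgS\<close>.\<close>
    from two_functor_cells(9)[OF Fact this] show ?case
      by (simp add: Fact_simps Alg_def structured_Cell2 squaring_monad_def)
  }
qed

end
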